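(* Let $(r_n)_{n \in \mathbb{N}}$ be an increasing sequence of positive real numbers tending to infinity. Then there is a transcendental entire function $f$ in the Eremenko–Lyubich class $\mathcal{B}$ such that the maximum modulus set $\mathcal{M}(f)$ has a discontinuity at $r_n$, for all $n \in \mathbb{N}$.
   Context: For an entire function $f$, the maximum modulus is $M(r,f) := \max_{|z|=r}|f(z)|$ for $r \ge 0$, and the maximum modulus set is $\mathcal{M}(f) := \{z \in \mathbb{C} : |f(z)| = M(|z|,f)\}$. For $r>0$, we say that $\mathcal{M}(f)$ has a discontinuity at $r$ if there exist a connected component $\Gamma$ of $\mathcal{M}(f)$ and a point $z \in \Gamma$ with $|z| = r$ such that $\Gamma$ contains no points of modulus less than $r$. The Eremenko–Lyubich class $\mathcal{B}$ is the class of transcendental entire functions $f$ whose set of (finite) singular values is bounded, where singular values are those values through which some inverse branch of $f$ cannot be continued; equivalently, the set of finite critical values and finite asymptotic values of $f$ is bounded in $\mathbb{C}$. *)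

theory Defs
  imports "HOL-Complex_Analysis.Complex_Analysis"
begin

(* The supremum is a maximum for the continuous f and r >= 0 considered here. *)
definition max_modulus :: "real \<Rightarrow> (complex \<Rightarrow> complex) \<Rightarrow> real" where
  "max_modulus r f = (SUP z\<in>sphere 0 r. norm (f z))"

definition max_modulus_set :: "(complex \<Rightarrow> complex) \<Rightarrow> complex set" where
  "max_modulus_set f = {z. norm (f z) = max_modulus (norm z) f}"

definition max_modulus_discontinuity :: "(complex \<Rightarrow> complex) \<Rightarrow> real \<Rightarrow> bool" where
  "max_modulus_discontinuity f r \<longleftrightarrow>
     r > 0 \<and>
     (\<exists>\<Gamma> \<in> components (max_modulus_set f).
        \<exists>z \<in> \<Gamma>. norm z = r \<and> \<not> (\<exists>w \<in> \<Gamma>. norm w < r))"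

definition transcendental_entire :: "(complex \<Rightarrow> complex) \<Rightarrow> bool" where
  "transcendental_entire f \<longleftrightarrow>
     f holomorphic_on UNIV \<and> \<not> (\<exists>p :: complex poly. \<forall>z. f z = poly p z)"

definition critical_values :: "(complex \<Rightarrow> complex) \<Rightarrow> complex set" where
  "critical_values f = {f z | z. deriv f z = 0}"

definition asymptotic_values :: "(complex \<Rightarrow> complex) \<Rightarrow> complex set" where
  "asymptotic_values f =
     {a. \<exists>\<gamma> :: real \<Rightarrow> complex. continuous_on {0..} \<gamma> \<and>
           filterlim \<gamma> at_infinity at_top \<and> ((\<lambda>t. f (\<gamma> t)) \<longlongrightarrow> a) at_top}"

(* Singular values enter through the finite critical and asymptotic values; taking
   the closure of their union would not affect boundedness. *)
definition eremenko_lyubich_class :: "(complex \<Rightarrow> complex) set" where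
  "eremenko_lyubich_class =
     {f. transcendental_entire f \<and> bounded (critical_values f \<union> asymptotic_values f)}"

end

theory Submission
  imports Defs "HOL-Computational_Algebra.Fundamental_Theorem_Algebra"
begin

text \<open>
  We construct \<open>f = E + H\<close> with \<open>E\<close> even, \<open>H\<close> odd and both real on the real axis, where \<open>H\<close> vanishes at
  every \<open>r\<^sub>n\<close> and \<open>\<bar>E\<bar>\<close> dominates so strongly that for large \<open>\<bar>z\<bar>\<close> the maximum modulus set lies on the
  real axis. Then both \<open>r\<^sub>n\<close> and \<open>-r\<^sub>n\<close> belong to it. If neither of them were the inner end of its component,
  then \<open>s\<close> and \<open>-s\<close> would both be maximum points for all \<open>s < r\<^sub>n\<close> near \<open>r\<^sub>n\<close>, so \<open>H\<close> would
  vanish on an interval.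

  The function lives on two thin tracts \<open>\<plusminus>psi S\<close>, where \<open>S\<close> is a half-strip and
  \<open>psi s = \<Sum>\<^sub>k s / (s + a\<^sub>k)\<close>. This map is univalent since its derivative has positive real part, and it grows
  as slowly as we like if the \<open>a\<^sub>k\<close> grow fast, so \<open>f\<close> can be made to grow fast enough for any
  given sequence. A Cauchy integral over the boundary of a half-strip turns a function \<open>\<Phi>\<close> on \<open>S\<close> that is
  small near the boundary into an entire function that is bounded off the tract and differs from \<open>\<Phi>\<close> by a
  bounded amount on it, with a bound independent of \<open>a\<close>. With \<open>\<Phi> s = exp (exp s)\<close> this yields \<open>E\<close>. A smaller
  oscillating \<open>\<Phi>\<close> yields an odd function with a real zero \<open>p\<^sub>n\<close> very close to each \<open>r\<^sub>n\<close>, and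
  multiplication by \<open>\<Prod>\<^sub>n (z\<^sup>2 - r\<^sub>n\<^sup>2) / (z\<^sup>2 - p\<^sub>n\<^sup>2)\<close> yields \<open>H\<close>. On the tract, \<open>f (psi s)\<close> has the form
  \<open>exp (exp s + \<kappa> s)\<close> with small \<open>\<kappa>\<close> wherever \<open>\<bar>f\<bar>\<close> is large, which bounds the singular values and
  makes \<open>log \<bar>f\<bar>\<close> strictly concave across the real axis.
\<close>

section \<open>Univalent maps of a half-strip of slow growth\<close>

text \<open>The obstacle is the order of the choices. All statements about the maximum modulus set
  hold only beyond a radius \<open>R0\<close> that depends on the error constants, and even the
  smallest prescribed modulus must exceed it. So the constants \<open>C\<close> and \<open>L\<close>
  and the thresholds \<open>N n\<close> are fixed first, and only then is \<open>a\<close> chosen so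
  sparse that the preimage of the n-th modulus under \<open>psiR\<close> is at least
  \<open>N n\<close>. This is not circular because the distortion and Cauchy estimates contain no
  constant that depends on \<open>a\<close>.

  The Cauchy integral reproduces a given function only up to a bounded error, so sign changes of an
  oscillating model locate zeros without placing them; hence the correcting product. It converges
  because the model contains \<open>cos (s^2)\<close>, whose sign changes on the real axis become
  ever denser.

  Two contours are used, one from \<open>Re s = 0\<close> at height 3 and one from
  \<open>Re s = 1\<close> at height 2. The boundary of \<open>strip (1/2) (5/2)\<close> runs between
  them at distance 1/2 from either, and \<open>strip (-1) 4\<close> leaves room for discs of radius
  1/2 about contour points.\<close>

definition strip :: "real \<Rightarrow> real \<Rightarrow> complex set" where
  "strip l h = {s. l < Re s \<and> \<bar>Im s\<bar> < h}"

lemma open_strip: "open (strip l h)"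
proof -
  have "strip l h = {s. l < Re s} \<inter> {s. Im s < h} \<inter> {s. - h < Im s}"
    by (auto simp: strip_def abs_less_iff)
  then show ?thesis
    by (simp add: open_Int open_halfspace_Re_gt open_halfspace_Im_lt open_halfspace_Im_gt)
qed

lemma convex_strip: "convex (strip l h)"
proof -
  have "strip l h = {s. l < Re s} \<inter> {s. Im s < h} \<inter> {s. - h < Im s}"
    by (auto simp: strip_def abs_less_iff)
  then show ?thesis
    by (simp add: convex_Int convex_halfspace_Re_gt convex_halfspace_Im_lt convex_halfspace_Im_gt)
qed

lemma cball_subset_strip:
  assumes "l + d < Re s" "\<bar>Im s\<bar> + d < h"
  shows "cball s d \<subseteq> strip l h"
proof
  fix w assume "w \<in> cball s d"
  then have "cmod (s - w) \<le> d" by (simp add: dist_norm)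
  then have "\<bar>Re s - Re w\<bar> \<le> d" "\<bar>Im s - Im w\<bar> \<le> d"
    using abs_Re_le_cmod[of "s - w"] abs_Im_le_cmod[of "s - w"] by auto
  then show "w \<in> strip l h" using assms by (auto simp: strip_def)
qed

text \<open>Quantitative form of the Noshiro-Warschawski criterion. The projection
  \<open>\<phi>\<close> of \<open>f\<close> onto the direction \<open>d\<close> along the segment
  has derivative \<open>\<bar>d\<bar>^2 * Re f'\<close>, so the real mean value theorem
  applies.\<close>

lemma norm_diff_ge_of_Re_deriv:
  fixes f f' :: "complex \<Rightarrow> complex"
  assumes "convex S" "x \<in> S" "y \<in> S"
    and der: "\<And>s. s \<in> S \<Longrightarrow> (f has_field_derivative f' s) (at s)"
    and m: "\<And>s. s \<in> S \<Longrightarrow> m \<le> Re (f' s)"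
  shows "m * cmod (x - y) \<le> cmod (f x - f y)"
proof (cases "x = y")
  case False
  define d where "d = x - y"
  define \<phi> where "\<phi> t = Re (cnj d * f (y + of_real t * d))" for t
  have inS: "y + of_real t * d \<in> S" if "0 \<le> t" "t \<le> 1" for t
  proof -
    have "y + of_real t * d = (1 - t) *\<^sub>R y + t *\<^sub>R x"
      by (simp add: d_def scaleR_conv_of_real algebra_simps)
    then show ?thesis using assms(1-3) that by (simp add: convexD_alt)
  qed
  have d\<phi>: "(\<phi> has_real_derivative Re (cnj d * (f' (y + of_real t * d) * d))) (at t)"
    if "0 \<le> t" "t \<le> 1" for t
  proof -
    have "((\<lambda>t. f (y + of_real t * d)) has_vector_derivative (d * f' (y + of_real t * d))) (at t)"
    proof -
      have 1: "((\<lambda>t. y + of_real t * d) has_vector_derivative d) (at t)"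
        by (auto intro!: derivative_eq_intros)
      have 2: "(f has_field_derivative f' (y + of_real t * d)) (at (y + of_real t * d))"
        using der inS that by auto
      show ?thesis using field_vector_diff_chain_at[OF 1 2] by (simp add: o_def)
    qed
    then have "((\<lambda>t. cnj d * f (y + of_real t * d)) has_vector_derivative
        (cnj d * (d * f' (y + of_real t * d)))) (at t)"
      by (rule has_vector_derivative_mult_right)
    from bounded_linear.has_vector_derivative[OF bounded_linear_Re this]
    show ?thesis
      unfolding \<phi>_def has_real_derivative_iff_has_vector_derivative
      by (simp add: mult.commute)
  qed
  obtain t where t: "0 < t" "t < 1"
    and eq: "\<phi> 1 - \<phi> 0 = (1 - 0) * Re (cnj d * (f' (y + of_real t * d) * d))"
    using MVT2[of 0 1 \<phi>, OF _ d\<phi>] by auto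
  have "cnj d * (f' (y + of_real t * d) * d) = of_real ((cmod d)\<^sup>2) * f' (y + of_real t * d)"
    by (metis complex_norm_square mult.assoc mult.commute of_real_power)
  then have "\<phi> 1 - \<phi> 0 = (cmod d)\<^sup>2 * Re (f' (y + of_real t * d))"
  proof -
    have "Re (of_real c * w) = c * Re w" for c w by simp
    then show ?thesis
      using eq \<open>cnj d * (f' (y + of_real t * d) * d) = of_real ((cmod d)\<^sup>2) * f' (y + of_real t * d)\<close>
      by (simp only: diff_zero mult_1)
  qed
  also have "\<dots> \<ge> (cmod d)\<^sup>2 * m"
    using m inS t by (intro mult_left_mono) auto
  finally have 1: "(cmod d)\<^sup>2 * m \<le> \<phi> 1 - \<phi> 0" .
  have "\<phi> 1 - \<phi> 0 = Re (cnj d * (f x - f y))"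
    by (simp add: \<phi>_def d_def right_diff_distrib)
  also have "\<dots> \<le> cmod d * cmod (f x - f y)"
    using complex_Re_le_cmod[of "cnj d * (f x - f y)"] by (simp add: norm_mult)
  finally have "cmod d * (m * cmod d) \<le> cmod d * cmod (f x - f y)"
    using 1 by (simp add: power2_eq_square mult_ac)
  moreover have "cmod d > 0" using False by (simp add: d_def)
  ultimately show ?thesis by (simp add: d_def)
qed auto

lemma Re_inverse_square:
  "Re (1 / w\<^sup>2) = ((Re w)\<^sup>2 - (Im w)\<^sup>2) / ((cmod w)\<^sup>2)\<^sup>2"
proof -
  have "(of_real ((cmod w)\<^sup>2))\<^sup>2 = (w * cnj w)\<^sup>2"
    using complex_norm_square[of w] by simp
  then have "1 / w\<^sup>2 = (cnj w)\<^sup>2 / of_real (((cmod w)\<^sup>2)\<^sup>2)"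
    by (cases "w = 0") (simp_all add: power_mult_distrib divide_simps)
  then have "Re (1 / w\<^sup>2) = Re ((cnj w)\<^sup>2) / ((cmod w)\<^sup>2)\<^sup>2"
    by (simp only: Re_divide_of_real)
  then show ?thesis by (simp add: power2_eq_square)
qed

text \<open>Makes the distortion of \<open>psi\<close> uniform in \<open>a\<close>: for
  \<open>w0 = s + a k\<close> a shift by 1/2 barely changes modulus or argument. The factor 0.95 is
  \<open>1 - (1/2) / 10\<close>, and 0.94 is \<open>1 - (1/2) / (19/2)\<close> rounded down.\<close>

lemma inverse_square_comparison:
  assumes "10 \<le> Re w0" "\<bar>Im w0\<bar> \<le> 3" "cmod (w - w0) \<le> 1/2"
  shows "1 / (2 * (cmod w0)\<^sup>2) \<le> Re (1 / w\<^sup>2)" and "1 / (cmod w)\<^sup>2 \<le> 2 / (cmod w0)\<^sup>2"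
proof -
  have "\<bar>Re w - Re w0\<bar> \<le> 1/2" "\<bar>Im w - Im w0\<bar> \<le> 1/2"
    using assms(3) abs_Re_le_cmod[of "w - w0"] abs_Im_le_cmod[of "w - w0"] by auto
  then have X: "19/2 \<le> Re w" and Y: "\<bar>Im w\<bar> \<le> 7/2" using assms(1,2) by linarith+
  have XX: "361/4 \<le> (Re w)\<^sup>2" using power_mono[OF X, of 2] by (simp add: power2_eq_square)
  have YY: "(Im w)\<^sup>2 \<le> 49/4"
    using power_mono[OF Y, of 2] by (simp add: power2_eq_square)
  have nw: "(cmod w)\<^sup>2 = (Re w)\<^sup>2 + (Im w)\<^sup>2" by (simp add: cmod_power2)
  have w9: "19/2 \<le> cmod w" using X complex_Re_le_cmod[of w] by linarith
  have w10: "10 \<le> cmod w0" using assms(1) complex_Re_le_cmod[of w0] by linarith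
  have a: "cmod w - 1/2 \<le> cmod w0" and b: "cmod w0 - 1/2 \<le> cmod w"
    using assms(3) norm_triangle_ineq2[of w w0] norm_triangle_ineq2[of w0 w]
    by (auto simp: norm_minus_commute)
  have "0.94 * cmod w \<le> cmod w0" using a w9 by simp
  then have "(0.94 * cmod w)\<^sup>2 \<le> (cmod w0)\<^sup>2" by (intro power_mono) auto
  then have c: "0.88 * ((Re w)\<^sup>2 + (Im w)\<^sup>2) \<le> (cmod w0)\<^sup>2"
  proof -
    have "0.88 * ((Re w)\<^sup>2 + (Im w)\<^sup>2) \<le> 0.94\<^sup>2 * ((Re w)\<^sup>2 + (Im w)\<^sup>2)"
      by (intro mult_right_mono) (simp_all add: power2_eq_square)
    then show ?thesis
      using \<open>(0.94 * cmod w)\<^sup>2 \<le> (cmod w0)\<^sup>2\<close> unfolding power_mult_distrib nw by linarith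
  qed
  have pos: "0 < (cmod w0)\<^sup>2" "0 < (cmod w)\<^sup>2" using w9 w10 by auto
  let ?P = "(Re w)\<^sup>2 + (Im w)\<^sup>2"
  have "?P\<^sup>2 = ?P * ?P" by (simp add: power2_eq_square)
  also have "\<dots> \<le> ?P * (1.76 * ((Re w)\<^sup>2 - (Im w)\<^sup>2))"
    using XX YY by (intro mult_left_mono) auto
  also have "\<dots> = (0.88 * ?P) * (2 * ((Re w)\<^sup>2 - (Im w)\<^sup>2))" by algebra
  also have "\<dots> \<le> (cmod w0)\<^sup>2 * (2 * ((Re w)\<^sup>2 - (Im w)\<^sup>2))"
    using c XX YY by (intro mult_right_mono) auto
  finally have "?P\<^sup>2 \<le> (2 * (cmod w0)\<^sup>2) * ((Re w)\<^sup>2 - (Im w)\<^sup>2)" by (simp only: mult_ac)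
  moreover have "0 < ?P\<^sup>2" using pos(2) unfolding nw by (rule zero_less_power)
  ultimately show "1 / (2 * (cmod w0)\<^sup>2) \<le> Re (1 / w\<^sup>2)"
    unfolding Re_inverse_square nw using pos(1)
    by (simp add: pos_le_divide_eq pos_divide_le_eq mult_ac del: zero_less_power2 power_eq_0_iff)
  have "0.95 * cmod w0 \<le> cmod w" using b w10 by simp
  then have "(0.95 * cmod w0)\<^sup>2 \<le> (cmod w)\<^sup>2" by (intro power_mono) auto
  moreover have "1/2 * (cmod w0)\<^sup>2 \<le> 0.95\<^sup>2 * (cmod w0)\<^sup>2"
    by (intro mult_right_mono) (simp_all add: power2_eq_square)
  ultimately have "(cmod w0)\<^sup>2 \<le> 2 * (cmod w)\<^sup>2"
    unfolding power_mult_distrib by linarith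
  then show "1 / (cmod w)\<^sup>2 \<le> 2 / (cmod w0)\<^sup>2"
    using pos by (simp add: divide_simps)
qed

section \<open>The slowly growing map and its distortion\<close>

locale tract =
  fixes a :: "nat \<Rightarrow> real"
  assumes a_ge: "10 * 2 ^ k \<le> a k"
begin

definition psi :: "complex \<Rightarrow> complex" where
  "psi s = (\<Sum>k. s / (s + of_real (a k)))"

definition dpsi :: "complex \<Rightarrow> complex" where
  "dpsi s = (\<Sum>k. of_real (a k) / (s + of_real (a k))\<^sup>2)"

text \<open>A positive substitute for the modulus of \<open>dpsi\<close>: it bounds that modulus
  from above, and half of \<open>lam s0\<close> bounds \<open>Re (dpsi s)\<close> from below for
  \<open>s\<close> within 1/2 of \<open>s0\<close>, whatever \<open>a\<close> is.\<close>

definition lam :: "complex \<Rightarrow> real" where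
  "lam s = (\<Sum>k. a k / (cmod (s + of_real (a k)))\<^sup>2)"

definition psiR :: "real \<Rightarrow> real" where
  "psiR u = (\<Sum>k. u / (u + a k))"

lemma a_ge_10: "10 \<le> a k"
proof -
  have "10 * 1 \<le> 10 * (2::real) ^ k" by (intro mult_left_mono) auto
  then show ?thesis using a_ge[of k] by linarith
qed

lemma a_pos: "0 < a k"
  using a_ge_10[of k] by simp

lemma inverse_a_le: "1 / a k \<le> (1/2) ^ k / 10"
  using a_ge[of k] a_pos[of k] by (simp add: divide_simps power_divide)

lemma norm_add_a_ge:
  assumes "-1 < Re s" shows "9 / 10 * a k \<le> cmod (s + of_real (a k))"
  using assms a_ge_10[of k] complex_Re_le_cmod[of "s + of_real (a k)"] by simp

lemma add_a_nz: "-1 < Re s \<Longrightarrow> s + of_real (a k) \<noteq> 0"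
  using norm_add_a_ge[of s k] a_pos[of k] by auto

lemma lam_term_le:
  assumes "-1 < Re s"
  shows "a k / (cmod (s + of_real (a k)))\<^sup>2 \<le> (1/2) ^ k / 5"
proof -
  have "(9 / 10 * a k)\<^sup>2 \<le> (cmod (s + of_real (a k)))\<^sup>2"
    using norm_add_a_ge[OF assms, of k] a_pos[of k] by (intro power_mono) auto
  then have "a k / (cmod (s + of_real (a k)))\<^sup>2 \<le> a k / (9 / 10 * a k)\<^sup>2"
    using a_pos[of k] by (intro divide_left_mono mult_pos_pos) (auto simp: add_a_nz[OF assms])
  also have "\<dots> = (100 / 81) * (1 / a k)" using a_pos[of k] by (simp add: power2_eq_square field_simps)
  also have "\<dots> \<le> 2 * ((1/2) ^ k / 10)"
    using inverse_a_le[of k] a_pos[of k] by (intro mult_mono) auto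
  also have "\<dots> = (1/2) ^ k / 5" by simp
  finally show ?thesis .
qed

lemma lam_term_nonneg: "0 \<le> a k / (cmod (s + of_real (a k)))\<^sup>2"
  using a_pos[of k] by simp

lemma summable_half_power: "summable (\<lambda>k. (1/2 :: real) ^ k / c)"
  by (intro summable_divide summable_geometric) auto

lemma summable_lam:
  assumes "-1 < Re s" shows "summable (\<lambda>k. a k / (cmod (s + of_real (a k)))\<^sup>2)"
proof (rule summable_comparison_test[OF _ summable_half_power[of 5]], intro exI allI impI)
  show "norm (a k / (cmod (s + of_real (a k)))\<^sup>2) \<le> (1/2) ^ k / 5" for k
    using lam_term_le[OF assms, of k] lam_term_nonneg[of k s] by (simp only: real_norm_def abs_of_nonneg)
qed

lemma norm_dpsi_term: "cmod (of_real (a k) / (s + of_real (a k))\<^sup>2) = a k / (cmod (s + of_real (a k)))\<^sup>2"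
  using a_pos[of k] by (simp add: norm_divide norm_power)

lemma summable_dpsi: "-1 < Re s \<Longrightarrow> summable (\<lambda>k. of_real (a k) / (s + of_real (a k))\<^sup>2)"
  by (rule summable_norm_cancel) (use summable_lam[of s] in \<open>simp add: norm_dpsi_term\<close>)

lemma lam_pos: "-1 < Re s \<Longrightarrow> 0 < lam s"
  unfolding lam_def using summable_lam a_pos add_a_nz
  by (intro suminf_pos) (auto intro!: divide_pos_pos)

lemma lam_le_1: assumes "-1 < Re s" shows "lam s \<le> 1"
proof -
  have "lam s \<le> (\<Sum>k. (1/2) ^ k / 5)"
    unfolding lam_def using assms
    by (intro suminf_le lam_term_le summable_lam summable_half_power)
  also have "\<dots> = 2/5" by (subst suminf_divide) (auto simp: suminf_geometric)
  finally show ?thesis by simp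
qed

lemma norm_dpsi_le: assumes "-1 < Re s" shows "cmod (dpsi s) \<le> lam s"
  unfolding dpsi_def lam_def
  using summable_norm[of "\<lambda>k. of_real (a k) / (s + of_real (a k))\<^sup>2"] summable_lam[OF assms]
  by (simp add: norm_dpsi_term)

lemma psi_has_derivative:
  assumes "s \<in> strip (-1) 4"
  shows "(psi has_field_derivative dpsi s) (at s)"
    and summable_psi: "summable (\<lambda>k. s / (s + of_real (a k)))"
proof -
  have der: "((\<lambda>s. s / (s + of_real (a k))) has_field_derivative
      of_real (a k) / (x + of_real (a k))\<^sup>2) (at x within strip (-1) 4)"
    if "x \<in> strip (-1) 4" for k x
    using that add_a_nz[of x k]
    by (auto intro!: derivative_eq_intros simp: strip_def power2_eq_square)
  have uc: "uniformly_convergent_on (strip (-1) 4)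
      (\<lambda>n x. \<Sum>k<n. of_real (a k) / (x + of_real (a k))\<^sup>2)"
  proof (rule Weierstrass_m_test'[OF _ summable_half_power[of 5]])
    show "norm (of_real (a k) / (x + of_real (a k))\<^sup>2) \<le> (1/2) ^ k / 5"
      if "x \<in> strip (-1) 4" for k x
      unfolding norm_dpsi_term using that by (intro lam_term_le) (simp add: strip_def)
  qed
  have "s \<in> interior (strip (-1) 4)" using assms by (simp add: interior_open open_strip)
  note * = has_field_derivative_series'[OF convex_strip der uc, of 0, OF _ _ _ this]
  show "(psi has_field_derivative dpsi s) (at s)"
    unfolding psi_def dpsi_def by (rule *(2)) (auto simp: strip_def)
  show "summable (\<lambda>k. s / (s + of_real (a k)))"
    by (rule *(1)) (auto simp: strip_def)
qed

lemma holomorphic_psi: "psi holomorphic_on strip (-1) 4"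
  by (rule holomorphic_onI) (metis psi_has_derivative(1) field_differentiable_at_within field_differentiable_def)

lemma deriv_psi: "s \<in> strip (-1) 4 \<Longrightarrow> deriv psi s = dpsi s"
  by (rule DERIV_imp_deriv[OF psi_has_derivative(1)])

lemma holomorphic_dpsi: "dpsi holomorphic_on strip (-1) 4"
  using holomorphic_deriv[OF holomorphic_psi open_strip]
  by (rule holomorphic_transform) (simp add: deriv_psi)

lemma Re_dpsi_ge:
  assumes "0 \<le> Re s0" "\<bar>Im s0\<bar> \<le> 3" "cmod (s - s0) \<le> 1/2"
  shows "lam s0 / 2 \<le> Re (dpsi s)" and "lam s \<le> 2 * lam s0"
proof -
  have s: "-1 < Re s" using assms abs_Re_le_cmod[of "s - s0"] by simp
  have w: "10 \<le> Re (s0 + of_real (a k))" "\<bar>Im (s0 + of_real (a k))\<bar> \<le> 3"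
    "cmod (s + of_real (a k) - (s0 + of_real (a k))) \<le> 1/2" for k
    using assms a_ge_10[of k] by auto
  have "lam s0 / 2 = (\<Sum>k. a k / (cmod (s0 + of_real (a k)))\<^sup>2 / 2)"
    unfolding lam_def using assms by (intro suminf_divide[symmetric] summable_lam) auto
  also have "\<dots> \<le> (\<Sum>k. Re (of_real (a k) / (s + of_real (a k))\<^sup>2))"
  proof (rule suminf_le)
    fix k
    have "a k * (1 / (2 * (cmod (s0 + of_real (a k)))\<^sup>2)) \<le> a k * Re (1 / (s + of_real (a k))\<^sup>2)"
      using inverse_square_comparison(1)[OF w] a_pos[of k] by (intro mult_left_mono) auto
    also have "\<dots> = Re (of_real (a k) / (s + of_real (a k))\<^sup>2)"
      by (simp flip: Re_complex_of_real times_divide_eq_right add: divide_inverse)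
    finally show "a k / (cmod (s0 + of_real (a k)))\<^sup>2 / 2 \<le> Re (of_real (a k) / (s + of_real (a k))\<^sup>2)"
      by (simp add: mult.commute)
  next
    show "summable (\<lambda>k. a k / (cmod (s0 + of_real (a k)))\<^sup>2 / 2)"
      using assms by (intro summable_divide summable_lam) auto
    show "summable (\<lambda>k. Re (of_real (a k) / (s + of_real (a k))\<^sup>2))"
      by (rule summable_Re[OF summable_dpsi[OF s]])
  qed
  also have "\<dots> = Re (dpsi s)"
    unfolding dpsi_def by (rule Re_suminf[symmetric, OF summable_dpsi[OF s]])
  finally show "lam s0 / 2 \<le> Re (dpsi s)" .
  have "lam s \<le> (\<Sum>k. 2 * (a k / (cmod (s0 + of_real (a k)))\<^sup>2))"
    unfolding lam_def
  proof (rule suminf_le)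
    fix k
    have "a k * (1 / (cmod (s + of_real (a k)))\<^sup>2) \<le> a k * (2 / (cmod (s0 + of_real (a k)))\<^sup>2)"
      using inverse_square_comparison(2)[OF w] a_pos[of k] by (intro mult_left_mono) auto
    then show "a k / (cmod (s + of_real (a k)))\<^sup>2 \<le> 2 * (a k / (cmod (s0 + of_real (a k)))\<^sup>2)"
      by (simp add: mult.commute)
  next
    show "summable (\<lambda>k. 2 * (a k / (cmod (s0 + of_real (a k)))\<^sup>2))"
      using assms by (intro summable_mult summable_lam) auto
  qed (rule summable_lam[OF s])
  also have "\<dots> = 2 * lam s0" unfolding lam_def using assms by (intro suminf_mult summable_lam) auto
  finally show "lam s \<le> 2 * lam s0" .
qed

text \<open>Each \<open>s + a k\<close> has real part above 9 and imaginary part below 4 in modulus,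
  hence argument below pi/4 in modulus, and its inverse square lies in the right half-plane.\<close>

lemma Re_dpsi_pos: assumes "s \<in> strip (-1) 4" shows "0 < Re (dpsi s)"
proof -
  have s: "-1 < Re s" "\<bar>Im s\<bar> < 4" using assms by (auto simp: strip_def)
  have "0 < (\<Sum>k. Re (of_real (a k) / (s + of_real (a k))\<^sup>2))"
  proof (rule suminf_pos)
    fix k
    have "\<bar>Im (s + of_real (a k))\<bar> < Re (s + of_real (a k))" using s a_ge_10[of k] by auto
    then have "\<bar>Im (s + of_real (a k))\<bar>\<^sup>2 < (Re (s + of_real (a k)))\<^sup>2"
      by (intro power_strict_mono) auto
    then have "0 < Re (1 / (s + of_real (a k))\<^sup>2)"
      unfolding Re_inverse_square using add_a_nz[OF s(1), of k] by (intro divide_pos_pos) auto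
    then have "0 < a k * Re (1 / (s + of_real (a k))\<^sup>2)" using a_pos[of k] by simp
    also have "\<dots> = Re (of_real (a k) / (s + of_real (a k))\<^sup>2)"
      by (simp flip: Re_complex_of_real times_divide_eq_right add: divide_inverse)
    finally show "0 < Re (of_real (a k) / (s + of_real (a k))\<^sup>2)" .
  qed (rule summable_Re[OF summable_dpsi[OF s(1)]])
  also have "\<dots> = Re (dpsi s)"
    unfolding dpsi_def by (rule Re_suminf[symmetric, OF summable_dpsi[OF s(1)]])
  finally show ?thesis .
qed

lemma dpsi_nz: "s \<in> strip (-1) 4 \<Longrightarrow> dpsi s \<noteq> 0"
  using Re_dpsi_pos[of s] by auto

lemma inj_psi: "inj_on psi (strip (-1) 4)"
proof (rule inj_onI, rule ccontr)
  fix x y assume xy: "x \<in> strip (-1) 4" "y \<in> strip (-1) 4" "psi x = psi y" "x \<noteq> y"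
  have sub: "closed_segment x y \<subseteq> strip (-1) 4"
    using xy convex_strip closed_segment_subset by blast
  \<comment> \<open>\<open>Re (dpsi s)\<close> tends to 0 at infinity, so there is no positive lower
    bound on the whole half-strip; the minimum over the compact segment serves instead.\<close>
  have "continuous_on (closed_segment x y) (\<lambda>s. Re (dpsi s))"
    using holomorphic_on_imp_continuous_on[OF holomorphic_on_subset[OF holomorphic_dpsi sub]]
    by (intro continuous_intros)
  then obtain c where c: "c \<in> closed_segment x y"
    "\<And>s. s \<in> closed_segment x y \<Longrightarrow> Re (dpsi c) \<le> Re (dpsi s)"
    using continuous_attains_inf[of "closed_segment x y" "\<lambda>s. Re (dpsi s)"] by auto
  have "Re (dpsi c) * cmod (x - y) \<le> cmod (psi x - psi y)"
    by (rule norm_diff_ge_of_Re_deriv[OF convex_closed_segment _ _ psi_has_derivative(1) c(2)])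
       (use sub in auto)
  moreover have "0 < Re (dpsi c)" using c sub Re_dpsi_pos by blast
  ultimately show False using xy by (simp add: mult_le_0_iff)
qed

lemma psi_diff_ge:
  assumes "0 \<le> Re s0" "\<bar>Im s0\<bar> \<le> 3" "cmod (s - s0) \<le> 1/2"
  shows "lam s0 / 2 * cmod (s - s0) \<le> cmod (psi s - psi s0)"
proof (rule norm_diff_ge_of_Re_deriv[of "cball s0 (1/2)" _ _ psi dpsi])
  fix x assume "x \<in> cball s0 (1/2)"
  moreover have "cball s0 (1/2) \<subseteq> strip (-1) 4" using assms by (intro cball_subset_strip) auto
  ultimately show "(psi has_field_derivative dpsi x) (at x)" "lam s0 / 2 \<le> Re (dpsi x)"
    using psi_has_derivative(1) Re_dpsi_ge(1)[OF assms(1,2), of x]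
    by (auto simp: dist_norm norm_minus_commute)
qed (use assms in \<open>auto simp: dist_norm norm_minus_commute\<close>)

text \<open>A covering estimate in the style of Koebe's quarter theorem: \<open>psi\<close> expands
  by at least \<open>lam s0 / 2\<close> on the disc of radius 1/2, so the image of that disc
  contains the disc of radius \<open>lam s0 / 4\<close> about \<open>psi s0\<close>.\<close>

lemma dist_psi_ge:
  assumes s0: "0 \<le> Re s0" "\<bar>Im s0\<bar> \<le> 3" and z: "z \<notin> psi ` ball s0 (1/2)"
  shows "lam s0 / 4 \<le> cmod (psi s0 - z)"
proof -
  have sub: "cball s0 (1/2) \<subseteq> strip (-1) 4" using s0 by (intro cball_subset_strip) auto
  have "ball (psi s0) (lam s0 / 4) \<subseteq> psi ` ball s0 (1/2)"
  proof (rule ball_subset_open_map_image)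
    show "continuous_on (closure (ball s0 (1/2))) psi"
      using holomorphic_on_imp_continuous_on[OF holomorphic_on_subset[OF holomorphic_psi sub]] by simp
    show "open (psi ` interior (ball s0 (1/2)))"
    proof -
      have "ball s0 (1/2) \<subseteq> strip (-1) 4" using sub ball_subset_cball by blast
      then show ?thesis
        using open_mapping_thm3[of psi "ball s0 (1/2)"] holomorphic_on_subset[OF holomorphic_psi]
          inj_on_subset[OF inj_psi] by (auto simp: interior_open)
    qed
    show "lam s0 / 4 \<le> cmod (psi w - psi s0)" if "w \<in> frontier (ball s0 (1/2))" for w
    proof -
      have "cmod (w - s0) = 1/2" using that by (simp add: dist_norm norm_minus_commute)
      then show ?thesis using psi_diff_ge[OF s0, of w] by (simp only: order.refl) simp
    qed
    show "0 < lam s0 / 4" using lam_pos[of s0] s0 by simp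
  qed auto
  then show ?thesis using z by (force simp: dist_norm)
qed

lemma psi_cnj: "psi (cnj s) = cnj (psi s)"
  if "s \<in> strip (-1) 4"
proof -
  have "(\<lambda>k. cnj (s / (s + of_real (a k)))) sums cnj (psi s)"
    unfolding sums_cnj psi_def using summable_psi[OF that] by (rule summable_sums)
  then show ?thesis unfolding psi_def by (simp add: sums_iff)
qed

section \<open>Behaviour on the real axis and growth\<close>

lemma summable_psiR: "0 \<le> u \<Longrightarrow> summable (\<lambda>k. u / (u + a k))"
proof -
  assume "0 \<le> u"
  have "of_real u \<in> strip (-1) 4" using \<open>0 \<le> u\<close> by (simp add: strip_def)
  from summable_Re[OF summable_psi[OF this]] show ?thesis
    by (simp flip: of_real_add of_real_divide)
qed

lemma psi_of_real: "0 \<le> u \<Longrightarrow> psi (of_real u) = of_real (psiR u)"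
  unfolding psi_def psiR_def using suminf_of_real[OF summable_psiR, where 'a=complex]
  by simp

text \<open>Each term is \<open>1 - b / (s + b)\<close>, and \<open>Re (b / (s + b))\<close> is at
  most \<open>b / (Re s + b)\<close>. So \<open>psi\<close> bends vertical lines to the right, and a
  point \<open>psi w\<close> of modulus \<open>psiR x\<close> must have
  \<open>Re w \<le> x\<close>.\<close>

lemma Re_psi_ge:
  assumes "0 \<le> Re s" "\<bar>Im s\<bar> < 4"
  shows "psiR (Re s) \<le> Re (psi s)"
proof -
  have s: "s \<in> strip (-1) 4" using assms by (simp add: strip_def)
  have "psiR (Re s) \<le> (\<Sum>k. Re (s / (s + of_real (a k))))"
    unfolding psiR_def
  proof (rule suminf_le)
    fix k
    define u v b where "u = Re s" "v = Im s" "b = a k"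
    have b: "0 < b" "0 \<le> u" using a_pos assms by (auto simp: u_v_b_def)
    have "Re (s / (s + of_real b)) = (u * (u + b) + v * v) / ((u + b)\<^sup>2 + v\<^sup>2)"
      by (simp add: Re_divide u_v_b_def)
    moreover have "u / (u + b) \<le> (u * (u + b) + v * v) / ((u + b)\<^sup>2 + v\<^sup>2)"
    proof -
      have "u * ((u + b)\<^sup>2 + v\<^sup>2) \<le> (u * (u + b) + v * v) * (u + b)"
        using b by (simp add: power2_eq_square algebra_simps)
      moreover have "0 < (u + b)\<^sup>2 + v\<^sup>2" using b by (simp add: add_pos_nonneg)
      ultimately show ?thesis using b by (simp add: divide_simps)
    qed
    ultimately show "Re s / (Re s + a k) \<le> Re (s / (s + of_real (a k)))"
      by (simp add: u_v_b_def)
  qed (use assms summable_psiR summable_Re[OF summable_psi[OF s]] in auto)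
  also have "\<dots> = Re (psi s)" unfolding psi_def by (rule Re_suminf[symmetric, OF summable_psi[OF s]])
  finally show ?thesis .
qed

lemma psiR_strict_mono: assumes "0 \<le> u" "u < v" shows "psiR u < psiR v"
proof -
  have "0 < (\<Sum>k. v / (v + a k) - u / (u + a k))"
  proof (rule suminf_pos)
    show "0 < v / (v + a k) - u / (u + a k)" for k
    proof -
      have "u / (u + a k) < v / (v + a k)"
        using assms a_pos[of k] by (simp add: divide_simps) (simp add: algebra_simps)
      then show ?thesis by simp
    qed
  next
    show "summable (\<lambda>k. v / (v + a k) - u / (u + a k))"
      using assms by (intro summable_diff summable_psiR) auto
  qed
  then show ?thesis unfolding psiR_def using assms summable_psiR by (simp add: suminf_diff[symmetric])
qed

lemma psiR_mono: "0 \<le> u \<Longrightarrow> u \<le> v \<Longrightarrow> psiR u \<le> psiR v"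
  using psiR_strict_mono[of u v] by (cases "u = v") auto

lemma psiR_0 [simp]: "psiR 0 = 0"
  by (simp add: psiR_def)

lemma psiR_pos: "0 < u \<Longrightarrow> 0 < psiR u"
  using psiR_strict_mono[of 0 u] by simp

lemma Re_psi_pos: "0 < Re s \<Longrightarrow> \<bar>Im s\<bar> < 4 \<Longrightarrow> 0 < Re (psi s)"
  using Re_psi_ge[of s] psiR_pos[of "Re s"] by simp

lemma psiR_has_derivative:
  assumes "0 \<le> u"
  shows "(psiR has_real_derivative lam (of_real u)) (at u within {0..})"
proof -
  have u: "of_real u \<in> strip (-1) 4" using assms by (simp add: strip_def)
  have "(of_real has_vector_derivative (1::complex)) (at u)"
    using has_vector_derivative_of_real[OF DERIV_ident] by simp
  from field_vector_diff_chain_at[OF this psi_has_derivative(1)[OF u]]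
  have "((\<lambda>u. psi (of_real u)) has_vector_derivative (1 * dpsi (of_real u))) (at u within {0..})"
    unfolding o_def by (rule has_vector_derivative_at_within)
  from bounded_linear.has_vector_derivative[OF bounded_linear_Re this]
  have "((\<lambda>u. Re (psi (of_real u))) has_real_derivative Re (dpsi (of_real u))) (at u within {0..})"
    unfolding has_real_derivative_iff_has_vector_derivative by simp
  moreover have "dpsi (of_real u) = of_real (lam (of_real u))"
  proof -
    have "cmod (of_real u + of_real (a k)) = u + a k" for k
      using a_pos[of k] assms by (metis norm_of_real of_real_add abs_of_nonneg add_nonneg_nonneg less_imp_le)
    then show ?thesis unfolding dpsi_def lam_def
      using suminf_of_real[OF summable_lam[of "of_real u"], where 'a=complex] assms by simp
  qed
  ultimately show ?thesis
    by (subst has_field_derivative_cong_eventually[where g = "\<lambda>u. Re (psi (of_real u))"])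
       (auto simp: psi_of_real assms eventually_at_filter)
qed

lemma continuous_psiR: "continuous_on {0..} psiR"
  using psiR_has_derivative by (intro has_field_derivative_imp_has_derivative[THEN has_derivative_continuous_on] DERIV_continuous_on) auto

lemma psiR_unbounded: "\<exists>x\<ge>0. B \<le> psiR x"
proof -
  obtain n :: nat where n: "2 * B \<le> real n" using real_arch_simple by blast
  define x where "x = Max (a ` {..n})"
  have x: "a k \<le> x" if "k \<le> n" for k using that by (auto simp: x_def)
  have x0: "0 \<le> x" using x[of 0] a_pos[of 0] by simp
  have "real n / 2 = (\<Sum>k<n. 1/2)" by simp
  also have "\<dots> \<le> (\<Sum>k<n. x / (x + a k))"
  proof (rule sum_mono)
    fix k assume "k \<in> {..<n}"
    then have "a k \<le> x" using x by simp
    then show "1/2 \<le> x / (x + a k)" using a_pos[of k] by (simp add: field_simps)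
  qed
  also have "\<dots> \<le> psiR x" unfolding psiR_def
    using summable_psiR[OF x0] x0 a_pos by (intro sum_le_suminf) (auto intro!: divide_nonneg_nonneg add_nonneg_nonneg simp: less_imp_le)
  finally show ?thesis using n x0 by (intro exI[of _ x]) auto
qed

lemma psiR_surj: assumes "0 \<le> r" obtains x where "0 \<le> x" "psiR x = r"
proof -
  obtain B where B: "0 \<le> B" "r \<le> psiR B" using psiR_unbounded by blast
  have "\<exists>x. 0 \<le> x \<and> x \<le> B \<and> psiR x = r"
    using B assms continuous_psiR by (intro IVT') (auto intro: continuous_on_subset)
  then show ?thesis using that by blast
qed

text \<open>Termwise comparison of \<open>a k / (x + a k)^2\<close> with
  \<open>1 / (x + a k)\<close>. Since \<open>lam\<close> is the derivative of \<open>psiR\<close>, a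
  large preimage of a given modulus means a small slope there; this later spreads out the preimages
  of the prescribed moduli.\<close>

lemma lam_of_real_le:
  assumes "0 < x" shows "lam (of_real x) \<le> psiR x / x"
proof -
  have "lam (of_real x) \<le> (\<Sum>k. x / (x + a k) / x)"
    unfolding lam_def
  proof (rule suminf_le)
    fix k
    have "a k / (cmod (of_real x + of_real (a k)))\<^sup>2 = a k / (x + a k)\<^sup>2"
      by (metis norm_of_real of_real_add power2_abs)
    also have "\<dots> \<le> 1 / (x + a k)"
      using assms a_pos[of k] by (simp add: divide_simps power2_eq_square)
    finally show "a k / (cmod (of_real x + of_real (a k)))\<^sup>2 \<le> x / (x + a k) / x"
      using assms by simp
  next
    show "summable (\<lambda>k. x / (x + a k) / x)"
      using assms by (intro summable_divide summable_psiR) simp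
  qed (use assms in \<open>auto intro!: summable_lam\<close>)
  also have "\<dots> = psiR x / x" unfolding psiR_def using assms by (intro suminf_divide summable_psiR) auto
  finally show ?thesis .
qed

end

section \<open>Cauchy transforms along the boundary of the tract\<close>

lemma rectpath_sides:
  assumes "l \<le> N" "0 \<le> h"
    and cont: "continuous_on (path_image (rectpath (Complex l (-h)) (Complex N h))) q"
    and I: "(q has_contour_integral I) (rectpath (Complex l (-h)) (Complex N h))"
  shows "contour_integral (linepath (Complex N (-h)) (Complex N h)) q =
     I + contour_integral (linepath (Complex l (-h)) (Complex l h)) q
       + contour_integral (linepath (Complex l h) (Complex N h)) q
       - contour_integral (linepath (Complex l (-h)) (Complex N (-h))) q"
proof -
  let ?A = "Complex l (-h)" and ?B = "Complex N (-h)" and ?C = "Complex N h" and ?D = "Complex l h"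
  have rp: "rectpath ?A ?C = linepath ?A ?B +++ linepath ?B ?C +++ linepath ?C ?D +++ linepath ?D ?A"
    by (simp add: rectpath_def Let_def)
  have "path_image (rectpath ?A ?C) =
      closed_segment ?A ?B \<union> (closed_segment ?B ?C \<union> (closed_segment ?C ?D \<union> closed_segment ?D ?A))"
    unfolding rp by (simp add: path_image_join)
  then have c: "continuous_on (closed_segment ?A ?B) q" "continuous_on (closed_segment ?B ?C) q"
    "continuous_on (closed_segment ?C ?D) q" "continuous_on (closed_segment ?D ?A) q"
    using cont by (auto elim: continuous_on_subset)
  then have i: "q contour_integrable_on linepath ?A ?B" "q contour_integrable_on linepath ?B ?C"
    "q contour_integrable_on linepath ?C ?D" "q contour_integrable_on linepath ?D ?A"
    by (auto intro: contour_integrable_continuous_linepath)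
  have "I = contour_integral (rectpath ?A ?C) q" using I by (simp add: contour_integral_unique)
  also have "\<dots> = contour_integral (linepath ?A ?B) q + (contour_integral (linepath ?B ?C) q
      + (contour_integral (linepath ?C ?D) q + contour_integral (linepath ?D ?A) q))"
    unfolding rp using i by (simp add: contour_integrable_join)
  finally show ?thesis
    using contour_integral_reverse_linepath[OF c(3)] contour_integral_reverse_linepath[OF c(4)] by simp
qed

lemma contour_integral_horizontal_bound:
  assumes "l < N" and cont: "continuous_on (closed_segment (Complex l y) (Complex N y)) q"
    and B: "\<And>x. l \<le> x \<Longrightarrow> x \<le> N \<Longrightarrow> cmod (q (Complex x y)) \<le> M * exp (- x)" and "0 \<le> M"
  shows "cmod (contour_integral (linepath (Complex l y) (Complex N y)) q) \<le> M * exp (- l)"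
proof -
  let ?p = "linepath (Complex l y) (Complex N y)"
  define G where "G t = - M * exp (- (l + t * (N - l)))" for t :: real
  have p: "?p t = Complex (l + t * (N - l)) y" for t
    by (simp add: linepath_def complex_eq_iff algebra_simps)
  have G: "((\<lambda>t. M * exp (- (l + t * (N - l))) * (N - l)) has_integral (G 1 - G 0)) {0..1}"
    by (rule fundamental_theorem_of_calculus)
       (auto intro!: derivative_eq_intros simp: G_def simp flip: has_real_derivative_iff_has_vector_derivative,
        simp add: algebra_simps)
  have qi: "(\<lambda>t. q (?p t) * (Complex N y - Complex l y)) integrable_on {0..1}"
    using contour_integrable_continuous_linepath[OF cont]
    by (simp add: contour_integrable_on)
  have "cmod (integral {0..1} (\<lambda>t. q (?p t) * (Complex N y - Complex l y))) \<le>
      integral {0..1} (\<lambda>t. M * exp (- (l + t * (N - l))) * (N - l))"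
  proof (rule integral_norm_bound_integral[OF qi])
    show "(\<lambda>t. M * exp (- (l + t * (N - l))) * (N - l)) integrable_on {0..1}" using G by blast
    fix t :: real assume t: "t \<in> {0..1}"
    have "l + t * (N - l) \<le> l + 1 * (N - l)"
      using t assms(1) by (intro add_left_mono mult_right_mono) auto
    then have "cmod (q (?p t)) \<le> M * exp (- (l + t * (N - l)))"
      unfolding p using t assms(1) by (intro B) auto
    moreover have "cmod (Complex N y - Complex l y) = N - l"
      using assms(1) by (simp add: cmod_def)
    ultimately show "cmod (q (?p t) * (Complex N y - Complex l y)) \<le> M * exp (- (l + t * (N - l))) * (N - l)"
      using assms(1) by (simp add: norm_mult mult_right_mono)
  qed
  also have "\<dots> = G 1 - G 0" using G by (rule integral_unique)
  also have "\<dots> \<le> M * exp (- l)" using \<open>0 \<le> M\<close> by (simp add: G_def)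
  finally show ?thesis by (simp add: contour_integral_integral)
qed

lemma in_cbox_rect: "s \<in> cbox (Complex l (-h)) (Complex N h) \<longleftrightarrow> l \<le> Re s \<and> Re s \<le> N \<and> \<bar>Im s\<bar> \<le> h"
  by (auto simp: in_cbox_complex_iff)

lemma in_box_rect: "s \<in> box (Complex l (-h)) (Complex N h) \<longleftrightarrow> l < Re s \<and> Re s < N \<and> \<bar>Im s\<bar> < h"
  by (auto simp: in_box_complex_iff)

context tract
begin

text \<open>The Cauchy kernel pulled back to the parameter plane: the substitution
  \<open>\<zeta> = psi s\<close> turns \<open>\<Phi> d\<zeta> / (\<zeta> - z)\<close> into this
  integrand.\<close>

definition kern :: "(complex \<Rightarrow> complex) \<Rightarrow> complex \<Rightarrow> complex \<Rightarrow> complex" where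
  "kern \<Phi> z s = \<Phi> s * dpsi s / (psi s - z)"

definition vert :: "(complex \<Rightarrow> complex) \<Rightarrow> real \<Rightarrow> real \<Rightarrow> complex \<Rightarrow> complex" where
  "vert \<Phi> N h z = contour_integral (linepath (Complex N (-h)) (Complex N h)) (kern \<Phi> z)"

text \<open>Cauchy's theorem moves the cross-cut integral onto the bottom, left and top sides of a
  rectangle, so for \<open>z\<close> off the tract the limit is the Cauchy integral over the
  boundary of the half-strip. The cross-cuts eventually avoid any given \<open>z\<close>, so this
  single formula works in the whole plane and nothing has to be continued across the boundary
  curve.\<close>

definition cauchy_transform :: "(complex \<Rightarrow> complex) \<Rightarrow> complex \<Rightarrow> complex" where
  "cauchy_transform \<Phi> z = lim (\<lambda>n. vert \<Phi> (real n) 3 z) / (2 * pi * \<i>)"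

lemma holomorphic_kern:
  assumes "\<Phi> holomorphic_on strip (-1) 4" "S \<subseteq> strip (-1) 4" "z \<notin> psi ` S"
  shows "kern \<Phi> z holomorphic_on S"
  unfolding kern_def
  using assms by (intro holomorphic_intros holomorphic_on_subset[OF holomorphic_dpsi]
      holomorphic_on_subset[OF holomorphic_psi]) (auto intro: holomorphic_on_subset)

lemma cbox_subset_strip: "0 \<le> l \<Longrightarrow> h < 4 \<Longrightarrow> cbox (Complex l (-h)) (Complex N h) \<subseteq> strip (-1) 4"
  by (auto simp: in_cbox_rect strip_def)

lemma closed_segment_vertical_subset:
  "0 \<le> N \<Longrightarrow> 0 \<le> h \<Longrightarrow> closed_segment (Complex N (-h)) (Complex N h) \<subseteq> {s. Re s = N \<and> \<bar>Im s\<bar> \<le> h}"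
  by (auto simp: closed_segment_same_Re closed_segment_eq_real_ivl abs_le_iff)

lemma kern_rectangle_outside:
  assumes \<Phi>: "\<Phi> holomorphic_on strip (-1) 4" and "0 \<le> l" "l \<le> N" "0 \<le> h" "h < 4"
    and z: "z \<notin> psi ` cbox (Complex l (-h)) (Complex N h)"
  shows "(kern \<Phi> z has_contour_integral 0) (rectpath (Complex l (-h)) (Complex N h))"
  using assms cbox_subset_strip[of l h N]
  by (intro Cauchy_theorem_convex_simple[OF holomorphic_kern[OF \<Phi> _ z]] path_image_rectpath_subset_cbox)
     auto

text \<open>Univalence of \<open>psi\<close> makes the difference quotient \<open>g\<close> free of
  zeros, so the kernel is a holomorphic function over \<open>s - s0\<close> and Cauchy's formula
  applies in the parameter plane, without winding numbers in the image.\<close>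

lemma kern_rectangle_inside:
  assumes \<Phi>: "\<Phi> holomorphic_on strip (-1) 4" and l: "0 \<le> l" "l \<le> N" "0 \<le> h" "h < 4"
    and s0: "s0 \<in> box (Complex l (-h)) (Complex N h)"
  shows "(kern \<Phi> (psi s0) has_contour_integral (2 * pi * \<i> * \<Phi> s0)) (rectpath (Complex l (-h)) (Complex N h))"
proof -
  define g where "g s = (if s = s0 then deriv psi s0 else (psi s - psi s0) / (s - s0))" for s
  have s0D: "s0 \<in> strip (-1) 4"
    using s0 l by (auto simp: in_box_rect strip_def)
  have g: "g holomorphic_on strip (-1) 4"
    unfolding g_def by (rule pole_lemma_open[OF holomorphic_psi open_strip])
  have gnz: "g s \<noteq> 0" if "s \<in> strip (-1) 4" for s
    using that s0D inj_onD[OF inj_psi, of s s0] dpsi_nz[OF s0D] by (auto simp: g_def deriv_psi)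
  have hol: "(\<lambda>s. \<Phi> s * dpsi s / g s) holomorphic_on strip (-1) 4"
    using gnz by (intro holomorphic_intros \<Phi> holomorphic_dpsi g) auto
  have im: "path_image (rectpath (Complex l (-h)) (Complex N h)) \<subseteq> strip (-1) 4 - {s0}"
  proof -
    have "path_image (rectpath (Complex l (-h)) (Complex N h)) \<subseteq> cbox (Complex l (-h)) (Complex N h)"
      using l by (intro path_image_rectpath_subset_cbox) auto
    moreover have "path_image (rectpath (Complex l (-h)) (Complex N h)) \<inter> box (Complex l (-h)) (Complex N h) = {}"
      using l by (intro path_image_rectpath_inter_box) auto
    ultimately show ?thesis using s0 cbox_subset_strip[of l h N] l by blast
  qed
  have "((\<lambda>s. (\<Phi> s * dpsi s / g s) / (s - s0)) has_contour_integral
      (2 * pi * \<i> * winding_number (rectpath (Complex l (-h)) (Complex N h)) s0 * (\<Phi> s0 * dpsi s0 / g s0)))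
      (rectpath (Complex l (-h)) (Complex N h))"
    by (rule Cauchy_integral_formula_convex_simple[OF convex_strip hol])
       (use s0D im in \<open>auto simp: interior_open open_strip\<close>)
  moreover have "winding_number (rectpath (Complex l (-h)) (Complex N h)) s0 = 1"
    using s0 by (rule winding_number_rectpath)
  moreover have "\<Phi> s0 * dpsi s0 / g s0 = \<Phi> s0"
    using dpsi_nz[OF s0D] by (simp add: g_def deriv_psi[OF s0D])
  ultimately have "((\<lambda>s. (\<Phi> s * dpsi s / g s) / (s - s0)) has_contour_integral (2 * pi * \<i> * \<Phi> s0))
      (rectpath (Complex l (-h)) (Complex N h))"
    by simp
  then show ?thesis
  proof (rule has_contour_integral_eq)
    fix s assume "s \<in> path_image (rectpath (Complex l (-h)) (Complex N h))"
    then have "s \<in> strip (-1) 4" "s \<noteq> s0" using im by auto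
    then show "\<Phi> s * dpsi s / g s / (s - s0) = kern \<Phi> (psi s0) s"
      by (simp add: g_def kern_def)
  qed
qed

text \<open>What remains after subtracting the integral around the rectangle is the two horizontal
  sides; the decay of the integrand bounds each by \<open>M * exp (- l)\<close>, uniformly in the
  length.\<close>

lemma vert_compare:
  assumes \<Phi>: "\<Phi> holomorphic_on strip (-1) 4" and l: "0 \<le> l" "l < N" "0 \<le> h" "h < 4"
    and I: "(kern \<Phi> z has_contour_integral I) (rectpath (Complex l (-h)) (Complex N h))"
    and z: "z \<notin> psi ` path_image (rectpath (Complex l (-h)) (Complex N h))"
    and B: "\<And>s. l \<le> Re s \<Longrightarrow> \<bar>Im s\<bar> = h \<Longrightarrow> cmod (kern \<Phi> z s) \<le> M * exp (- Re s)" and "0 \<le> M"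
  shows "cmod (vert \<Phi> N h z - vert \<Phi> l h z - I) \<le> 2 * M * exp (- l)"
proof -
  let ?P = "path_image (rectpath (Complex l (-h)) (Complex N h))"
  have sub: "?P \<subseteq> strip (-1) 4"
    using path_image_rectpath_subset_cbox[of "Complex l (-h)" "Complex N h"] cbox_subset_strip[of l h N] l by auto
  have c: "continuous_on ?P (kern \<Phi> z)"
    by (rule holomorphic_on_imp_continuous_on[OF holomorphic_kern[OF \<Phi> sub z]])
  have P: "?P = {s. Re s \<in> {l, N} \<and> Im s \<in> {-h..h}} \<union> {s. Im s \<in> {-h, h} \<and> Re s \<in> {l..N}}"
    using path_image_rectpath[of "Complex l (-h)" "Complex N h"] l by simp
  have side: "cmod (contour_integral (linepath (Complex l y) (Complex N y)) (kern \<Phi> z)) \<le> M * exp (- l)"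
    if y: "\<bar>y\<bar> = h" for y
  proof (rule contour_integral_horizontal_bound[OF l(2) _ _ \<open>0 \<le> M\<close>])
    have "closed_segment (Complex l y) (Complex N y) \<subseteq> ?P"
      using l y unfolding P by (auto simp: closed_segment_same_Im closed_segment_eq_real_ivl split: if_splits)
    then show "continuous_on (closed_segment (Complex l y) (Complex N y)) (kern \<Phi> z)"
      using c continuous_on_subset by blast
    show "cmod (kern \<Phi> z (Complex x y)) \<le> M * exp (- x)" if "l \<le> x" "x \<le> N" for x
      using B[of "Complex x y"] that y by simp
  qed
  have "vert \<Phi> N h z - vert \<Phi> l h z - I = contour_integral (linepath (Complex l h) (Complex N h)) (kern \<Phi> z)
       - contour_integral (linepath (Complex l (-h)) (Complex N (-h))) (kern \<Phi> z)"
    unfolding vert_def using rectpath_sides[OF _ _ c I] l by simp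
  also have "cmod \<dots> \<le> M * exp (- l) + M * exp (- l)"
    by (intro order.trans[OF norm_triangle_ineq4] add_mono side) (use l in auto)
  finally show ?thesis by simp
qed

lemma vert_bound:
  assumes \<Phi>: "\<Phi> holomorphic_on strip (-1) 4" and "0 \<le> N" "0 \<le> h" "h < 4"
    and z: "\<And>s. Re s = N \<Longrightarrow> \<bar>Im s\<bar> \<le> h \<Longrightarrow> psi s \<noteq> z"
    and B: "\<And>s. Re s = N \<Longrightarrow> \<bar>Im s\<bar> \<le> h \<Longrightarrow> cmod (kern \<Phi> z s) \<le> M" and "0 \<le> M"
  shows "cmod (vert \<Phi> N h z) \<le> M * (2 * h)"
proof -
  let ?L = "closed_segment (Complex N (-h)) (Complex N h)"
  have L: "?L \<subseteq> {s. Re s = N \<and> \<bar>Im s\<bar> \<le> h}"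
    using assms by (intro closed_segment_vertical_subset)
  have "kern \<Phi> z holomorphic_on ?L"
    using L z assms(2,4) by (intro holomorphic_kern[OF \<Phi>]) (auto simp: strip_def)
  then have "cmod (vert \<Phi> N h z) \<le> M * cmod (Complex N h - Complex N (-h))"
    unfolding vert_def using L B \<open>0 \<le> M\<close>
    by (intro contour_integral_bound_linepath contour_integrable_continuous_linepath
         holomorphic_on_imp_continuous_on) auto
  also have "cmod (Complex N h - Complex N (-h)) = 2 * h"
  proof -
    have "Complex N h - Complex N (-h) = of_real (2 * h) * \<i>" by (simp add: complex_eq_iff)
    then show ?thesis using \<open>0 \<le> h\<close> by (simp only: norm_mult norm_of_real) simp
  qed
  finally show ?thesis .
qed

end

section \<open>Entire functions from data that decay near the boundary of the half-strip\<close>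

locale tract_kernel = tract +
  fixes \<Phi> :: "complex \<Rightarrow> complex" and K :: real
  assumes \<Phi>: "\<Phi> holomorphic_on strip (-1) 4"
    and \<Phi>_decay: "\<And>s. 0 \<le> Re s \<Longrightarrow> \<bar>Im s\<bar> \<le> 3 \<Longrightarrow> Re s \<le> 1 \<or> 2 \<le> \<bar>Im s\<bar> \<Longrightarrow> cmod (\<Phi> s) \<le> K * exp (- Re s)"
begin

lemma K_nonneg: "0 \<le> K"
proof -
  have "cmod (\<Phi> 0) \<le> K" using \<Phi>_decay[of 0] by simp
  then show ?thesis using norm_ge_zero[of "\<Phi> 0"] by linarith
qed

text \<open>Both \<open>dpsi s\<close> and the distance of \<open>psi s\<close> from
  \<open>z\<close> are measured by \<open>lam s\<close>, which cancels; this is where independence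
  of \<open>a\<close> comes from.\<close>

lemma kern_bound:
  assumes s: "0 \<le> Re s" "\<bar>Im s\<bar> \<le> 3" "Re s \<le> 1 \<or> 2 \<le> \<bar>Im s\<bar>" and z: "z \<notin> psi ` ball s (1/2)"
  shows "cmod (kern \<Phi> z s) \<le> 4 * K * exp (- Re s)"
proof -
  have lp: "0 < lam s" using s lam_pos by simp
  have d: "lam s / 4 \<le> cmod (psi s - z)" using s z by (intro dist_psi_ge)
  have "cmod (kern \<Phi> z s) = cmod (\<Phi> s) * (cmod (dpsi s) / cmod (psi s - z))"
    by (simp add: kern_def norm_mult norm_divide)
  also have "\<dots> \<le> (K * exp (- Re s)) * (lam s / (lam s / 4))"
    using \<Phi>_decay[OF s] norm_dpsi_le[of s] d lp s K_nonneg
    by (intro mult_mono frac_le) auto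
  also have "\<dots> = 4 * K * exp (- Re s)" using lp by simp
  finally show ?thesis .
qed

lemma dist_psi_ge_1:
  assumes "R + 1 \<le> psiR n0" "0 \<le> n0" "n0 \<le> Re s" "\<bar>Im s\<bar> < 4" "cmod z \<le> R"
  shows "1 \<le> cmod (psi s - z)"
proof -
  have "R + 1 \<le> psiR (Re s)" using assms psiR_mono[of n0 "Re s"] by simp
  also have "\<dots> \<le> Re (psi s)" using assms by (intro Re_psi_ge) auto
  also have "\<dots> \<le> cmod (psi s)" by (rule complex_Re_le_cmod)
  finally show ?thesis using assms norm_triangle_ineq2[of "psi s" z] by simp
qed

text \<open>Far to the right \<open>psi s\<close> has distance at least 1 from a whole disc of
  values \<open>z\<close>. In contrast to \<open>kern_bound\<close> this also covers points of the
  tract and is uniform in \<open>z\<close>, as locally uniform convergence of the cross-cuts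
  requires.\<close>

lemma kern_bound_far:
  assumes "R + 1 \<le> psiR n0" "0 \<le> n0" "n0 \<le> Re s" "\<bar>Im s\<bar> \<le> 3" "2 \<le> \<bar>Im s\<bar>" "cmod z \<le> R"
  shows "cmod (kern \<Phi> z s) \<le> K * exp (- Re s)"
proof -
  have d: "1 \<le> cmod (psi s - z)" using assms by (intro dist_psi_ge_1[of R n0]) auto
  have "cmod (dpsi s) \<le> 1" using norm_dpsi_le[of s] lam_le_1[of s] assms by simp
  then have "cmod (dpsi s) / cmod (psi s - z) \<le> 1 / 1" using d by (intro frac_le) auto
  moreover have "cmod (\<Phi> s) \<le> K * exp (- Re s)" using assms by (intro \<Phi>_decay) auto
  ultimately have "cmod (\<Phi> s) * (cmod (dpsi s) / cmod (psi s - z)) \<le> (K * exp (- Re s)) * 1"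
    using K_nonneg by (intro mult_mono) auto
  then show ?thesis by (simp add: kern_def norm_mult norm_divide)
qed

lemma vert_Cauchy:
  assumes "R + 1 \<le> psiR l" "0 \<le> l" "l \<le> N" "cmod z \<le> R"
  shows "cmod (vert \<Phi> N 3 z - vert \<Phi> l 3 z) \<le> 2 * K * exp (- l)"
proof (cases "l = N")
  case False
  have nz: "z \<notin> psi ` cbox (Complex l (-3)) (Complex N 3)"
    using dist_psi_ge_1[OF assms(1,2) _ _ assms(4)] by (force simp: in_cbox_rect)
  moreover have "path_image (rectpath (Complex l (-3)) (Complex N 3)) \<subseteq> cbox (Complex l (-3)) (Complex N 3)"
    using assms by (intro path_image_rectpath_subset_cbox) auto
  ultimately show ?thesis
    using vert_compare[OF \<Phi> _ _ _ _ kern_rectangle_outside[OF \<Phi> _ _ _ _ nz], where M = K]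
      kern_bound_far[OF assms(1,2) _ _ _ assms(4)] K_nonneg assms False by auto
qed (use K_nonneg in auto)

lemma holomorphic_vert:
  assumes "R + 1 \<le> psiR N" "0 \<le> N"
  shows "vert \<Phi> N 3 holomorphic_on ball 0 R"
proof -
  let ?p = "linepath (Complex N (-3)) (Complex N 3)"
  let ?c = "Complex N 3 - Complex N (-3)"
  have p: "Re (?p t) = N" "\<bar>Im (?p t)\<bar> \<le> 3" if "t \<in> {0..1}" for t
  proof -
    have "?p t \<in> closed_segment (Complex N (-3)) (Complex N 3)"
      using linepath_in_path[OF that] .
    then show "Re (?p t) = N" "\<bar>Im (?p t)\<bar> \<le> 3"
      using closed_segment_vertical_subset[of N 3] assms(2) by auto
  qed
  have pD: "?p ` {0..1} \<subseteq> strip (-1) 4" proof (rule image_subsetI)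
    fix t :: real assume "t \<in> {0..1}"
    from p[OF this] assms(2) show "?p t \<in> strip (-1) 4" by (simp add: strip_def)
  qed
  have nz: "psi (?p t) - z \<noteq> 0" if "t \<in> {0..1}" "z \<in> ball 0 R" for t z
    using dist_psi_ge_1[OF assms, of "?p t" z] p[OF that(1)] that(2) by auto
  have cp: "continuous_on {0..1} (\<lambda>t. f (?p t))" if "f holomorphic_on strip (-1) 4" for f
    using continuous_on_compose2[OF holomorphic_on_imp_continuous_on[OF that] continuous_on_linepath pD] .
  have "(\<lambda>z. integral (cbox 0 1) (\<lambda>t. \<Phi> (?p t) * dpsi (?p t) / (psi (?p t) - z) * ?c)) holomorphic_on ball 0 R"
  proof (rule leibniz_rule_holomorphic)
    fix z t assume zt: "z \<in> ball (0::complex) R" "t \<in> cbox (0::real) 1"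
    show "((\<lambda>z. \<Phi> (?p t) * dpsi (?p t) / (psi (?p t) - z) * ?c) has_field_derivative
        \<Phi> (?p t) * dpsi (?p t) / (psi (?p t) - z)\<^sup>2 * ?c) (at z within ball 0 R)"
      using nz[of t z] zt by (auto intro!: derivative_eq_intros simp: power2_eq_square)
  next
    fix z assume z: "z \<in> ball (0::complex) R"
    show "(\<lambda>t. \<Phi> (?p t) * dpsi (?p t) / (psi (?p t) - z) * ?c) integrable_on cbox 0 1"
      using nz z by (intro integrable_continuous continuous_intros cp[unfolded cbox_interval[symmetric]] \<Phi> holomorphic_dpsi holomorphic_psi) auto
  next
    have c2: "continuous_on (ball 0 R \<times> cbox 0 1) (\<lambda>x. f (?p (snd x)))" if "f holomorphic_on strip (-1) 4" for f
      by (rule continuous_on_compose2[OF cp[OF that]]) (auto intro!: continuous_intros)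
    show "continuous_on (ball 0 R \<times> cbox 0 1) (\<lambda>(z, t). \<Phi> (?p t) * dpsi (?p t) / (psi (?p t) - z)\<^sup>2 * ?c)"
      unfolding case_prod_unfold using nz
      by (intro continuous_intros c2 \<Phi> holomorphic_dpsi holomorphic_psi) auto
  qed auto
  then show ?thesis
    unfolding vert_def kern_def by (simp add: contour_integral_integral)
qed

lemma cauchy_transform_limit:
  shows "(\<lambda>n. vert \<Phi> (real n) 3 z) \<longlonglongrightarrow> 2 * pi * \<i> * cauchy_transform \<Phi> z"
    and "cauchy_transform \<Phi> holomorphic_on UNIV"
proof -
  have ul: "\<exists>g n0. uniform_limit (ball 0 R) (\<lambda>n. vert \<Phi> (real n) 3) g sequentially \<and> R + 1 \<le> psiR (real n0)" for R
  proof -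
    obtain x where x: "0 \<le> x" "R + 1 \<le> psiR x" using psiR_unbounded by blast
    obtain n0 :: nat where n0: "x \<le> real n0" using real_arch_simple by blast
    have R: "R + 1 \<le> psiR (real n)" if "n \<ge> n0" for n
      using x n0 that psiR_mono[of x "real n"] by simp
    have "uniformly_Cauchy_on (ball 0 R) (\<lambda>n. vert \<Phi> (real n) 3)"
    proof (rule uniformly_Cauchy_onI')
      fix e :: real assume e: "0 < e"
      have "(\<lambda>n. 2 * K * exp (- real n)) \<longlonglongrightarrow> 2 * K * 0"
        by (intro tendsto_intros) real_asymp
      then have "\<forall>\<^sub>F n in sequentially. 2 * K * exp (- real n) < e"
        using e by (simp add: order_tendstoD(2))
      then obtain n1 where n1: "\<And>n. n \<ge> n1 \<Longrightarrow> 2 * K * exp (- real n) < e"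
        by (auto simp: eventually_sequentially)
      show "\<exists>M. \<forall>z\<in>ball 0 R. \<forall>m\<ge>M. \<forall>n>m. dist (vert \<Phi> (real m) 3 z) (vert \<Phi> (real n) 3 z) < e"
      proof (intro exI[of _ "max n0 n1"] ballI allI impI)
        fix z m n assume z: "z \<in> ball (0::complex) R" and mn: "max n0 n1 \<le> m" "m < n"
        have "cmod (vert \<Phi> (real n) 3 z - vert \<Phi> (real m) 3 z) \<le> 2 * K * exp (- real m)"
          using z mn R by (intro vert_Cauchy[of R]) auto
        then show "dist (vert \<Phi> (real m) 3 z) (vert \<Phi> (real n) 3 z) < e"
          using n1[of m] mn by (simp add: dist_norm norm_minus_commute)
      qed
    qed
    then have "uniformly_convergent_on (ball 0 R) (\<lambda>n. vert \<Phi> (real n) 3)"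
      by (simp add: uniformly_convergent_eq_Cauchy)
    then show ?thesis using R[of n0] unfolding uniformly_convergent_on_def by blast
  qed
  show lim: "(\<lambda>n. vert \<Phi> (real n) 3 z) \<longlonglongrightarrow> 2 * pi * \<i> * cauchy_transform \<Phi> z" for z
  proof -
    obtain g where "uniform_limit (ball 0 (cmod z + 1)) (\<lambda>n. vert \<Phi> (real n) 3) g sequentially"
      using ul by blast
    then have "(\<lambda>n. vert \<Phi> (real n) 3 z) \<longlonglongrightarrow> g z" by (rule tendsto_uniform_limitI) simp
    then show ?thesis by (simp add: cauchy_transform_def limI)
  qed
  have hol: "cauchy_transform \<Phi> holomorphic_on ball 0 R" for R
  proof -
    obtain g n0 where g: "uniform_limit (ball 0 R) (\<lambda>n. vert \<Phi> (real n) 3) g sequentially"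
      and n0: "R + 1 \<le> psiR (real n0)"
      using ul by blast
    \<comment> \<open>Cross-cuts of small index may pass through the disc, so holomorphy is
      available only from index \<open>n0\<close> on.\<close>
    have g': "uniform_limit (ball 0 R) (\<lambda>n. vert \<Phi> (real (n + n0)) 3) g sequentially"
      using filterlim_compose[OF g filterlim_add_const_nat_at_top[of n0]] by simp
    have "g holomorphic_on ball 0 R"
    proof (rule holomorphic_uniform_sequence[OF open_ball])
      show "vert \<Phi> (real (n + n0)) 3 holomorphic_on ball 0 R" for n
        using n0 psiR_mono[of "real n0" "real (n + n0)"] by (intro holomorphic_vert) auto
      fix x assume "x \<in> ball (0::complex) R"
      then obtain d where "0 < d" "cball x d \<subseteq> ball 0 R"
        using open_contains_cball[of "ball 0 R"] by blast
      then show "\<exists>d>0. cball x d \<subseteq> ball 0 R \<and> uniform_limit (cball x d) (\<lambda>n. vert \<Phi> (real (n + n0)) 3) g sequentially"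
        using g' uniform_limit_on_subset by blast
    qed
    then have "(\<lambda>z. g z / (2 * pi * \<i>)) holomorphic_on ball 0 R"
      by (intro holomorphic_intros) auto
    moreover have "g z / (2 * pi * \<i>) = cauchy_transform \<Phi> z" if "z \<in> ball 0 R" for z
      using LIMSEQ_unique[OF tendsto_uniform_limitI[OF g that] lim] by simp
    ultimately show ?thesis by (rule holomorphic_transform) auto
  qed
  show "cauchy_transform \<Phi> holomorphic_on UNIV"
  proof (rule holomorphic_onI)
    fix z :: complex
    have "cauchy_transform \<Phi> field_differentiable at z"
      using holomorphic_on_imp_differentiable_at[OF hol[of "cmod z + 1"]] by simp
    then show "cauchy_transform \<Phi> field_differentiable at z within UNIV" by simp
  qed
qed

text \<open>The end pieces between heights 2 and 3 lie in the decay region, so both heights give the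
  same limit. The contour can then be chosen according to the position of \<open>z\<close>.\<close>

lemma vert_3_2_diff: "(\<lambda>n. vert \<Phi> (real n) 3 z - vert \<Phi> (real n) 2 z) \<longlonglongrightarrow> 0"
proof -
  obtain x where x: "0 \<le> x" "cmod z + 1 \<le> psiR x" using psiR_unbounded by blast
  obtain n0 :: nat where n0: "x \<le> real n0" using real_arch_simple by blast
  have R: "cmod z + 1 \<le> psiR (real n)" if "n \<ge> n0" for n
    using x n0 that psiR_mono[of x "real n"] by simp
  have "cmod (vert \<Phi> (real n) 3 z - vert \<Phi> (real n) 2 z) \<le> 2 * K * exp (- real n)" if n: "n \<ge> n0" for n
  proof -
    let ?S = "{s. Re s = real n \<and> \<bar>Im s\<bar> \<le> 3}"
    have c: "continuous_on ?S (kern \<Phi> z)"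
    proof (intro holomorphic_on_imp_continuous_on holomorphic_kern[OF \<Phi>])
      show "z \<notin> psi ` ?S"
      proof
        assume "z \<in> psi ` ?S"
        then obtain s where "s \<in> ?S" "z = psi s" by blast
        then show False using dist_psi_ge_1[OF R[OF n], of s z] by auto
      qed
    qed (auto simp: strip_def)
    let ?l = "\<lambda>a b. contour_integral (linepath (Complex n a) (Complex n b)) (kern \<Phi> z)"
    have seg: "closed_segment (Complex n a) (Complex n b) = {s. Re s = n \<and> a \<le> Im s \<and> Im s \<le> b}"
      if "a \<le> b" for a b :: real
      using that by (auto simp: closed_segment_same_Re closed_segment_eq_real_ivl)
    have split: "?l a b = ?l a c + ?l c b" if "-3 \<le> a" "a \<le> c" "c \<le> b" "b \<le> 3" for a b c
      using that by (intro contour_integral_split_linepath continuous_on_subset[OF c]) (auto simp: seg)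
    have small: "cmod (?l a b) \<le> K * exp (- real n)"
      if "-3 \<le> a" "a \<le> b" "b \<le> 3" "b - a = 1" "b \<le> -2 \<or> 2 \<le> a" for a b
    proof -
      have "cmod (?l a b) \<le> K * exp (- real n) * cmod (Complex n b - Complex n a)"
      proof (rule contour_integral_bound_linepath)
        show "kern \<Phi> z contour_integrable_on linepath (Complex n a) (Complex n b)"
          using that by (intro contour_integrable_continuous_linepath continuous_on_subset[OF c]) (auto simp: seg)
        show "cmod (kern \<Phi> z s) \<le> K * exp (- real n)"
          if s: "s \<in> closed_segment (Complex n a) (Complex n b)" for s
          using s \<open>-3 \<le> a\<close> \<open>a \<le> b\<close> \<open>b \<le> 3\<close> \<open>b \<le> -2 \<or> 2 \<le> a\<close> kern_bound_far[OF R[OF n], of s z]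
          by (auto simp: seg)
      qed (use K_nonneg in auto)
      also have "cmod (Complex n b - Complex n a) = 1" using that by (simp add: cmod_def)
      finally show ?thesis by simp
    qed
    have "vert \<Phi> (real n) 3 z - vert \<Phi> (real n) 2 z = ?l (-3) (-2) + ?l 2 3"
      unfolding vert_def using split[of "-3" "-2" 3] split[of "-2" 2 3] by simp
    also have "cmod \<dots> \<le> K * exp (- real n) + K * exp (- real n)"
      by (intro order.trans[OF norm_triangle_ineq] add_mono small) auto
    finally show ?thesis by simp
  qed
  then have "\<forall>\<^sub>F n in sequentially. norm (vert \<Phi> (real n) 3 z - vert \<Phi> (real n) 2 z) \<le> 2 * K * exp (- real n)"
    by (auto simp: eventually_sequentially)
  moreover have "(\<lambda>n. 2 * K * exp (- real n)) \<longlonglongrightarrow> 2 * K * 0"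
    by (intro tendsto_intros) real_asymp
  then have "(\<lambda>n. 2 * K * exp (- real n)) \<longlonglongrightarrow> 0" by simp
  ultimately show ?thesis by (rule Lim_null_comparison)
qed

text \<open>The inner contour is used: discs of radius 1/2 about its points stay in
  \<open>strip (1/2) (5/2)\<close>, so their images miss \<open>z\<close>. The horizontal sides
  contribute \<open>8 * K\<close> and the vertical side \<open>16 * K\<close>; the division by
  \<open>2 * pi\<close> is given away.\<close>

lemma cauchy_transform_bound_outside:
  assumes z: "z \<notin> psi ` strip (1/2) (5/2)"
  shows "cmod (cauchy_transform \<Phi> z) \<le> 32 * K"
proof -
  have kb: "cmod (kern \<Phi> z s) \<le> 4 * K * exp (- Re s)"
    if "1 \<le> Re s" "\<bar>Im s\<bar> \<le> 2" "Re s = 1 \<or> \<bar>Im s\<bar> = 2" for s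
  proof (rule kern_bound)
    have "ball s (1/2) \<subseteq> strip (1/2) (5/2)"
    proof
      fix w assume "w \<in> ball s (1/2)"
      then have "cmod (s - w) < 1/2" by (simp add: dist_norm)
      then have "\<bar>Re s - Re w\<bar> < 1/2" "\<bar>Im s - Im w\<bar> < 1/2"
        using abs_Re_le_cmod[of "s - w"] abs_Im_le_cmod[of "s - w"] by auto
      then have "1/2 < Re w" "\<bar>Im w\<bar> < 5/2" using that(1,2) by (simp_all only: abs_less_iff abs_le_iff) linarith+
      then show "w \<in> strip (1/2) (5/2)" by (simp add: strip_def)
    qed
    then show "z \<notin> psi ` ball s (1/2)" using z by blast
  qed (use that in auto)
  have e: "cmod (vert \<Phi> (real n) 2 z) \<le> 32 * K" if n: "n \<ge> 2" for n
  proof -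
    have sub: "cbox (Complex 1 (-2)) (Complex n 2) \<subseteq> strip (1/2) (5/2)"
      by (auto simp: in_cbox_rect strip_def)
    then have nz: "z \<notin> psi ` cbox (Complex 1 (-2)) (Complex n 2)" using z by blast
    have "path_image (rectpath (Complex 1 (-2)) (Complex n 2)) \<subseteq> cbox (Complex 1 (-2)) (Complex n 2)"
      using n by (intro path_image_rectpath_subset_cbox) auto
    then have "cmod (vert \<Phi> (real n) 2 z - vert \<Phi> 1 2 z - 0) \<le> 2 * (4 * K) * exp (- 1)"
      using nz n K_nonneg kb
      by (intro vert_compare[OF \<Phi> _ _ _ _ kern_rectangle_outside[OF \<Phi> _ _ _ _ nz]]) auto
    also have "\<dots> \<le> 2 * (4 * K) * 1"
      using K_nonneg by (intro mult_left_mono) auto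
    finally have 1: "cmod (vert \<Phi> (real n) 2 z - vert \<Phi> 1 2 z) \<le> 8 * K" by simp
    have "cmod (vert \<Phi> 1 2 z) \<le> 4 * K * (2 * 2)"
    proof (rule vert_bound[OF \<Phi>])
      fix s assume s: "Re s = 1" "\<bar>Im s\<bar> \<le> 2"
      have "cmod (kern \<Phi> z s) \<le> 4 * K * exp (- 1)" using kb[of s] s by simp
      also have "\<dots> \<le> 4 * K * 1" using K_nonneg by (intro mult_left_mono) auto
      finally show "cmod (kern \<Phi> z s) \<le> 4 * K" by simp
      have "s \<in> strip (1/2) (5/2)" using s by (simp add: strip_def)
      then show "psi s \<noteq> z" using z by blast
    qed (use K_nonneg in auto)
    then show ?thesis
      using 1 norm_triangle_ineq[of "vert \<Phi> (real n) 2 z - vert \<Phi> 1 2 z" "vert \<Phi> 1 2 z"] K_nonneg by simp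
  qed
  have "(\<lambda>n. vert \<Phi> (real n) 3 z - (vert \<Phi> (real n) 3 z - vert \<Phi> (real n) 2 z)) \<longlonglongrightarrow>
      2 * pi * \<i> * cauchy_transform \<Phi> z - 0"
    by (intro tendsto_diff cauchy_transform_limit vert_3_2_diff)
  then have "(\<lambda>n. cmod (vert \<Phi> (real n) 2 z)) \<longlonglongrightarrow> cmod (2 * pi * \<i> * cauchy_transform \<Phi> z)"
    by (intro tendsto_norm) simp
  then have "cmod (2 * pi * \<i> * cauchy_transform \<Phi> z) \<le> 32 * K"
    by (rule Lim_bounded[where M = 2]) (use e in auto)
  then have "1 * cmod (cauchy_transform \<Phi> z) \<le> 32 * K"
    using mult_right_mono[of 1 "2 * pi" "cmod (cauchy_transform \<Phi> z)"] pi_gt3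
    by (simp add: norm_mult)
  then show ?thesis by simp
qed

text \<open>The outer contour encloses \<open>s0\<close> and keeps distance at least 1/2 from it,
  and the enclosed pole contributes \<open>\<Phi> s0\<close>. The horizontal sides give
  \<open>8 * K\<close> and the vertical side of length 6 gives \<open>24 * K\<close>, which is the
  origin of 32.\<close>

lemma cauchy_transform_bound_inside:
  assumes s0: "s0 \<in> strip (1/2) (5/2)"
  shows "cmod (cauchy_transform \<Phi> (psi s0) - \<Phi> s0) \<le> 32 * K"
proof -
  have s0D: "s0 \<in> strip (-1) 4" using s0 by (auto simp: strip_def)
  have kb: "cmod (kern \<Phi> (psi s0) s) \<le> 4 * K * exp (- Re s)"
    if s: "0 \<le> Re s" "\<bar>Im s\<bar> \<le> 3" "Re s = 0 \<or> \<bar>Im s\<bar> = 3" for s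
  proof (rule kern_bound)
    show "psi s0 \<notin> psi ` ball s (1/2)"
    proof
      assume "psi s0 \<in> psi ` ball s (1/2)"
      then obtain w where w: "w \<in> ball s (1/2)" "psi s0 = psi w" by blast
      have "cball s (1/2) \<subseteq> strip (-1) 4" using s by (intro cball_subset_strip) auto
      then have "w \<in> strip (-1) 4" using w by force
      then have "s0 = w" using w inj_onD[OF inj_psi _ s0D] by auto
      then have "cmod (s - s0) < 1/2" using w by (simp add: dist_norm)
      then have "\<bar>Re s - Re s0\<bar> < 1/2" "\<bar>Im s - Im s0\<bar> < 1/2"
        using abs_Re_le_cmod[of "s - s0"] abs_Im_le_cmod[of "s - s0"] by auto
      moreover have "1/2 < Re s0" "\<bar>Im s0\<bar> < 5/2" using s0 by (auto simp: strip_def)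
      ultimately show False using s(3) by linarith
    qed
  qed (use s in auto)
  have e: "cmod (vert \<Phi> (real n) 3 (psi s0) - 2 * pi * \<i> * \<Phi> s0) \<le> 32 * K" if n: "Re s0 < n" for n
  proof -
    have box: "s0 \<in> box (Complex 0 (-3)) (Complex n 3)" using s0 n by (auto simp: in_box_rect strip_def)
    have n0: "0 < real n" using n s0 by (auto simp: strip_def)
    have P: "path_image (rectpath (Complex 0 (-3)) (Complex n 3)) \<subseteq> strip (-1) 4 - {s0}"
    proof -
      have "path_image (rectpath (Complex 0 (-3)) (Complex n 3)) \<subseteq> cbox (Complex 0 (-3)) (Complex n 3)"
        by (intro path_image_rectpath_subset_cbox) auto
      moreover have "path_image (rectpath (Complex 0 (-3)) (Complex n 3)) \<inter> box (Complex 0 (-3)) (Complex n 3) = {}"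
        by (intro path_image_rectpath_inter_box) auto
      ultimately show ?thesis using box cbox_subset_strip[of 0 3 n] by auto
    qed
    have nz: "psi s0 \<notin> psi ` path_image (rectpath (Complex 0 (-3)) (Complex n 3))"
    proof
      assume "psi s0 \<in> psi ` path_image (rectpath (Complex 0 (-3)) (Complex n 3))"
      then obtain w where "w \<in> path_image (rectpath (Complex 0 (-3)) (Complex n 3))" "psi s0 = psi w" by blast
      then show False using P inj_onD[OF inj_psi _ s0D, of w] by auto
    qed
    have "cmod (vert \<Phi> (real n) 3 (psi s0) - vert \<Phi> 0 3 (psi s0) - 2 * pi * \<i> * \<Phi> s0) \<le> 2 * (4 * K) * exp (- 0)"
      using nz n0 K_nonneg kb
      by (intro vert_compare[OF \<Phi> _ _ _ _ kern_rectangle_inside[OF \<Phi> _ _ _ _ box]]) auto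
    then have 1: "cmod (vert \<Phi> (real n) 3 (psi s0) - 2 * pi * \<i> * \<Phi> s0 - vert \<Phi> 0 3 (psi s0)) \<le> 8 * K"
      by (simp add: algebra_simps)
    have "cmod (vert \<Phi> 0 3 (psi s0)) \<le> 4 * K * (2 * 3)"
    proof (rule vert_bound[OF \<Phi>])
      fix s assume s: "Re s = 0" "\<bar>Im s\<bar> \<le> 3"
      show "cmod (kern \<Phi> (psi s0) s) \<le> 4 * K" using kb[of s] s by simp
      have "s \<in> strip (-1) 4" "s \<noteq> s0" using s s0 by (auto simp: strip_def)
      then show "psi s \<noteq> psi s0" using inj_onD[OF inj_psi, of s s0] s0D by auto
    qed (use K_nonneg in auto)
    then show ?thesis
      using 1 norm_triangle_ineq[of "vert \<Phi> (real n) 3 (psi s0) - 2 * pi * \<i> * \<Phi> s0 - vert \<Phi> 0 3 (psi s0)" "vert \<Phi> 0 3 (psi s0)"] by simp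
  qed
  obtain n0 :: nat where n0: "Re s0 < n0" using reals_Archimedean2 by blast
  have "(\<lambda>n. cmod (vert \<Phi> (real n) 3 (psi s0) - 2 * pi * \<i> * \<Phi> s0)) \<longlonglongrightarrow>
      cmod (2 * pi * \<i> * cauchy_transform \<Phi> (psi s0) - 2 * pi * \<i> * \<Phi> s0)"
    by (intro tendsto_norm tendsto_diff cauchy_transform_limit tendsto_const)
  then have "cmod (2 * pi * \<i> * cauchy_transform \<Phi> (psi s0) - 2 * pi * \<i> * \<Phi> s0) \<le> 32 * K"
    by (rule Lim_bounded[where M = n0]) (use e n0 in auto)
  then have "cmod (2 * pi * \<i>) * cmod (cauchy_transform \<Phi> (psi s0) - \<Phi> s0) \<le> 32 * K"
    by (simp flip: norm_mult add: right_diff_distrib)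
  then show ?thesis
    using mult_right_mono[of 1 "2 * pi" "cmod (cauchy_transform \<Phi> (psi s0) - \<Phi> s0)"] pi_gt3
    by (simp add: norm_mult)
qed

end

text \<open>Symmetrising under complex conjugation makes the transform real on the real axis.\<close>

lemma (in tract) cauchy_transform_exists:
  assumes \<Phi>: "\<Phi> holomorphic_on strip (-1) 4"
    and decay: "\<And>s. 0 \<le> Re s \<Longrightarrow> \<bar>Im s\<bar> \<le> 3 \<Longrightarrow> Re s \<le> 1 \<or> 2 \<le> \<bar>Im s\<bar> \<Longrightarrow> cmod (\<Phi> s) \<le> K * exp (- Re s)"
    and sym: "\<And>s. s \<in> strip (1/2) (5/2) \<Longrightarrow> \<Phi> (cnj s) = cnj (\<Phi> s)"
  obtains F where "F holomorphic_on UNIV" "\<And>z. F (cnj z) = cnj (F z)"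
    "\<And>z. z \<notin> psi ` strip (1/2) (5/2) \<Longrightarrow> cmod (F z) \<le> 32 * K"
    "\<And>s. s \<in> strip (1/2) (5/2) \<Longrightarrow> cmod (F (psi s) - \<Phi> s) \<le> 32 * K"
proof -
  interpret tract_kernel a \<Phi> K by unfold_locales (use \<Phi> decay in auto)
  define G where "G = cauchy_transform \<Phi>"
  define F where "F z = (G z + cnj (G (cnj z))) / 2" for z
  have hG: "G holomorphic_on UNIV" unfolding G_def by (rule cauchy_transform_limit)
  have half: "cmod ((x + y) / 2) \<le> c" if "cmod x \<le> c" "cmod y \<le> c" for x y c
    using norm_triangle_ineq[of x y] that by (simp add: norm_divide)
  have cs: "cnj s \<in> strip (1/2) (5/2) \<longleftrightarrow> s \<in> strip (1/2) (5/2)" for s by (simp add: strip_def)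
  have sD: "s \<in> strip (-1) 4" if "s \<in> strip (1/2) (5/2)" for s using that by (auto simp: strip_def)
  show ?thesis
  proof (rule that[of F])
    have "(cnj \<circ> G \<circ> cnj) holomorphic_on UNIV"
      using hG by (subst holomorphic_on_compose_cnj_cnj) (auto simp: image_def)
    then show "F holomorphic_on UNIV"
      unfolding F_def using hG by (intro holomorphic_intros) (auto simp: o_def)
    show "F (cnj z) = cnj (F z)" for z by (simp add: F_def add.commute)
    show "cmod (F z) \<le> 32 * K" if z: "z \<notin> psi ` strip (1/2) (5/2)" for z
    proof -
      have "cnj z \<notin> psi ` strip (1/2) (5/2)"
      proof
        assume "cnj z \<in> psi ` strip (1/2) (5/2)"
        then obtain s where s: "s \<in> strip (1/2) (5/2)" "cnj z = psi s" by blast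
        then have "z = psi (cnj s)" using psi_cnj[OF sD[OF s(1)]] by (metis complex_cnj_cnj)
        then show False using z s cs by blast
      qed
      then show ?thesis
        unfolding F_def G_def using z
        by (intro half) (auto intro: cauchy_transform_bound_outside)
    qed
    show "cmod (F (psi s) - \<Phi> s) \<le> 32 * K" if s: "s \<in> strip (1/2) (5/2)" for s
    proof -
      have "cmod (cnj (G (psi (cnj s)) - \<Phi> (cnj s))) \<le> 32 * K"
        unfolding complex_mod_cnj G_def using s cs by (intro cauchy_transform_bound_inside) auto
      then have "cmod (((G (psi s) - \<Phi> s) + (cnj (G (cnj (psi s))) - \<Phi> s)) / 2) \<le> 32 * K"
        using s cauchy_transform_bound_inside[OF s]
        by (intro half) (auto simp: G_def psi_cnj[OF sD[OF s]] sym[OF s])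
      then show ?thesis by (simp add: F_def field_simps)
    qed
  qed
qed

section \<open>Moving the zeros of an odd entire function\<close>

lemma entire_eqI_off_finite:
  fixes f g :: "complex \<Rightarrow> complex"
  assumes "f holomorphic_on UNIV" "g holomorphic_on UNIV" "finite S" "\<And>z. z \<notin> S \<Longrightarrow> f z = g z"
  shows "f z = g z"
proof (rule analytic_continuation_open[of "- S" UNIV f g z])
  show "open (- S)" using \<open>finite S\<close> by (simp add: finite_imp_closed open_Compl)
  show "- S \<noteq> {}" using \<open>finite S\<close> infinite_UNIV_char_0[where 'a=complex]
    by (metis Compl_empty_eq double_compl)
qed (use assms in auto)

lemma holomorphic_compose_uminus:
  assumes "f holomorphic_on UNIV" shows "(\<lambda>z. f (- z)) holomorphic_on UNIV"
  using holomorphic_on_compose_gen[of uminus UNIV f UNIV] holomorphic_on_minus[OF holomorphic_on_ident] assms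
  by (simp add: o_def)

lemma holomorphic_compose_cnj:
  assumes "f holomorphic_on UNIV" shows "(\<lambda>z. cnj (f (cnj z))) holomorphic_on UNIV"
proof -
  have "(cnj \<circ> f \<circ> cnj) holomorphic_on UNIV"
    using assms by (subst holomorphic_on_compose_cnj_cnj) (auto simp: image_def)
  then show ?thesis by (simp add: o_def)
qed

definition divide_zero :: "complex \<Rightarrow> (complex \<Rightarrow> complex) \<Rightarrow> complex \<Rightarrow> complex" where
  "divide_zero p h z = (if z = p then deriv h p else h z / (z - p))"

lemma divide_zero:
  assumes "h holomorphic_on UNIV" "h p = 0"
  shows "divide_zero p h holomorphic_on UNIV" and "divide_zero p h z * (z - p) = h z"
proof -
  have "(\<lambda>z. if z = p then deriv h p else (h z - h p) / (z - p)) holomorphic_on UNIV"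
    using assms by (intro pole_lemma_open) auto
  moreover have "(\<lambda>z. if z = p then deriv h p else (h z - h p) / (z - p)) = divide_zero p h"
    using assms by (auto simp: divide_zero_def)
  ultimately show "divide_zero p h holomorphic_on UNIV" by simp
qed (use assms in \<open>simp add: divide_zero_def\<close>)

definition shift_zeros :: "real \<Rightarrow> real \<Rightarrow> (complex \<Rightarrow> complex) \<Rightarrow> complex \<Rightarrow> complex" where
  "shift_zeros p r h z =
     (z\<^sup>2 - (of_real r)\<^sup>2) * divide_zero (- of_real p) (divide_zero (of_real p) h) z"

text \<open>The multiplied form of the identity remains valid at \<open>p\<close> and
  \<open>- p\<close>, where the quotient is of the form 0/0.\<close>

lemma shift_zeros:
  assumes h: "h holomorphic_on UNIV" "h (of_real p) = 0" "h (- of_real p) = 0" and "p \<noteq> 0"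
  shows "shift_zeros p r h holomorphic_on UNIV"
    and "shift_zeros p r h z * (z\<^sup>2 - (of_real p)\<^sup>2) = h z * (z\<^sup>2 - (of_real r)\<^sup>2)"
proof -
  define g where "g = divide_zero (of_real p) h"
  have g: "g holomorphic_on UNIV" "\<And>z. g z * (z - of_real p) = h z"
    unfolding g_def using divide_zero[OF h(1,2)] by auto
  have "g (- of_real p) * (- of_real p - of_real p) = 0" unfolding g(2) by (rule h(3))
  moreover have "- of_real p - of_real p \<noteq> (0::complex)"
    using \<open>p \<noteq> 0\<close> by (metis add_eq_0_iff2 diff_0 diff_minus_eq_add minus_diff_eq mult_2 mult_eq_0_iff of_real_eq_0_iff zero_neq_numeral)
  ultimately have g0: "g (- of_real p) = 0" by simp
  note d = divide_zero[OF g(1) g0]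
  show "shift_zeros p r h holomorphic_on UNIV"
    unfolding shift_zeros_def[abs_def] g_def[symmetric] by (intro holomorphic_intros d)
  have "shift_zeros p r h z * (z\<^sup>2 - (of_real p)\<^sup>2) =
      (z\<^sup>2 - (of_real r)\<^sup>2) * ((divide_zero (- of_real p) g z * (z - - of_real p)) * (z - of_real p))"
    unfolding shift_zeros_def g_def[symmetric] by (simp add: power2_eq_square algebra_simps)
  also have "\<dots> = h z * (z\<^sup>2 - (of_real r)\<^sup>2)" unfolding d(2) g(2) by simp
  finally show "shift_zeros p r h z * (z\<^sup>2 - (of_real p)\<^sup>2) = h z * (z\<^sup>2 - (of_real r)\<^sup>2)" .
qed

text \<open>The limit of \<open>corr\<close> is the product of \<open>D\<close> with the factors \<open>(z\<^sup>2 - r\<^sub>n\<^sup>2) / (z\<^sup>2 - p\<^sub>n\<^sup>2)\<close>,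
  which moves the zeros \<open>\<plusminus>p\<^sub>n\<close> of \<open>D\<close> to the prescribed points \<open>\<plusminus>r\<^sub>n\<close>.\<close>

locale zero_shift =
  fixes D :: "complex \<Rightarrow> complex" and p r :: "nat \<Rightarrow> real" and U :: "nat \<Rightarrow> complex set"
  assumes D: "D holomorphic_on UNIV" and D_odd: "\<And>z. D (- z) = - D z" and D_cnj: "\<And>z. D (cnj z) = cnj (D z)"
    and D_p: "\<And>n. D (of_real (p n)) = 0"
    and p_pos: "\<And>n. 0 < p n" and r_pos: "\<And>n. 0 < r n"
    and p_inj: "\<And>m n. m \<noteq> n \<Longrightarrow> p m \<noteq> p n" and p_r: "\<And>m n. m \<noteq> n \<Longrightarrow> p m \<noteq> r n"
    and p_U: "\<And>n. of_real (p n) \<in> U n"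
    and U: "\<And>n z. z \<notin> U n \<Longrightarrow> - z \<notin> U n \<Longrightarrow>
        \<bar>(p n)\<^sup>2 - (r n)\<^sup>2\<bar> \<le> (1/2) ^ (n + 2) * cmod (z\<^sup>2 - (of_real (p n))\<^sup>2)"
    and U_escape: "\<And>R. \<exists>n0. \<forall>n\<ge>n0. \<forall>z\<in>U n. R < cmod z"
    and U_bounded: "\<And>n. bounded (U n)"
    and U_frontier: "\<And>m n z. z \<in> frontier (U n) \<Longrightarrow> z \<notin> U m \<and> - z \<notin> U m"
begin

primrec corr :: "nat \<Rightarrow> complex \<Rightarrow> complex" where
  "corr 0 = D"
| "corr (Suc n) = shift_zeros (p n) (r n) (corr n)"

lemma square_nz: "m \<noteq> n \<Longrightarrow> (complex_of_real (p m))\<^sup>2 - (of_real (p n))\<^sup>2 \<noteq> 0"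
  and square_nz': "m \<noteq> n \<Longrightarrow> (complex_of_real (r m))\<^sup>2 - (of_real (p n))\<^sup>2 \<noteq> 0"
proof -
  have "(complex_of_real x)\<^sup>2 - (of_real y)\<^sup>2 \<noteq> 0" if "0 < x" "0 < y" "x \<noteq> y" for x y :: real
  proof -
    have "x\<^sup>2 \<noteq> y\<^sup>2" using that by (simp add: power2_eq_iff_nonneg)
    then have "complex_of_real (x\<^sup>2) \<noteq> of_real (y\<^sup>2)" by (simp only: of_real_eq_iff not_False_eq_True)
    then show ?thesis by simp
  qed
  then show "m \<noteq> n \<Longrightarrow> (complex_of_real (p m))\<^sup>2 - (of_real (p n))\<^sup>2 \<noteq> 0"
    "m \<noteq> n \<Longrightarrow> (complex_of_real (r m))\<^sup>2 - (of_real (p n))\<^sup>2 \<noteq> 0"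
    using p_pos r_pos p_inj p_r[of n m] by metis+
qed

text \<open>Zeros of index \<open>N\<close> and above are still in place in \<open>corr N\<close>.
  This makes the next division legitimate, so holomorphy and vanishing go through a single
  induction.\<close>

lemma corr:
  shows holomorphic_corr: "corr N holomorphic_on UNIV"
    and corr_p: "N \<le> n \<Longrightarrow> corr N (of_real (p n)) = 0 \<and> corr N (- of_real (p n)) = 0"
proof (induction N arbitrary: n)
  case 0
  show "corr 0 holomorphic_on UNIV" by (simp add: D)
  show "corr 0 (of_real (p n)) = 0 \<and> corr 0 (- of_real (p n)) = 0" for n
    by (simp add: D_p D_odd)
next
  case (Suc N)
  have pN: "p N \<noteq> 0" using p_pos[of N] by simp
  note s = shift_zeros[OF Suc.IH(1) conjunct1[OF Suc.IH(2)] conjunct2[OF Suc.IH(2)] pN, OF order.refl order.refl]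
  show "corr (Suc N) holomorphic_on UNIV" using s(1) by simp
  fix n assume n: "Suc N \<le> n"
  then have "(complex_of_real (p n))\<^sup>2 - (of_real (p N))\<^sup>2 \<noteq> 0" by (intro square_nz) auto
  then show "corr (Suc N) (of_real (p n)) = 0 \<and> corr (Suc N) (- of_real (p n)) = 0"
    using s(2)[of "r N" "of_real (p n)"] s(2)[of "r N" "- of_real (p n)"] Suc.IH(2)[of n] n by auto
qed

lemma corr_Suc: "corr (Suc N) z * (z\<^sup>2 - (of_real (p N))\<^sup>2) = corr N z * (z\<^sup>2 - (of_real (r N))\<^sup>2)"
  using shift_zeros(2)[OF holomorphic_corr[of N] conjunct1[OF corr_p[of N N]] conjunct2[OF corr_p[of N N]],
      of "r N" z] p_pos[of N]
  by simp

lemma corr_r: "n < N \<Longrightarrow> corr N (of_real (r n)) = 0"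
proof (induction N)
  case (Suc N)
  show ?case
  proof (cases "n = N")
    case True
    then show ?thesis by (simp add: shift_zeros_def)
  next
    case False
    then have "corr N (of_real (r n)) = 0" using Suc by simp
    then show ?thesis using corr_Suc[of N "of_real (r n)"] square_nz'[OF False] by simp
  qed
qed simp

text \<open>The recursion divides by \<open>z - p\<close> and \<open>z + p\<close> one after the
  other and hides the symmetry. The identity \<open>corr_Suc\<close>, whose factors are symmetric,
  gives it off two points, and the identity theorem everywhere.\<close>

lemma corr_symmetric: "corr N (- z) = - corr N z" "corr N (cnj z) = cnj (corr N z)"
proof (induction N arbitrary: z)
  case 0
  show "corr 0 (- z) = - corr 0 z" "corr 0 (cnj z) = cnj (corr 0 z)" for z by (auto simp: D_odd D_cnj)
next
  case (Suc N)
  let ?S = "{of_real (p N), - of_real (p N)} :: complex set"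
  have nz: "z\<^sup>2 - (of_real (p N))\<^sup>2 \<noteq> 0" if "z \<notin> ?S" for z :: complex
    using that by (auto simp: power2_eq_iff)
  have eq: "a = b" if "a * c = b * c" "c \<noteq> 0" for a b c :: complex using that by simp
  have "- corr (Suc N) (- z) = corr (Suc N) z" for z
  proof (rule entire_eqI_off_finite[of "\<lambda>z. - corr (Suc N) (- z)" "corr (Suc N)" ?S])
    show "- corr (Suc N) (- z) = corr (Suc N) z" if "z \<notin> ?S" for z
    proof (rule eq[of _ "z\<^sup>2 - (of_real (p N))\<^sup>2"])
      have "- corr (Suc N) (- z) * (z\<^sup>2 - (of_real (p N))\<^sup>2) =
          - (corr (Suc N) (- z) * ((- z)\<^sup>2 - (of_real (p N))\<^sup>2))" by simp
      also have "\<dots> = corr N z * (z\<^sup>2 - (of_real (r N))\<^sup>2)"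
        unfolding corr_Suc Suc.IH(1)[of z] by simp
      finally show "- corr (Suc N) (- z) * (z\<^sup>2 - (of_real (p N))\<^sup>2) =
          corr (Suc N) z * (z\<^sup>2 - (of_real (p N))\<^sup>2)" unfolding corr_Suc .
    qed (rule nz[OF that])
  qed (auto intro!: holomorphic_intros holomorphic_compose_uminus holomorphic_corr simp del: corr.simps)
  then show "corr (Suc N) (- z) = - corr (Suc N) z" for z by (metis minus_minus)
  have "cnj (corr (Suc N) (cnj z)) = corr (Suc N) z" for z
  proof (rule entire_eqI_off_finite[of "\<lambda>z. cnj (corr (Suc N) (cnj z))" "corr (Suc N)" ?S])
    show "cnj (corr (Suc N) (cnj z)) = corr (Suc N) z" if "z \<notin> ?S" for z
    proof (rule eq[of _ "z\<^sup>2 - (of_real (p N))\<^sup>2"])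
      have "cnj (corr (Suc N) (cnj z)) * (z\<^sup>2 - (of_real (p N))\<^sup>2) =
          cnj (corr (Suc N) (cnj z) * ((cnj z)\<^sup>2 - (of_real (p N))\<^sup>2))" by simp
      also have "\<dots> = corr N z * (z\<^sup>2 - (of_real (r N))\<^sup>2)"
        unfolding corr_Suc Suc.IH(2)[of z] by simp
      finally show "cnj (corr (Suc N) (cnj z)) * (z\<^sup>2 - (of_real (p N))\<^sup>2) =
          corr (Suc N) z * (z\<^sup>2 - (of_real (p N))\<^sup>2)" unfolding corr_Suc .
    qed (rule nz[OF that])
  qed (auto intro!: holomorphic_compose_cnj holomorphic_corr simp del: corr.simps)
  then show "corr (Suc N) (cnj z) = cnj (corr (Suc N) z)" for z by (metis complex_cnj_cnj)
qed

text \<open>The \<open>n\<close>-th factor minus 1 is \<open>(p^2 - r^2) / (z^2 - p^2)\<close>,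
  exactly the quotient that the assumption on \<open>U n\<close> controls.\<close>

lemma corr_diff:
  assumes z: "z \<notin> U n" "- z \<notin> U n"
  shows "cmod (corr (Suc n) z - corr n z) \<le> (1/2) ^ (n + 2) * cmod (corr n z)"
proof -
  let ?d = "z\<^sup>2 - (of_real (p n))\<^sup>2"
  have nz: "?d \<noteq> 0" using z p_U[of n] by (auto simp: power2_eq_iff)
  have "(corr (Suc n) z - corr n z) * ?d = corr n z * (of_real ((p n)\<^sup>2 - (r n)\<^sup>2))"
    unfolding left_diff_distrib corr_Suc by (simp add: algebra_simps)
  then have "cmod (corr (Suc n) z - corr n z) * cmod ?d = cmod (corr n z) * \<bar>(p n)\<^sup>2 - (r n)\<^sup>2\<bar>"
    by (metis norm_mult norm_of_real)
  also have "\<dots> \<le> cmod (corr n z) * ((1/2) ^ (n + 2) * cmod ?d)"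
    using U[OF z] by (intro mult_left_mono) auto
  also have "\<dots> = ((1/2) ^ (n + 2) * cmod (corr n z)) * cmod ?d" by (simp only: mult_ac)
  finally show ?thesis using nz by (simp only: mult_le_cancel_right_pos zero_less_norm_iff not_False_eq_True)
qed

text \<open>With relative errors \<open>2^-(n+2)\<close> the two closed forms reproduce themselves
  in the induction and converge to 2 and 1/2. The general start \<open>n0\<close> serves bounded
  discs, which meet only finitely many of the sets \<open>U n\<close> and their reflections.\<close>

lemma corr_bounds:
  assumes z: "\<And>n. n0 \<le> n \<Longrightarrow> z \<notin> U n \<and> - z \<notin> U n"
  shows "cmod (corr (n0 + N) z) \<le> cmod (corr n0 z) * (2 - (1/2) ^ N)"
    and "cmod (corr n0 z) * (1/2 + (1/2) ^ N / 2) \<le> cmod (corr (n0 + N) z)"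
proof (induction N)
  case (Suc N)
  define x :: real where "x = (1/2) ^ N"
  have x: "0 < x" "x \<le> 1" by (auto simp: x_def power_le_one)
  let ?c = "cmod (corr n0 z)" and ?y = "cmod (corr (n0 + N) z)"
  have "(1/2) ^ (n0 + N + 2) \<le> x / 4"
    using power_decreasing[of "N + 2" "n0 + N + 2" "1/2 :: real"] by (simp add: x_def)
  then have "(1/2) ^ (n0 + N + 2) * ?y \<le> x / 4 * ?y" by (rule mult_right_mono) auto
  then have d: "cmod (corr (Suc (n0 + N)) z - corr (n0 + N) z) \<le> x / 4 * ?y"
    using corr_diff[of z "n0 + N"] z[of "n0 + N"] by auto
  have y: "?y \<le> ?c * (2 - x)" "?c * (1/2 + x/2) \<le> ?y" using Suc.IH by (auto simp: x_def)
  have "cmod (corr (Suc (n0 + N)) z) \<le> (1 + x/4) * ?y"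
    using d norm_triangle_sub[of "corr (Suc (n0 + N)) z" "corr (n0 + N) z"] by (simp add: algebra_simps)
  also have "\<dots> \<le> (1 + x/4) * (?c * (2 - x))" using y x by (intro mult_left_mono) auto
  also have "\<dots> = ?c * ((1 + x/4) * (2 - x))" by simp
  also have "\<dots> \<le> ?c * (2 - x/2)" using x by (intro mult_left_mono) (auto simp: algebra_simps)
  finally show "cmod (corr (n0 + Suc N) z) \<le> ?c * (2 - (1/2) ^ Suc N)" by (simp add: x_def)
  have "?c * (1/2 + x/4) \<le> ?c * ((1 - x/4) * (1/2 + x/2))"
  proof (rule mult_left_mono)
    have "x * x \<le> x * 1" using x by (intro mult_left_mono) auto
    then show "1/2 + x/4 \<le> (1 - x/4) * (1/2 + x/2)" by (simp add: algebra_simps)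
  qed simp
  also have "\<dots> = (1 - x/4) * (?c * (1/2 + x/2))" by simp
  also have "\<dots> \<le> (1 - x/4) * ?y" using y x by (intro mult_left_mono) auto
  also have "\<dots> \<le> cmod (corr (Suc (n0 + N)) z)"
    using d norm_triangle_sub[of "corr (n0 + N) z" "corr (Suc (n0 + N)) z"]
    by (simp add: algebra_simps norm_minus_commute)
  finally show "?c * (1/2 + (1/2) ^ Suc N / 2) \<le> cmod (corr (n0 + Suc N) z)" by (simp add: x_def)
qed auto

text \<open>The limit of \<open>corr\<close>, written as a telescoping series so that the
  Weierstrass test applies.\<close>

definition shifted :: "complex \<Rightarrow> complex" where
  "shifted z = D z + (\<Sum>n. corr (Suc n) z - corr n z)"

lemma corr_uniform_limit: "uniform_limit (cball 0 R) corr shifted sequentially"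
proof -
  obtain n0 where n0: "\<forall>n\<ge>n0. \<forall>z\<in>U n. R < cmod z" using U_escape by blast
  then have notin: "z \<notin> U n \<and> - z \<notin> U n" if "z \<in> cball 0 R" "n0 \<le> n" for z n
    using that by (metis mem_cball_0 norm_minus_cancel not_less)
  have "continuous_on (cball 0 R) (corr n0)"
    using holomorphic_on_imp_continuous_on[OF holomorphic_corr] continuous_on_subset by blast
  then have "bounded (corr n0 ` cball 0 R)"
    by (intro compact_imp_bounded compact_continuous_image) auto
  then obtain M where M: "\<And>z. z \<in> cball 0 R \<Longrightarrow> cmod (corr n0 z) \<le> M"
    unfolding bounded_iff by blast
  have bound: "cmod (corr (Suc n) z - corr n z) \<le> (1/2) ^ n * (M * 2)"
    if "n0 \<le> n" "z \<in> cball 0 R" for n z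
  proof -
    have "cmod (corr n z) \<le> cmod (corr n0 z) * (2 - (1/2) ^ (n - n0))"
      using corr_bounds(1)[of n0 z "n - n0"] notin[OF that(2)] that(1) by simp
    also have "\<dots> \<le> M * 2"
    proof (rule mult_mono[OF M[OF that(2)]])
      show "2 - (1/2) ^ (n - n0) \<le> (2::real)" by simp
      show "0 \<le> M" using order.trans[OF norm_ge_zero M[OF that(2)]] .
      have "(1/2) ^ (n - n0) \<le> (1::real)" by (simp add: power_le_one)
      then show "0 \<le> 2 - (1/2 :: real) ^ (n - n0)" by linarith
    qed
    finally have 1: "cmod (corr n z) \<le> M * 2" .
    have "cmod (corr (Suc n) z - corr n z) \<le> (1/2) ^ (n + 2) * cmod (corr n z)"
      using notin[OF that(2,1)] by (intro corr_diff) auto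
    also have "\<dots> \<le> (1/2) ^ n * (M * 2)"
      using 1 by (intro mult_mono power_decreasing) auto
    finally show ?thesis .
  qed
  have "uniform_limit (cball 0 R) (\<lambda>n z. \<Sum>i<n. corr (Suc i) z - corr i z)
      (\<lambda>z. \<Sum>i. corr (Suc i) z - corr i z) sequentially"
  proof (rule Weierstrass_m_test_ev)
    show "\<forall>\<^sub>F n in sequentially. \<forall>z\<in>cball 0 R. norm (corr (Suc n) z - corr n z) \<le> (1/2) ^ n * (M * 2)"
      using bound unfolding eventually_sequentially by blast
    show "summable (\<lambda>n. (1/2 :: real) ^ n * (M * 2))" by (intro summable_mult2 summable_geometric) auto
  qed
  moreover have "(\<Sum>i<n. corr (Suc i) z - corr i z) = corr n z - D z" for n z
    using sum_lessThan_telescope[of "\<lambda>n. corr n z" n] by (simp del: corr.simps(2))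
  ultimately have "uniform_limit (cball 0 R) (\<lambda>n z. corr n z - D z) (\<lambda>z. \<Sum>i. corr (Suc i) z - corr i z) sequentially"
    by (simp only:)
  then have "uniform_limit (cball 0 R) (\<lambda>n z. D z + (corr n z - D z)) (\<lambda>z. D z + (\<Sum>i. corr (Suc i) z - corr i z)) sequentially"
    by (intro uniform_limit_intros)
  then show ?thesis by (simp add: shifted_def[abs_def])
qed

lemma corr_tendsto: "(\<lambda>n. corr n z) \<longlonglongrightarrow> shifted z"
  using corr_uniform_limit[of "cmod z"] by (rule tendsto_uniform_limitI) simp

lemma holomorphic_shifted: "shifted holomorphic_on UNIV"
proof (rule holomorphic_uniform_sequence)
  fix x :: complex
  have "cball x 1 \<subseteq> cball 0 (cmod x + 1)"
    by (intro cball_subset_cball_iff[THEN iffD2]) (auto simp: dist_norm)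
  then show "\<exists>d>0. cball x d \<subseteq> UNIV \<and> uniform_limit (cball x d) corr shifted sequentially"
    using corr_uniform_limit uniform_limit_on_subset zero_less_one by blast
qed (auto intro: holomorphic_corr)

lemma shifted_r: "shifted (of_real (r n)) = 0"
proof (rule LIMSEQ_unique[OF corr_tendsto])
  have "\<forall>\<^sub>F N in sequentially. corr N (of_real (r n)) = 0"
    using eventually_gt_at_top[of n] by eventually_elim (rule corr_r)
  then show "(\<lambda>N. corr N (of_real (r n))) \<longlonglongrightarrow> 0" by (rule tendsto_eventually)
qed

lemma shifted_odd: "shifted (- z) = - shifted z"
  by (rule LIMSEQ_unique[OF corr_tendsto[of "- z"]]) (simp add: corr_symmetric corr_tendsto tendsto_minus)

lemma shifted_cnj: "shifted (cnj z) = cnj (shifted z)"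
  by (rule LIMSEQ_unique[OF corr_tendsto[of "cnj z"]]) (simp add: corr_symmetric corr_tendsto lim_cnj)

lemma shifted_bounds:
  assumes z: "\<And>n. z \<notin> U n \<and> - z \<notin> U n"
  shows "cmod (shifted z) \<le> 2 * cmod (D z)" and "cmod (D z) / 2 \<le> cmod (shifted z)"
proof -
  have lim: "(\<lambda>n. cmod (corr n z)) \<longlonglongrightarrow> cmod (shifted z)" by (intro tendsto_norm corr_tendsto)
  have "cmod (corr n z) \<le> 2 * cmod (D z)" for n
  proof -
    have "cmod (corr n z) \<le> cmod (D z) * (2 - (1/2) ^ n)" using corr_bounds(1)[of 0 z n] z by simp
    also have "\<dots> \<le> cmod (D z) * 2" by (intro mult_left_mono) auto
    finally show ?thesis by simp
  qed
  then show "cmod (shifted z) \<le> 2 * cmod (D z)" using lim by (intro Lim_bounded[OF lim, of 0]) auto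
  have "cmod (D z) / 2 \<le> cmod (corr n z)" for n
  proof -
    have "cmod (D z) * (1/2) \<le> cmod (D z) * (1/2 + (1/2) ^ n / 2)" by (intro mult_left_mono) auto
    also have "\<dots> \<le> cmod (corr n z)" using corr_bounds(2)[of 0 z n] z by simp
    finally show ?thesis by simp
  qed
  then show "cmod (D z) / 2 \<le> cmod (shifted z)" using lim by (intro Lim_bounded2[OF lim, of 0]) auto
qed

text \<open>Inside \<open>U n\<close> the factor with denominator \<open>z^2 - p^2\<close> is
  uncontrolled. The frontier of \<open>U n\<close> avoids every \<open>U m\<close> and its
  reflection, so the bound holds there, and the maximum principle carries it inside.\<close>

lemma shifted_bound_U:
  assumes "z \<in> U n" and M: "\<And>w. w \<in> frontier (U n) \<Longrightarrow> cmod (D w) \<le> M"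
  shows "cmod (shifted z) \<le> 2 * M"
proof (rule maximum_modulus_frontier[OF _ _ U_bounded _ \<open>z \<in> U n\<close>])
  show "shifted holomorphic_on interior (U n)" using holomorphic_shifted holomorphic_on_subset by blast
  show "continuous_on (closure (U n)) shifted"
    using holomorphic_on_imp_continuous_on[OF holomorphic_shifted] continuous_on_subset by blast
  show "cmod (shifted w) \<le> 2 * M" if "w \<in> frontier (U n)" for w
    using shifted_bounds(1)[of w] U_frontier[OF that] M[OF that] by fastforce
qed

end

section \<open>The even and the odd part\<close>

lemma norm_cos_le_exp: "cmod (cos w) \<le> exp \<bar>Im w\<bar>"
proof -
  have "cmod (cos w) = cmod (exp (\<i> * w) + exp (- (\<i> * w))) / 2"
    by (simp add: cos_exp_eq norm_divide)
  also have "\<dots> \<le> (cmod (exp (\<i> * w)) + cmod (exp (- (\<i> * w)))) / 2"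
    by (intro divide_right_mono norm_triangle_ineq) simp
  also have "\<dots> = (exp (- Im w) + exp (Im w)) / 2" by (simp add: norm_exp_eq_Re)
  also have "\<dots> \<le> (exp \<bar>Im w\<bar> + exp \<bar>Im w\<bar>) / 2" by (intro divide_right_mono add_mono) auto
  finally show ?thesis by simp
qed

lemma cos_ge_quadratic: "1 - y\<^sup>2 / 2 \<le> cos (y::real)"
proof -
  have "(sin (y / 2))\<^sup>2 \<le> (y / 2)\<^sup>2"
    using power_mono[OF abs_sin_x_le_abs_x[of "y / 2"], of 2] by (simp add: power_divide)
  then show ?thesis using cos_double_sin[of "y / 2"] by (simp add: power_divide)
qed

text \<open>The first summand serves heights between 2 and 3, through
  \<open>exp (- (c * E)) \<le> 1 / (c * E)\<close> with \<open>c = - cos 2\<close> and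
  \<open>E = exp (Re s)\<close>; the second serves \<open>Re s \<le> 1\<close>.\<close>

definition decay_const :: real where
  "decay_const = 1 / (- cos 2) + exp (exp 1) * exp 1"

lemma decay_const_ge_1: "1 \<le> decay_const"
proof -
  have "1 * 1 \<le> exp (exp 1) * exp (1::real)" by (intro mult_mono) auto
  moreover have "0 \<le> 1 / (- cos (2::real))" using cos_two_less_zero by simp
  ultimately show ?thesis unfolding decay_const_def by linarith
qed

lemma cos_le_cos_2: "2 \<le> \<bar>y\<bar> \<Longrightarrow> \<bar>y\<bar> \<le> 3 \<Longrightarrow> cos y \<le> cos (2::real)"
  using cos_monotone_0_pi_le[of 2 "\<bar>y\<bar>"] pi_gt3 by simp

lemma exp_exp_decay:
  assumes "0 \<le> Re s" "\<bar>Im s\<bar> \<le> 3" "Re s \<le> 1 \<or> 2 \<le> \<bar>Im s\<bar>"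
  shows "cmod (exp (exp s)) \<le> decay_const * exp (- Re s)"
proof -
  have n: "cmod (exp (exp s)) = exp (exp (Re s) * cos (Im s))" by (simp add: norm_exp_eq_Re Re_exp)
  have c: "0 < - cos (2::real)" using cos_two_less_zero by simp
  show ?thesis
  proof (cases "2 \<le> \<bar>Im s\<bar>")
    case True
    let ?c = "- cos (2::real)"
    have "exp (Re s) * cos (Im s) \<le> exp (Re s) * cos 2"
      using cos_le_cos_2 True assms by (intro mult_left_mono) auto
    then have "exp (exp (Re s) * cos (Im s)) \<le> exp (- (?c * exp (Re s)))" by (simp add: mult.commute)
    also have "\<dots> \<le> 1 / ?c * exp (- Re s)"
    proof -
      have aux: "exp (- (d * E)) \<le> 1 / d * (1 / E)" if "0 < d" "0 < E" for d E :: real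
      proof -
        have "d * E \<le> exp (d * E)" using exp_ge_add_one_self[of "d * E"] by linarith
        then have "1 / exp (d * E) \<le> 1 / (d * E)" using that by (intro frac_le) auto
        then show ?thesis by (simp add: exp_minus divide_inverse mult.commute)
      qed
      show ?thesis using aux[OF c, of "exp (Re s)"] by (simp only: exp_minus inverse_eq_divide exp_gt_zero simp_thms)
    qed
    also have "\<dots> \<le> decay_const * exp (- Re s)"
      unfolding decay_const_def by (intro mult_right_mono) auto
    finally show ?thesis unfolding n .
  next
    case False
    then have x: "Re s \<le> 1" using assms by simp
    have "exp (Re s) * cos (Im s) \<le> exp 1 * 1"
      using x by (intro order.trans[OF mult_left_mono[OF cos_le_one] mult_right_mono]) auto
    then have "exp (exp (Re s) * cos (Im s)) \<le> exp (exp 1)" by simp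
    also have "\<dots> \<le> exp (exp 1) * exp 1 * exp (- Re s)"
      using x by (simp add: exp_minus field_simps)
    also have "\<dots> \<le> decay_const * exp (- Re s)"
      unfolding decay_const_def using c by (intro mult_right_mono) auto
    finally show ?thesis unfolding n .
  qed
qed

text \<open>The factor 1/8 leaves room below the square root of \<open>exp (exp s)\<close>, which is
  used up when bounds are spread over discs of radius 1/2. The term \<open>- 11 * s\<close> absorbs
  the growth \<open>exp (6 * Re s)\<close> of \<open>cos (s^2)\<close> at heights up to 3 and still
  leaves decay.\<close>

definition osc :: "complex \<Rightarrow> complex" where
  "osc s = exp (exp s / 8 - 11 * s) * cos (s\<^sup>2)"

lemma norm_osc_le:
  assumes "0 \<le> Re s" "\<bar>Im s\<bar> \<le> 3"
  shows "cmod (osc s) \<le> exp (Re (exp s) / 8 - 5 * Re s)"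
proof -
  have "cmod (osc s) = exp (Re (exp s) / 8 - 11 * Re s) * cmod (cos (s\<^sup>2))"
    by (simp add: osc_def norm_mult norm_exp_eq_Re)
  also have "\<dots> \<le> exp (Re (exp s) / 8 - 11 * Re s) * exp \<bar>Im (s\<^sup>2)\<bar>"
    by (intro mult_left_mono norm_cos_le_exp) auto
  also have "\<dots> = exp (Re (exp s) / 8 - 11 * Re s + \<bar>Im (s\<^sup>2)\<bar>)" by (simp add: exp_add)
  also have "\<dots> \<le> exp (Re (exp s) / 8 - 5 * Re s)"
  proof -
    have "\<bar>Im (s\<^sup>2)\<bar> = Re s * (2 * \<bar>Im s\<bar>)" using assms by (simp add: power2_eq_square abs_mult)
    also have "\<dots> \<le> Re s * (2 * 3)" using assms by (intro mult_left_mono) auto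
    finally show ?thesis by simp
  qed
  finally show ?thesis .
qed

lemma osc_decay:
  assumes "0 \<le> Re s" "\<bar>Im s\<bar> \<le> 3" "Re s \<le> 1 \<or> 2 \<le> \<bar>Im s\<bar>"
  shows "cmod (osc s) \<le> decay_const * exp (- Re s)"
proof (cases "2 \<le> \<bar>Im s\<bar>")
  case True
  have "cos (Im s) \<le> 0" using cos_le_cos_2[of "Im s"] True assms cos_two_less_zero by linarith
  then have "Re (exp s) \<le> 0" by (simp add: Re_exp mult_nonneg_nonpos)
  then have "exp (Re (exp s) / 8 - 5 * Re s) \<le> 1 * exp (- Re s)" using assms by simp
  also have "\<dots> \<le> decay_const * exp (- Re s)" using decay_const_ge_1 by (intro mult_right_mono) auto
  finally show ?thesis using norm_osc_le[OF assms(1,2)] by linarith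
next
  case False
  then have x: "Re s \<le> 1" using assms by simp
  have "Re (exp s) \<le> exp 1 * 1" unfolding Re_exp
    using x by (intro order.trans[OF mult_left_mono[OF cos_le_one] mult_right_mono]) auto
  then have "Re (exp s) / 8 - 5 * Re s \<le> exp 1 + 1 - Re s" using assms exp_gt_zero[of "1::real"] by linarith
  then have "exp (Re (exp s) / 8 - 5 * Re s) \<le> exp (exp 1 + 1 - Re s)" by simp
  also have "\<dots> = exp (exp 1) * exp 1 * exp (- Re s)"
    by (simp add: exp_add exp_diff exp_minus divide_inverse)
  also have "\<dots> \<le> decay_const * exp (- Re s)"
    unfolding decay_const_def using cos_two_less_zero by (intro mult_right_mono) auto
  finally show ?thesis using norm_osc_le[OF assms(1,2)] by linarith
qed

lemma osc_cnj: "osc (cnj s) = cnj (osc s)"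
  by (simp add: osc_def exp_cnj cnj_cos flip: complex_cnj_power)

lemma osc_at_extremum:
  "osc (of_real (sqrt (real k * pi))) = of_real (exp (exp (sqrt (real k * pi)) / 8 - 11 * sqrt (real k * pi)) * (-1) ^ k)"
proof -
  let ?x = "sqrt (real k * pi)"
  have "osc (of_real x) = of_real (exp (exp x / 8 - 11 * x) * cos (x\<^sup>2))" for x
    unfolding osc_def by (simp flip: of_real_power exp_of_real cos_of_real)
  then have "osc (of_real ?x) = of_real (exp (exp ?x / 8 - 11 * ?x) * cos (?x\<^sup>2))" .
  also have "?x\<^sup>2 = real k * pi" by simp
  finally show ?thesis by (simp only: cos_npi)
qed

text \<open>Beyond \<open>u\<close> the amplitude of \<open>osc\<close> on the real axis exceeds the
  error of the Cauchy transform, so the signs at the points \<open>sqrt (k * pi)\<close> survive the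
  approximation.\<close>

definition amp_threshold :: "real \<Rightarrow> bool" where
  "amp_threshold u \<longleftrightarrow> 10 \<le> u \<and> (\<forall>x\<ge>u. 64 * decay_const < exp (exp x / 8 - 11 * x))"

lemma amp_threshold_exists: "\<exists>u. amp_threshold u"
proof -
  have "filterlim (\<lambda>x::real. exp (exp x / 8 - 11 * x)) at_top at_top" by real_asymp
  then have "\<forall>\<^sub>F x in at_top. 64 * decay_const < exp (exp x / 8 - 11 * x)"
    by (simp add: filterlim_at_top_dense)
  then obtain u where "\<And>x. x \<ge> u \<Longrightarrow> 64 * decay_const < exp (exp x / 8 - 11 * x)"
    by (auto simp: eventually_at_top_linorder)
  then have "amp_threshold (max 10 u)" by (auto simp: amp_threshold_def)
  then show ?thesis by blast
qed

abbreviation mid :: "complex set" where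
  "mid \<equiv> strip (1/2) (5/2)"

lemma mid_subset: "s \<in> mid \<Longrightarrow> s \<in> strip (-1) 4"
  by (auto simp: strip_def)

lemma (in tract) Re_psi_mid: "w \<in> mid \<Longrightarrow> 0 < Re (psi w)"
  by (rule Re_psi_pos) (auto simp: strip_def)

lemma (in tract) neg_psi_mid:
  assumes "w \<in> mid" shows "- psi w \<notin> psi ` mid"
proof
  assume "- psi w \<in> psi ` mid"
  then obtain v where v: "v \<in> mid" "- psi w = psi v" by blast
  then have "Re (psi v) = - Re (psi w)" by (metis uminus_complex.sel(1))
  then show False using Re_psi_mid[OF v(1)] Re_psi_mid[OF assms] by simp
qed

section \<open>Zeros of the odd part near the prescribed points\<close>

locale odd_model = tract +
  fixes \<Delta> :: "complex \<Rightarrow> complex" and u :: real and s :: "nat \<Rightarrow> real"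
  assumes \<Delta>: "\<Delta> holomorphic_on UNIV" and \<Delta>_odd: "\<And>z. \<Delta> (- z) = - \<Delta> z" and \<Delta>_cnj: "\<And>z. \<Delta> (cnj z) = cnj (\<Delta> z)"
    and \<Delta>_outside: "\<And>z. z \<notin> psi ` mid \<Longrightarrow> - z \<notin> psi ` mid \<Longrightarrow> cmod (\<Delta> z) \<le> 64 * decay_const"
    and \<Delta>_inside: "\<And>w. w \<in> mid \<Longrightarrow> cmod (\<Delta> (psi w) - osc w) \<le> 64 * decay_const"
    and u: "amp_threshold u"
    and s_large: "\<And>n. u + 2 + 400 * 2 ^ n \<le> s n" and s_gap: "\<And>n. s n + 3 \<le> s (Suc n)"
begin

lemma u10: "10 \<le> u" and amp: "u \<le> x \<Longrightarrow> 64 * decay_const < exp (exp x / 8 - 11 * x)"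
  using u by (auto simp: amp_threshold_def)

definition \<phi> :: "real \<Rightarrow> real" where
  "\<phi> t = Re (\<Delta> (psi (of_real t)))"

lemma \<Delta>_real: "1 \<le> t \<Longrightarrow> \<Delta> (psi (of_real t)) = of_real (\<phi> t)"
proof -
  assume t: "1 \<le> t"
  have "cnj (\<Delta> (psi (of_real t))) = \<Delta> (psi (of_real t))"
    using t by (simp add: psi_of_real flip: \<Delta>_cnj)
  then show ?thesis by (metis Reals_cnj_iff \<phi>_def of_real_Re)
qed

lemma \<phi>_extremum:
  assumes "u \<le> sqrt (real k * pi)"
  shows "0 < (-1) ^ k * \<phi> (sqrt (real k * pi))"
proof -
  let ?x = "sqrt (real k * pi)"
  have x: "10 \<le> ?x" using assms u10 by simp
  then have "of_real ?x \<in> mid" by (simp add: strip_def)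
  from \<Delta>_inside[OF this]
  have "cmod (of_real (\<phi> ?x - exp (exp ?x / 8 - 11 * ?x) * (-1) ^ k)) \<le> 64 * decay_const"
  proof -
    have "\<Delta> (psi (of_real ?x)) = of_real (\<phi> ?x)" by (rule \<Delta>_real) (use x in linarith)
    then show ?thesis
      using \<open>cmod (\<Delta> (psi (of_real ?x)) - osc (of_real ?x)) \<le> 64 * decay_const\<close>
      by (simp only: osc_at_extremum of_real_diff)
  qed
  then have "\<bar>\<phi> ?x - exp (exp ?x / 8 - 11 * ?x) * (-1) ^ k\<bar> \<le> 64 * decay_const"
    by (simp only: norm_of_real)
  then show ?thesis using amp[OF assms] by (cases "even k") auto
qed

lemma continuous_\<phi>: "continuous_on {1..} \<phi>"
proof -
  have "continuous_on {1..} (\<lambda>t. psi (of_real t))"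
    by (rule continuous_on_compose2[OF holomorphic_on_imp_continuous_on[OF holomorphic_psi]])
       (auto intro!: continuous_intros simp: strip_def)
  then have "continuous_on {1..} (\<lambda>t. \<Delta> (psi (of_real t)))"
    by (rule continuous_on_compose2[OF holomorphic_on_imp_continuous_on[OF \<Delta>]]) auto
  then show ?thesis unfolding \<phi>_def by (intro continuous_intros)
qed

text \<open>The neighbouring extrema \<open>\<alpha>\<close> and \<open>\<beta>\<close> of the
  cosine satisfy \<open>\<beta>^2 - \<alpha>^2 = pi\<close>, so they are at most
  \<open>4 / x\<close> apart, and \<open>\<phi>\<close> has opposite signs at them.\<close>

lemma zero_near:
  assumes x: "u + 1 \<le> x"
  shows "\<exists>t. \<bar>t - x\<bar> \<le> 4 / x \<and> u \<le> t \<and> \<Delta> (psi (of_real t)) = 0"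
proof -
  define k where "k = nat \<lfloor>x\<^sup>2 / pi\<rfloor>"
  define \<alpha> where "\<alpha> = sqrt (real k * pi)"
  define \<beta> where "\<beta> = sqrt (real (Suc k) * pi)"
  have "0 \<le> x\<^sup>2 / pi" by simp
  then have k: "real k \<le> x\<^sup>2 / pi" "x\<^sup>2 / pi < real k + 1"
    unfolding k_def by linarith+
  then have k': "real k * pi \<le> x\<^sup>2" "x\<^sup>2 < real (Suc k) * pi"
    using pi_gt_zero by (auto simp: field_simps)
  have x0: "0 < x" using x u10 by simp
  have \<alpha>: "\<alpha> \<le> x" using real_sqrt_le_mono[OF k'(1)] x0 by (simp add: \<alpha>_def)
  have \<beta>: "x < \<beta>" using real_sqrt_less_mono[OF k'(2)] x0 by (simp add: \<beta>_def)
  have u\<alpha>: "u \<le> \<alpha>"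
  proof -
    have "(u + 1)\<^sup>2 \<le> x\<^sup>2" using x u10 by (intro power_mono) auto
    then have "u\<^sup>2 + 2 * u + 1 \<le> x\<^sup>2" by (simp add: power2_eq_square algebra_simps)
    moreover have "x\<^sup>2 < real k * pi + pi" using k'(2) by (simp add: algebra_simps)
    ultimately have "u\<^sup>2 \<le> real k * pi" using u10 pi_less_4 by linarith
    then show ?thesis using real_sqrt_le_mono[of "u\<^sup>2" "real k * pi"] u10 by (simp add: \<alpha>_def)
  qed
  have "(\<beta> - \<alpha>) * (\<beta> + \<alpha>) = pi"
    by (simp add: \<alpha>_def \<beta>_def algebra_simps flip: power2_eq_square)
  moreover have "(\<beta> - \<alpha>) * x \<le> (\<beta> - \<alpha>) * (\<beta> + \<alpha>)"
    using \<alpha> \<beta> u\<alpha> u10 by (intro mult_left_mono) auto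
  ultimately have "(\<beta> - \<alpha>) * x \<le> 4" using pi_less_4 by linarith
  then have d: "\<beta> - \<alpha> \<le> 4 / x" using x0 by (simp add: field_simps)
  define g where "g t = (-1) ^ k * \<phi> t" for t
  have "0 < g \<alpha>" using \<phi>_extremum[of k] u\<alpha> by (simp add: g_def \<alpha>_def)
  moreover have "g \<beta> < 0"
    using \<phi>_extremum[of "Suc k"] u\<alpha> \<alpha> \<beta> unfolding g_def \<beta>_def[symmetric] by simp
  moreover have "continuous_on {\<alpha>..\<beta>} g"
    unfolding g_def using u\<alpha> u10
    by (intro continuous_intros continuous_on_subset[OF continuous_\<phi>]) auto
  ultimately obtain t where t: "\<alpha> \<le> t" "t \<le> \<beta>" "g t = 0"
    using IVT2'[of g \<beta> 0 \<alpha>] \<alpha> \<beta> by auto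
  then have "\<phi> t = 0" by (simp add: g_def)
  then show ?thesis using t d \<alpha> \<beta> u\<alpha> u10 \<Delta>_real[of t] by (intro exI[of _ t]) auto
qed

lemma s_gt: "m < n \<Longrightarrow> s m + 3 \<le> s n"
proof (induction n)
  case (Suc n)
  then show ?case using s_gap[of n] by (cases "m = n") auto
qed simp

lemma s_sep: "m \<noteq> n \<Longrightarrow> 3 \<le> \<bar>s m - s n\<bar>"
  using s_gt[of m n] s_gt[of n m] by (cases m n rule: linorder_cases) auto

lemma zeros_exist: "\<exists>t. \<forall>n. \<bar>t n - s n\<bar> \<le> (1/2) ^ n / 100 \<and> u \<le> t n \<and> \<Delta> (psi (of_real (t n))) = 0"
proof -
  have "\<exists>t. \<bar>t - s n\<bar> \<le> (1/2) ^ n / 100 \<and> u \<le> t \<and> \<Delta> (psi (of_real t)) = 0" for n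
  proof -
    have "0 < (2::real) ^ n" by simp
    then have "u + 1 \<le> s n" using s_large[of n] by linarith
    from zero_near[OF this] obtain t where t: "\<bar>t - s n\<bar> \<le> 4 / s n" "u \<le> t" "\<Delta> (psi (of_real t)) = 0" by blast
    \<comment> \<open>The 400 in \<open>s_large\<close> turns \<open>4 / s n\<close> into
      \<open>2^-n / 100\<close>, the summable accuracy that the correcting product consumes.\<close>
    have "400 * 2 ^ n \<le> s n" using s_large[of n] u10 by linarith
    then have "4 / s n \<le> 4 / (400 * 2 ^ n)" by (intro frac_le) auto
    also have "\<dots> = (1/2) ^ n / 100" by (simp add: power_divide)
    finally show ?thesis using t by (intro exI[of _ t]) auto
  qed
  then show ?thesis by metis
qed

definition t :: "nat \<Rightarrow> real" where
  "t = (SOME t. \<forall>n. \<bar>t n - s n\<bar> \<le> (1/2) ^ n / 100 \<and> u \<le> t n \<and> \<Delta> (psi (of_real (t n))) = 0)"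

lemma t: "\<bar>t n - s n\<bar> \<le> (1/2) ^ n / 100" "u \<le> t n" "\<Delta> (psi (of_real (t n))) = 0"
  using someI_ex[OF zeros_exist] by (auto simp: t_def)

lemma t_close: "\<bar>t n - s n\<bar> \<le> 1/100"
proof -
  have "(1/2 :: real) ^ n \<le> 1" by (simp add: power_le_one)
  then show ?thesis using t(1)[of n] by linarith
qed

lemma t_pos: "10 \<le> t n" and s_pos: "10 \<le> s n"
proof -
  have "0 < (2::real) ^ n" by simp
  then show "10 \<le> t n" "10 \<le> s n" using t(2)[of n] u10 s_large[of n] by linarith+
qed

text \<open>The radius is that of the covering estimate \<open>dist_psi_ge\<close>, so every point
  outside has distance at least \<open>lam / 4\<close> from the zero.\<close>

definition U :: "nat \<Rightarrow> complex set" where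
  "U n = psi ` ball (of_real (t n)) (1/2)"

lemma in_disc:
  assumes "w \<in> cball (of_real (t n)) (1/2)"
  shows "t n - 1/2 \<le> Re w" "\<bar>Im w\<bar> \<le> 1/2" "w \<in> mid"
proof -
  have "cmod (of_real (t n) - w) \<le> 1/2" using assms by (simp add: dist_norm)
  then show 1: "t n - 1/2 \<le> Re w" "\<bar>Im w\<bar> \<le> 1/2"
    using abs_Re_le_cmod[of "of_real (t n) - w"] abs_Im_le_cmod[of "of_real (t n) - w"] by auto
  then show "w \<in> mid" using t_pos[of n] by (simp add: strip_def)
qed

lemma in_ball_mid: "w \<in> ball (of_real (t n)) (1/2) \<Longrightarrow> w \<in> mid"
  by (rule in_disc(3)[of w n]) simp

lemma psi_inj_mid: "psi v = psi w \<Longrightarrow> v \<in> mid \<Longrightarrow> w \<in> mid \<Longrightarrow> v = w"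
  using inj_onD[OF inj_psi, of v w] mid_subset by blast

lemma U_subset: "U n \<subseteq> psi ` mid"
  unfolding U_def using in_disc(3) ball_subset_cball by blast

lemma frontier_U:
  assumes "z \<in> frontier (U n)"
  obtains w where "z = psi w" "cmod (w - of_real (t n)) = 1/2" "w \<in> mid"
proof -
  have sub: "cball (of_real (t n)) (1/2) \<subseteq> strip (-1) 4"
    using in_disc(3) mid_subset by blast
  have "compact (psi ` cball (of_real (t n)) (1/2))"
    using holomorphic_on_imp_continuous_on[OF holomorphic_on_subset[OF holomorphic_psi sub]]
    by (intro compact_continuous_image) auto
  then have "closure (U n) \<subseteq> psi ` cball (of_real (t n)) (1/2)"
    unfolding U_def by (intro closure_minimal compact_imp_closed) auto
  moreover have "open (U n)"
    unfolding U_def using sub ball_subset_cball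
    by (intro open_mapping_thm3 holomorphic_on_subset[OF holomorphic_psi] inj_on_subset[OF inj_psi]) auto
  ultimately have "z \<in> psi ` cball (of_real (t n)) (1/2)" "z \<notin> U n"
    using assms by (auto simp: frontier_def interior_open)
  then obtain w where w: "w \<in> cball (of_real (t n)) (1/2)" "z = psi w" "w \<notin> ball (of_real (t n)) (1/2)"
    unfolding U_def by blast
  then have "cmod (w - of_real (t n)) = 1/2" by (simp add: dist_norm norm_minus_commute)
  then show ?thesis using that w in_disc(3) by blast
qed

lemma psiR_close:
  assumes "\<bar>x - t n\<bar> \<le> 1/2"
  shows "\<bar>psiR x - psiR (t n)\<bar> \<le> 2 * lam (of_real (t n)) * \<bar>x - t n\<bar>"
proof -
  have "norm (psiR x - psiR (t n)) \<le> (2 * lam (of_real (t n))) * norm (x - t n)"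
  proof (rule field_differentiable_bound[of "cball (t n) (1/2)"])
    fix y assume y: "y \<in> cball (t n) (1/2)"
    then have y': "\<bar>y - t n\<bar> \<le> 1/2" by (simp add: dist_real_def abs_minus_commute)
    then have y0: "0 \<le> y" using t_pos[of n] by linarith
    show "(psiR has_field_derivative lam (of_real y)) (at y within cball (t n) (1/2))"
    proof (rule DERIV_subset[OF psiR_has_derivative[OF y0]])
      show "cball (t n) (1/2) \<subseteq> {0..}"
      proof
        fix x assume "x \<in> cball (t n) (1/2)"
        then have "\<bar>t n - x\<bar> \<le> 1/2" by (simp add: dist_real_def)
        then show "x \<in> {0..}" using t_pos[of n] unfolding atLeast_iff by linarith
      qed
    qed
    have "lam (of_real y) \<le> 2 * lam (of_real (t n))"
      using y' t_pos[of n] by (intro Re_dpsi_ge(2)) (auto simp flip: of_real_diff)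
    then show "norm (lam (of_real y)) \<le> 2 * lam (of_real (t n))"
      using lam_pos[of "of_real y"] y0 by simp
  qed (use assms in \<open>auto simp: dist_real_def abs_minus_commute\<close>)
  then show ?thesis by simp
qed

text \<open>The numerator is the product of \<open>\<bar>p - r\<bar>\<close>, of size
  \<open>l * 2^-n\<close>, and \<open>p + r \<le> 3 * p\<close>. In the denominator both
  \<open>\<bar>z - p\<bar>\<close> and \<open>\<bar>z + p\<bar>\<close> are at least
  \<open>l / 4\<close>, and the larger is at least \<open>p\<close>. The derivative
  \<open>l\<close>, which can be arbitrarily small, cancels.\<close>

lemma close_factor:
  assumes z: "z \<notin> U n" "- z \<notin> U n"
  shows "\<bar>(psiR (t n))\<^sup>2 - (psiR (s n))\<^sup>2\<bar> \<le> (1/2) ^ (n + 2) * cmod (z\<^sup>2 - (of_real (psiR (t n)))\<^sup>2)"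
proof -
  define p r l where "p = psiR (t n)" "r = psiR (s n)" "l = lam (of_real (t n))"
  have tn: "10 \<le> t n" "10 \<le> s n" by (rule t_pos, rule s_pos)
  have l: "0 < l" unfolding p_r_l_def using tn by (intro lam_pos) simp
  have p: "0 < p" unfolding p_r_l_def using tn by (intro psiR_pos) simp
  have r: "0 < r" unfolding p_r_l_def using tn by (intro psiR_pos) simp
  have lp: "l \<le> p"
  proof -
    have "l \<le> p / t n" unfolding p_r_l_def using tn by (intro lam_of_real_le) simp
    also have "\<dots> \<le> p / 1" using tn p by (intro divide_left_mono) auto
    finally show ?thesis by simp
  qed
  have pr: "\<bar>p - r\<bar> \<le> 2 * l * ((1/2) ^ n / 100)"
  proof -
    have "\<bar>r - p\<bar> \<le> 2 * l * \<bar>s n - t n\<bar>"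
      unfolding p_r_l_def using t_close[of n] by (intro psiR_close) linarith
    also have "\<dots> \<le> 2 * l * ((1/2) ^ n / 100)" using t(1)[of n] l by (intro mult_left_mono) (auto simp: abs_minus_commute)
    finally show ?thesis by (simp add: abs_minus_commute)
  qed
  have "(1/2 :: real) ^ n \<le> 1" by (simp add: power_le_one)
  then have "2 * l * ((1/2) ^ n / 100) \<le> 2 * l * (1 / 100)" using l by (intro mult_left_mono) auto
  then have "r \<le> 2 * p" using pr lp l by linarith
  then have "\<bar>p + r\<bar> \<le> 3 * p" using p r by simp
  then have "\<bar>p - r\<bar> * \<bar>p + r\<bar> \<le> (2 * l * ((1/2) ^ n / 100)) * (3 * p)"
    using pr l by (intro mult_mono) auto
  also have "\<dots> = (1/2) ^ n * ((l * p) * (6 / 100))" by simp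
  also have "\<dots> \<le> (1/2) ^ n * ((l * p) * (1 / 16))" using l p by (intro mult_left_mono) auto
  finally have 1: "\<bar>p\<^sup>2 - r\<^sup>2\<bar> \<le> (1/2) ^ (n + 2) * (p * (l / 4))"
    by (simp add: square_diff_square_factored power2_eq_square abs_mult mult_ac)
  have ptn: "psi (of_real (t n)) = of_real p" unfolding p_r_l_def using tn by (intro psi_of_real) simp
  have "l / 4 \<le> cmod (psi (of_real (t n)) - z)" "l / 4 \<le> cmod (psi (of_real (t n)) - - z)"
    using dist_psi_ge[of "of_real (t n)" z] dist_psi_ge[of "of_real (t n)" "- z"] z tn
    by (simp_all add: p_r_l_def U_def)
  then have d: "l / 4 \<le> cmod (z - of_real p)" "l / 4 \<le> cmod (z + of_real p)"
    unfolding ptn by (auto simp: norm_minus_commute add.commute)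
  have "2 * p \<le> cmod (z + of_real p) + cmod (z - of_real p)"
    using norm_triangle_ineq4[of "z + of_real p" "z - of_real p"] p by simp
  then have "p \<le> cmod (z + of_real p) \<or> p \<le> cmod (z - of_real p)" by linarith
  then have "p * (l / 4) \<le> cmod (z - of_real p) * cmod (z + of_real p)"
    using d p l mult_mono[of p "cmod (z + of_real p)" "l/4" "cmod (z - of_real p)"]
      mult_mono[of p "cmod (z - of_real p)" "l/4" "cmod (z + of_real p)"] by (auto simp: mult.commute)
  also have "\<dots> = cmod (z\<^sup>2 - (of_real p)\<^sup>2)"
    by (simp flip: norm_mult add: power2_eq_square algebra_simps)
  finally have "(1/2) ^ (n + 2) * (p * (l / 4)) \<le> (1/2) ^ (n + 2) * cmod (z\<^sup>2 - (of_real p)\<^sup>2)"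
    by (intro mult_left_mono) auto
  then show ?thesis using 1 unfolding p_r_l_def by linarith
qed

sublocale zero_shift \<Delta> "\<lambda>n. psiR (t n)" "\<lambda>n. psiR (s n)" U
proof
  have psiR_inj: "psiR x \<noteq> psiR y" if "0 \<le> x" "0 \<le> y" "x \<noteq> y" for x y
    using that psiR_strict_mono[of x y] psiR_strict_mono[of y x] by (cases x y rule: linorder_cases) auto
  show "\<Delta> (of_real (psiR (t n))) = 0" for n
    using t(3)[of n] t_pos[of n] by (simp add: psi_of_real)
  show "0 < psiR (t n)" "0 < psiR (s n)" for n
    using t_pos[of n] s_pos[of n] by (auto intro: psiR_pos)
  show "psiR (t m) \<noteq> psiR (t n)" if "m \<noteq> n" for m n
    using t_pos[of m] t_pos[of n] s_sep[OF that] t_close[of m] t_close[of n]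
    by (intro psiR_inj) linarith+
  show "psiR (t m) \<noteq> psiR (s n)" if "m \<noteq> n" for m n
    using t_pos[of m] s_pos[of n] s_sep[OF that] t_close[of m]
    by (intro psiR_inj) linarith+
  show "of_real (psiR (t n)) \<in> U n" for n
    unfolding U_def using t_pos[of n] by (intro image_eqI[of _ _ "of_real (t n)"]) (auto simp: psi_of_real)
  show "\<bar>(psiR (t n))\<^sup>2 - (psiR (s n))\<^sup>2\<bar> \<le> (1/2) ^ (n + 2) * cmod (z\<^sup>2 - (of_real (psiR (t n)))\<^sup>2)"
    if "z \<notin> U n" "- z \<notin> U n" for n z by (rule close_factor[OF that])
  show "\<exists>n0. \<forall>n\<ge>n0. \<forall>z\<in>U n. R < cmod z" for R
  proof -
    obtain x where x: "0 \<le> x" "R + 1 \<le> psiR x" using psiR_unbounded by blast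
    obtain n0 :: nat where n0: "x \<le> real n0" using real_arch_simple by blast
    have "R < cmod z" if n: "n0 \<le> n" and z: "z \<in> U n" for n z
    proof -
      obtain w where w: "w \<in> cball (of_real (t n)) (1/2)" "z = psi w"
        using z ball_subset_cball unfolding U_def by blast
      have "real n \<le> 2 ^ n" by (rule of_nat_less_two_power[THEN less_imp_le])
      then have "real n \<le> t n - 1/2" using s_large[of n] t_close[of n] u10 by linarith
      then have "x \<le> Re w" using in_disc(1)[OF w(1)] n n0 by linarith
      then have "R + 1 \<le> psiR (Re w)" using x psiR_mono[of x "Re w"] by simp
      also have "\<dots> \<le> Re (psi w)" using \<open>x \<le> Re w\<close> x in_disc(2)[OF w(1)] by (intro Re_psi_ge) auto
      also have "\<dots> \<le> cmod z" using w complex_Re_le_cmod by simp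
      finally show ?thesis by simp
    qed
    then show ?thesis by blast
  qed
  show "bounded (U n)" for n
  proof -
    have "bounded (psi ` cball (of_real (t n)) (1/2))"
    proof (intro compact_imp_bounded compact_continuous_image)
      show "continuous_on (cball (of_real (t n)) (1/2)) psi"
        using in_disc(3) mid_subset
        by (intro holomorphic_on_imp_continuous_on[OF holomorphic_on_subset[OF holomorphic_psi]]) blast
    qed auto
    then show ?thesis unfolding U_def by (rule bounded_subset) auto
  qed
  show "z \<notin> U m \<and> - z \<notin> U m" if z: "z \<in> frontier (U n)" for m n z
  proof -
    obtain w where w: "z = psi w" "cmod (w - of_real (t n)) = 1/2" "w \<in> mid"
      using frontier_U[OF z] .
    have "z \<notin> U m"
    proof
      assume "z \<in> U m"
      then obtain v where v: "v \<in> ball (of_real (t m)) (1/2)" "psi w = psi v" using w unfolding U_def by auto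
      then have "w = v" using psi_inj_mid[OF v(2) w(3) in_ball_mid[OF v(1)]] by simp
      then have "cmod (w - of_real (t m)) < 1/2" using v by (simp add: dist_norm norm_minus_commute)
      moreover have "m \<noteq> n" using calculation w by auto
      moreover have "cmod (of_real (t m) - of_real (t n)) \<le> cmod (w - of_real (t n)) + cmod (w - of_real (t m))"
        using norm_triangle_ineq4[of "w - of_real (t n)" "w - of_real (t m)"] by simp
      then have "\<bar>t m - t n\<bar> \<le> cmod (w - of_real (t n)) + cmod (w - of_real (t m))"
        by (simp flip: of_real_diff)
      ultimately have "\<bar>t m - t n\<bar> < 1" "3 \<le> \<bar>s m - s n\<bar>" using s_sep[of m n] w(2) by auto
      then show False using t_close[of m] t_close[of n] by linarith
    qed
    moreover have "- z \<notin> U m" using neg_psi_mid[OF w(3)] U_subset w(1) by blast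
    ultimately show ?thesis by simp
  qed
qed (use \<Delta> \<Delta>_odd \<Delta>_cnj in auto)

lemma shifted_outside:
  assumes "z \<notin> psi ` mid" "- z \<notin> psi ` mid"
  shows "cmod (shifted z) \<le> 128 * decay_const"
  using shifted_bounds(1)[of z] \<Delta>_outside[OF assms] U_subset assms by force

lemma \<Delta>_mid:
  assumes "w \<in> mid"
  shows "cmod (\<Delta> (psi w)) \<le> 65 * decay_const * exp (max 0 (Re (exp w)) / 8)"
proof -
  have w: "0 \<le> Re w" "\<bar>Im w\<bar> \<le> 3" using assms by (auto simp: strip_def)
  have "cmod (osc w) \<le> exp (max 0 (Re (exp w)) / 8)"
    using norm_osc_le[OF w] w by (elim order.trans) auto
  also have "\<dots> \<le> decay_const * exp (max 0 (Re (exp w)) / 8)" using decay_const_ge_1 by simp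
  finally have 1: "cmod (osc w) \<le> decay_const * exp (max 0 (Re (exp w)) / 8)" .
  have "64 * decay_const * 1 \<le> 64 * decay_const * exp (max 0 (Re (exp w)) / 8)"
    using decay_const_ge_1 by (intro mult_left_mono) auto
  then show ?thesis
    using 1 \<Delta>_inside[OF assms] norm_triangle_sub[of "\<Delta> (psi w)" "osc w"] by linarith
qed

text \<open>Off the discs only a factor 2 is lost. On a disc the bound comes from its frontier,
  where \<open>Re (exp v)\<close> can be up to four times its value at \<open>w\<close>; this turns
  the exponent 1/8 of \<open>osc\<close> into 1/2.\<close>

lemma shifted_inside:
  assumes w: "w \<in> mid"
  shows "cmod (shifted (psi w)) \<le> 130 * decay_const * exp (max 0 (Re (exp w)) / 2)"
proof (cases "\<exists>n. psi w \<in> U n")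
  case False
  have "- psi w \<notin> U n" for n using neg_psi_mid[OF w] U_subset by blast
  then have "cmod (shifted (psi w)) \<le> 2 * cmod (\<Delta> (psi w))" using False by (intro shifted_bounds) auto
  also have "\<dots> \<le> 2 * (65 * decay_const * exp (max 0 (Re (exp w)) / 8))" using \<Delta>_mid[OF w] by simp
  also have "\<dots> \<le> 2 * (65 * decay_const * exp (max 0 (Re (exp w)) / 2))"
    using decay_const_ge_1 by (intro mult_left_mono) auto
  finally show ?thesis by simp
next
  case True
  then obtain n where n: "psi w \<in> U n" by blast
  then obtain v where v: "v \<in> ball (of_real (t n)) (1/2)" "psi w = psi v" unfolding U_def by auto
  then have "w = v" using psi_inj_mid[OF v(2) w in_ball_mid[OF v(1)]] by simp
  then have wb: "w \<in> cball (of_real (t n)) (1/2)" using v by auto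
  \<comment> \<open>Across the disc \<open>exp (Re w)\<close> varies by at most
    \<open>exp 1 \<le> 3\<close>, and \<open>cos (Im w) \<ge> 7/8\<close>, so 4 suffices.\<close>
  have "exp (t n + 1/2) \<le> 4 * Re (exp w)"
  proof -
    have "\<bar>Im w\<bar>\<^sup>2 \<le> (1/2)\<^sup>2" using in_disc(2)[OF wb] by (intro power_mono) auto
    then have c: "7/8 \<le> cos (Im w)" using cos_ge_quadratic[of "Im w"] by (simp add: power2_eq_square)
    have "exp (t n + 1/2) = exp 1 * exp (t n - 1/2)" by (simp flip: exp_add)
    also have "\<dots> \<le> 3 * exp (t n - 1/2)" using exp_le by (intro mult_right_mono) auto
    also have "\<dots> \<le> (4 * cos (Im w)) * exp (t n - 1/2)" using c by (intro mult_right_mono) auto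
    also have "\<dots> \<le> (4 * cos (Im w)) * exp (Re w)" using c in_disc(1)[OF wb] by (intro mult_left_mono) auto
    finally show ?thesis by (simp add: Re_exp mult_ac)
  qed
  then have e: "exp (t n + 1/2) / 8 \<le> max 0 (Re (exp w)) / 2" by simp
  have "cmod (shifted (psi w)) \<le> 2 * (65 * decay_const * exp (max 0 (Re (exp w)) / 2))"
  proof (rule shifted_bound_U[OF n])
    fix z assume "z \<in> frontier (U n)"
    from frontier_U[OF this] obtain v where v: "z = psi v" "cmod (v - of_real (t n)) = 1/2" "v \<in> mid" .
    have "\<bar>Re (v - of_real (t n))\<bar> \<le> 1/2" using abs_Re_le_cmod[of "v - of_real (t n)"] v(2) by linarith
    then have "Re v \<le> t n + 1/2" by (simp only: minus_complex.sel Re_complex_of_real)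
    then have "Re (exp v) \<le> exp (t n + 1/2)"
      using complex_Re_le_cmod[of "exp v"] by simp (meson exp_le_cancel_iff order.trans)
    then have "max 0 (Re (exp v)) / 8 \<le> max 0 (Re (exp w)) / 2" using e by simp
    then have "65 * decay_const * exp (max 0 (Re (exp v)) / 8) \<le> 65 * decay_const * exp (max 0 (Re (exp w)) / 2)"
      using decay_const_ge_1 by (intro mult_left_mono) auto
    then show "cmod (\<Delta> z) \<le> 65 * decay_const * exp (max 0 (Re (exp w)) / 2)"
      using \<Delta>_mid[OF v(3)] v(1) by simp
  qed
  then show ?thesis by simp
qed

text \<open>The witness is an extremum \<open>sqrt (k * pi)\<close> between \<open>u\<close> and
  \<open>u + 1\<close>. All discs lie further to the right, so the lower bound for the product
  applies there, and \<open>\<Delta>\<close> does not vanish because the amplitude exceeds the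
  error.\<close>

lemma shifted_nonzero: "\<exists>z. shifted z \<noteq> 0"
proof -
  define k where "k = nat \<lceil>u\<^sup>2 / pi\<rceil>"
  define x where "x = sqrt (real k * pi)"
  have "0 \<le> u\<^sup>2 / pi" by simp
  then have k: "u\<^sup>2 / pi \<le> real k" "real k \<le> u\<^sup>2 / pi + 1" unfolding k_def by linarith+
  then have k': "u\<^sup>2 \<le> real k * pi" "real k * pi \<le> u\<^sup>2 + pi" using pi_gt_zero by (auto simp: field_simps)
  have ux: "u \<le> x" using real_sqrt_le_mono[OF k'(1)] u10 by (simp add: x_def)
  have "u\<^sup>2 + pi \<le> (u + 1)\<^sup>2" using u10 pi_less_4 by (simp add: power2_eq_square algebra_simps)
  then have "real k * pi \<le> (u + 1)\<^sup>2" using k' by linarith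
  then have xu: "x \<le> u + 1" using real_sqrt_le_mono[of "real k * pi" "(u + 1)\<^sup>2"] u10 by (simp add: x_def)
  have xm: "of_real x \<in> mid" using ux u10 by (simp add: strip_def)
  have nU: "psi (of_real x) \<notin> U n \<and> - psi (of_real x) \<notin> U n" for n
  proof -
    have "psi (of_real x) \<notin> U n"
    proof
      assume "psi (of_real x) \<in> U n"
      then obtain v where v: "v \<in> ball (of_real (t n)) (1/2)" "psi (of_real x) = psi v" unfolding U_def by auto
      then have "of_real x = v" using psi_inj_mid[OF v(2) xm in_ball_mid[OF v(1)]] by simp
      then have "of_real x \<in> cball (of_real (t n) :: complex) (1/2)" using v by auto
      from in_disc(1)[OF this] have "t n - 1/2 \<le> x" by simp
      moreover have "0 < (2::real) ^ n" by simp
      ultimately show False using xu s_large[of n] t_close[of n] by linarith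
    qed
    then show ?thesis using neg_psi_mid[OF xm] U_subset by blast
  qed
  have "\<phi> x \<noteq> 0" using \<phi>_extremum[of k] ux by (auto simp: x_def)
  then have "0 < cmod (\<Delta> (psi (of_real x)))" using \<Delta>_real[of x] ux u10 by simp
  then have "0 < cmod (shifted (psi (of_real x)))" using shifted_bounds(2)[OF nU] by linarith
  then show ?thesis by (intro exI[of _ "psi (of_real x)"]) auto
qed

end

text \<open>The transform of \<open>exp (exp s)\<close> is made even, that of \<open>osc\<close>
  odd. The constant 200 is a common roof for the 64 of the even part and the 128 and 130 of the odd
  part.\<close>

lemma (in tract) model_functions:
  assumes u: "amp_threshold u" and s: "\<And>n. u + 2 + 400 * 2 ^ n \<le> s n" "\<And>n. s n + 3 \<le> s (Suc n)"
  obtains E H where "E holomorphic_on UNIV" "H holomorphic_on UNIV"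
    "\<And>z. E (- z) = E z" "\<And>z. H (- z) = - H z" "\<And>z. E (cnj z) = cnj (E z)" "\<And>z. H (cnj z) = cnj (H z)"
    "\<And>n. H (of_real (psiR (s n))) = 0" "\<exists>z. H z \<noteq> 0"
    "\<And>z. z \<notin> psi ` mid \<Longrightarrow> - z \<notin> psi ` mid \<Longrightarrow> cmod (E z) \<le> 200 * decay_const \<and> cmod (H z) \<le> 200 * decay_const"
    "\<And>w. w \<in> mid \<Longrightarrow> cmod (E (psi w) - exp (exp w)) \<le> 200 * decay_const"
    "\<And>w. w \<in> mid \<Longrightarrow> cmod (H (psi w)) \<le> 200 * decay_const * exp (max 0 (Re (exp w)) / 2)"
proof -
  obtain A where A: "A holomorphic_on UNIV" "\<And>z. A (cnj z) = cnj (A z)"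
    "\<And>z. z \<notin> psi ` mid \<Longrightarrow> cmod (A z) \<le> 32 * decay_const"
    "\<And>s. s \<in> mid \<Longrightarrow> cmod (A (psi s) - exp (exp s)) \<le> 32 * decay_const"
  proof (rule cauchy_transform_exists[of "\<lambda>s. exp (exp s)" decay_const, OF _ exp_exp_decay])
    show "(\<lambda>s. exp (exp s)) holomorphic_on strip (-1) 4" by (intro holomorphic_intros)
  qed (simp_all add: exp_cnj)
  obtain B where B: "B holomorphic_on UNIV" "\<And>z. B (cnj z) = cnj (B z)"
    "\<And>z. z \<notin> psi ` mid \<Longrightarrow> cmod (B z) \<le> 32 * decay_const"
    "\<And>s. s \<in> mid \<Longrightarrow> cmod (B (psi s) - osc s) \<le> 32 * decay_const"
  proof (rule cauchy_transform_exists[of osc decay_const])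
    show "osc holomorphic_on strip (-1) 4" unfolding osc_def[abs_def] by (intro holomorphic_intros) auto
  qed (auto intro!: osc_decay simp: osc_cnj)
  define \<Delta> where "\<Delta> z = B z - B (- z)" for z
  have \<Delta>1: "cmod (\<Delta> z) \<le> 64 * decay_const" if "z \<notin> psi ` mid" "- z \<notin> psi ` mid" for z
    using B(3)[OF that(1)] B(3)[OF that(2)] norm_triangle_ineq4[of "B z" "B (- z)"] by (simp add: \<Delta>_def)
  have \<Delta>2: "cmod (\<Delta> (psi w) - osc w) \<le> 64 * decay_const" if "w \<in> mid" for w
    using B(4)[OF that] B(3)[OF neg_psi_mid[OF that]] norm_triangle_ineq4[of "B (psi w) - osc w" "B (- psi w)"]
    by (simp add: \<Delta>_def algebra_simps)
  interpret odd_model a \<Delta> u s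
    by unfold_locales
       (use \<Delta>1 \<Delta>2 u s in \<open>auto simp: \<Delta>_def[abs_def] B(2)[symmetric] intro!: holomorphic_intros holomorphic_compose_uminus B\<close>)
  define E where "E z = A z + A (- z)" for z
  show ?thesis
  proof (rule that[of E shifted])
    show "E holomorphic_on UNIV"
      unfolding E_def[abs_def] by (intro holomorphic_intros holomorphic_compose_uminus A)
    show "E (- z) = E z" "E (cnj z) = cnj (E z)" for z by (auto simp: E_def A(2)[symmetric])
    show "cmod (E z) \<le> 200 * decay_const \<and> cmod (shifted z) \<le> 200 * decay_const"
      if "z \<notin> psi ` mid" "- z \<notin> psi ` mid" for z
      using A(3)[OF that(1)] A(3)[OF that(2)] norm_triangle_ineq[of "A z" "A (- z)"]
        shifted_outside[OF that] decay_const_ge_1 by (simp add: E_def)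
    show "cmod (E (psi w) - exp (exp w)) \<le> 200 * decay_const" if "w \<in> mid" for w
      using A(4)[OF that] A(3)[OF neg_psi_mid[OF that]] norm_triangle_ineq[of "A (psi w) - exp (exp w)" "A (- psi w)"] decay_const_ge_1
      by (simp add: E_def algebra_simps)
    show "cmod (shifted (psi w)) \<le> 200 * decay_const * exp (max 0 (Re (exp w)) / 2)" if "w \<in> mid" for w
    proof -
      have "130 * decay_const * exp (max 0 (Re (exp w)) / 2) \<le> 200 * decay_const * exp (max 0 (Re (exp w)) / 2)"
        using decay_const_ge_1 by (intro mult_right_mono) auto
      then show ?thesis using shifted_inside[OF that] by linarith
    qed
  qed (use holomorphic_shifted shifted_odd shifted_cnj shifted_r shifted_nonzero in auto)
qed

section \<open>One tract: singular values and the maximum modulus\<close>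

lemma cos_1_less: "cos 1 < (9/10 :: real)"
proof -
  have "cos (2 * 1 :: real) = 2 * (cos 1)\<^sup>2 - 1" by (rule cos_double_cos)
  then have "2 * (cos 1)\<^sup>2 < (1::real)" using cos_two_less_zero by simp
  then have "(cos 1)\<^sup>2 < (9/10 :: real)\<^sup>2" by (simp add: power2_eq_square)
  then show ?thesis by (rule power2_less_imp_less) simp
qed

locale half_model = tract +
  fixes g :: "complex \<Rightarrow> complex" and C L :: real
  assumes g: "g holomorphic_on UNIV"
    and inside: "\<And>w. w \<in> mid \<Longrightarrow> cmod (g (psi w) - exp (exp w)) \<le> C * exp (max 0 (Re (exp w)) / 2)"
    and C: "0 \<le> C" "10 * C \<le> exp (L / 2)" and L: "3 \<le> L"
begin

definition Q :: "complex set" where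
  "Q = {w \<in> mid. L < Re (exp w)}"

text \<open>The principal logarithm of \<open>g (psi w) / exp (exp w)\<close>, which is close to 1
  on \<open>Q\<close>; the shape \<open>1 + x\<close> fits the estimate of the logarithm near
  1.\<close>

definition \<kappa> :: "complex \<Rightarrow> complex" where
  "\<kappa> w = Ln (1 + (g (psi w) * exp (- exp w) - 1))"

lemma Q_mid: "w \<in> Q \<Longrightarrow> w \<in> mid" and Q_Re: "w \<in> Q \<Longrightarrow> L < Re (exp w)"
  by (auto simp: Q_def)

lemma open_Q: "open Q"
proof -
  have "open {w. L < Re (exp w)}" by (intro open_Collect_less continuous_intros)
  moreover have "Q = mid \<inter> {w. L < Re (exp w)}" by (auto simp: Q_def)
  ultimately show ?thesis by (simp add: open_Int open_strip)
qed

lemma small: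
  assumes w: "w \<in> Q"
  shows "cmod (g (psi w) * exp (- exp w) - 1) \<le> 1/10"
proof -
  have Re: "L < Re (exp w)" "w \<in> mid" using w by (auto simp: Q_def)
  have "g (psi w) * exp (- exp w) - 1 = (g (psi w) - exp (exp w)) * exp (- exp w)"
    by (simp add: left_diff_distrib exp_minus)
  then have "cmod (g (psi w) * exp (- exp w) - 1) = cmod (g (psi w) - exp (exp w)) * exp (- Re (exp w))"
    by (simp add: norm_mult)
  also have "\<dots> \<le> (C * exp (Re (exp w) / 2)) * exp (- Re (exp w))"
    using inside[OF Re(2)] Re(1) L by (intro mult_right_mono) auto
  also have "\<dots> = C * exp (- (Re (exp w) / 2))" by (simp flip: exp_add)
  also have "\<dots> \<le> C * exp (- (L / 2))" using Re C by (intro mult_left_mono) auto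
  also have "\<dots> \<le> 1/10" using C by (simp add: exp_minus field_simps)
  finally show ?thesis .
qed

lemma \<kappa>_bound: assumes "w \<in> Q" shows "cmod (\<kappa> w) \<le> 1/5"
proof -
  have "cmod (\<kappa> w) \<le> 2 * cmod (g (psi w) * exp (- exp w) - 1)"
    unfolding \<kappa>_def using small[OF assms] by (intro norm_Ln_le) simp
  then show ?thesis using small[OF assms] by simp
qed

lemma Re_factor_pos: assumes "w \<in> Q" shows "0 < Re (1 + (g (psi w) * exp (- exp w) - 1))"
  using small[OF assms] abs_Re_le_cmod[of "g (psi w) * exp (- exp w) - 1"] by simp

lemma holomorphic_\<kappa>: "\<kappa> holomorphic_on Q"
proof -
  have "psi holomorphic_on Q" using Q_mid mid_subset by (intro holomorphic_on_subset[OF holomorphic_psi]) blast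
  then have "(\<lambda>w. g (psi w)) holomorphic_on Q"
    using holomorphic_on_compose_gen[OF _ g, of psi Q] by (simp add: o_def)
  then show ?thesis
    unfolding \<kappa>_def[abs_def] using Re_factor_pos
    by (intro holomorphic_intros) (force simp: complex_nonpos_Reals_iff)+
qed

lemma g_eq: assumes "w \<in> Q" shows "g (psi w) = exp (exp w + \<kappa> w)"
proof -
  have "exp (\<kappa> w) = g (psi w) * exp (- exp w)"
    using Re_factor_pos[OF assms] unfolding \<kappa>_def by (subst exp_Ln) auto
  then show ?thesis by (simp add: exp_add exp_minus)
qed

lemma norm_g: "w \<in> Q \<Longrightarrow> cmod (g (psi w)) = exp (Re (exp w) + Re (\<kappa> w))"
  by (simp add: g_eq)

lemma Re_\<kappa>: "w \<in> Q \<Longrightarrow> \<bar>Re (\<kappa> w)\<bar> \<le> 1/5"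
  using \<kappa>_bound[of w] abs_Re_le_cmod[of "\<kappa> w"] by linarith

text \<open>Where \<open>Re (exp w) \<le> M\<close>, the main term and the error term are each at
  most \<open>exp M\<close>.\<close>

lemma large_imp:
  assumes w: "w \<in> mid" and M: "L \<le> M" "2 * exp M < cmod (g (psi w))"
  shows "M < Re (exp w)"
proof (rule ccontr)
  assume n: "\<not> M < Re (exp w)"
  have "cmod (g (psi w)) \<le> cmod (exp (exp w)) + C * exp (max 0 (Re (exp w)) / 2)"
    using inside[OF w] norm_triangle_sub[of "g (psi w)" "exp (exp w)"] by linarith
  also have "\<dots> \<le> exp M + exp (L / 2) * exp (M / 2)"
  proof (rule add_mono)
    show "cmod (exp (exp w)) \<le> exp M" using n by simp
    have "C \<le> exp (L / 2)" using C by linarith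
    then show "C * exp (max 0 (Re (exp w)) / 2) \<le> exp (L / 2) * exp (M / 2)"
      using n M L C by (intro mult_mono) auto
  qed
  also have "\<dots> \<le> exp M + exp (M / 2) * exp (M / 2)" using M by (intro add_left_mono mult_right_mono) auto
  also have "exp (M / 2) * exp (M / 2) = exp M" by (simp flip: exp_add)
  finally show False using M by simp
qed

text \<open>\<open>Q\<close> keeps a distance of 1/2 from the boundary of \<open>mid\<close>, which
  is the room for Cauchy estimates. The bound on \<open>Re w\<close> uses that
  \<open>L \<ge> 3\<close> exceeds \<open>exp 1\<close>.\<close>

lemma Q_geometry:
  assumes w: "w \<in> Q"
  shows "\<bar>Im w\<bar> < 2" "1 < Re w"
proof -
  have L3: "3 < exp (Re w) * cos (Im w)" using Q_Re[OF w] L by (simp add: Re_exp)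
  show "\<bar>Im w\<bar> < 2"
  proof (rule ccontr)
    assume "\<not> \<bar>Im w\<bar> < 2"
    then have "cos (Im w) \<le> cos 2" using Q_mid[OF w] by (intro cos_le_cos_2) (auto simp: strip_def)
    then have "cos (Im w) \<le> 0" using cos_two_less_zero by linarith
    then have "exp (Re w) * cos (Im w) \<le> 0" by (intro mult_nonneg_nonpos) auto
    then show False using L3 by simp
  qed
  have "exp (Re w) * cos (Im w) \<le> exp (Re w) * 1" by (intro mult_left_mono) auto
  then have "exp 1 < exp (Re w)" using L3 exp_le by linarith
  then show "1 < Re w" by simp
qed

lemma \<kappa>_has_derivative: "w \<in> Q \<Longrightarrow> (\<kappa> has_field_derivative deriv \<kappa> w) (at w)"
  using holomorphic_\<kappa> open_Q holomorphic_derivI by blast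

lemma \<kappa>_deriv_bound:
  assumes "cball w \<rho> \<subseteq> Q" "0 < \<rho>"
  shows "cmod ((deriv ^^ n) \<kappa> w) \<le> fact n * (1/5) / \<rho> ^ n"
proof (rule Cauchy_inequality[OF _ _ \<open>0 < \<rho>\<close>])
  show "\<kappa> holomorphic_on ball w \<rho>" using holomorphic_on_subset[OF holomorphic_\<kappa>] assms ball_subset_cball by blast
  show "continuous_on (cball w \<rho>) \<kappa>"
    using holomorphic_on_imp_continuous_on[OF holomorphic_on_subset[OF holomorphic_\<kappa>]] assms by blast
  show "cmod (\<kappa> x) \<le> 1/5" if "cmod (w - x) = \<rho>" for x
  proof (rule \<kappa>_bound)
    have "x \<in> cball w \<rho>" using that by (simp add: dist_norm)
    then show "x \<in> Q" using assms by blast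
  qed
qed

text \<open>The logarithmic derivative of \<open>g (psi w)\<close> is
  \<open>exp w + deriv \<kappa> w\<close>. Cauchy's estimate on the disc of radius
  \<open>1 / (4 * cmod (exp w))\<close> bounds the second term by 4/5 of the first. On that disc
  \<open>exp\<close> moves by at most 3/4, so the margin 1 in the hypothesis keeps it inside
  \<open>Q\<close>.\<close>

lemma deriv_g_nonzero:
  assumes w: "w \<in> mid" and Re: "L + 1 < Re (exp w)"
  shows "deriv g (psi w) \<noteq> 0"
proof
  assume d0: "deriv g (psi w) = 0"
  have wQ: "w \<in> Q" using w Re by (simp add: Q_def)
  note geo = Q_geometry[OF wQ]
  have big: "3 < cmod (exp w)" using Re L complex_Re_le_cmod[of "exp w"] by linarith
  define \<rho> where "\<rho> = 1 / (4 * cmod (exp w))"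
  have \<rho>: "0 < \<rho>" "\<rho> \<le> 1/12" using big by (auto simp: \<rho>_def field_simps)
  have sub: "cball w \<rho> \<subseteq> Q"
  proof
    fix \<sigma> assume \<sigma>: "\<sigma> \<in> cball w \<rho>"
    have "cball w \<rho> \<subseteq> mid" using geo \<rho> by (intro cball_subset_strip) auto
    then have m: "\<sigma> \<in> mid" using \<sigma> by blast
    have "cmod (exp \<sigma> - exp w) \<le> (3 * cmod (exp w)) * cmod (\<sigma> - w)"
    proof (rule field_differentiable_bound[of "cball w \<rho>" exp exp])
      fix z assume z: "z \<in> cball w \<rho>"
      have "Re z \<le> Re w + \<rho>"
        using z abs_Re_le_cmod[of "w - z"] by (simp add: dist_norm)
      then have "exp (Re z) \<le> exp (1 + Re w)" using \<rho> by simp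
      also have "\<dots> = exp 1 * exp (Re w)" by (rule exp_add)
      also have "\<dots> \<le> 3 * exp (Re w)" using exp_le by (intro mult_right_mono) auto
      finally show "cmod (exp z) \<le> 3 * cmod (exp w)" by simp
    qed (use \<sigma> \<rho> in \<open>auto intro!: derivative_eq_intros\<close>)
    also have "\<dots> \<le> (3 * cmod (exp w)) * \<rho>"
      using \<sigma> by (intro mult_left_mono) (auto simp: dist_norm norm_minus_commute)
    also have "\<dots> = 3/4" using big by (simp add: \<rho>_def)
    finally have "\<bar>Re (exp \<sigma>) - Re (exp w)\<bar> \<le> 3/4" using abs_Re_le_cmod[of "exp \<sigma> - exp w"] by simp
    then have "L < Re (exp \<sigma>)" using Re by linarith
    then show "\<sigma> \<in> Q" using m by (simp add: Q_def)
  qed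
  have "cmod (deriv \<kappa> w) \<le> (1/5) / \<rho>" using \<kappa>_deriv_bound[OF sub \<rho>(1), of 1] by simp
  also have "\<dots> = 4/5 * cmod (exp w)" by (simp add: \<rho>_def)
  also have "\<dots> < cmod (exp w)" using big by simp
  finally have ne: "exp w + deriv \<kappa> w \<noteq> 0"
    by (metis add_eq_0_iff norm_minus_cancel order_less_irrefl)
  have "((\<lambda>w. exp (exp w + \<kappa> w)) has_field_derivative exp (exp w + \<kappa> w) * (exp w + deriv \<kappa> w)) (at w)"
    by (auto intro!: derivative_eq_intros \<kappa>_has_derivative[OF wQ] simp: algebra_simps)
  then have "((\<lambda>w. g (psi w)) has_field_derivative exp (exp w + \<kappa> w) * (exp w + deriv \<kappa> w)) (at w)"
    by (rule has_field_derivative_transform_within_open[OF _ open_Q wQ]) (simp add: g_eq)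
  moreover have "((\<lambda>w. g (psi w)) has_field_derivative deriv g (psi w) * dpsi w) (at w)"
    by (rule DERIV_chain2[OF _ psi_has_derivative(1)[OF mid_subset[OF w]]])
       (use g in \<open>auto intro: holomorphic_derivI\<close>)
  ultimately have "exp (exp w + \<kappa> w) * (exp w + deriv \<kappa> w) = deriv g (psi w) * dpsi w"
    by (rule DERIV_unique)
  then show False using ne d0 by simp
qed

text \<open>On the vertical line through \<open>w\<close> the logarithm of the modulus is strictly
  concave with equal values at \<open>w\<close> and \<open>cnj w\<close>, so it is larger at the
  real point \<open>Re w\<close>. Along the real axis it does not decrease up to \<open>x\<close>,
  and \<open>Re w \<le> x\<close> by \<open>Re_psi_ge\<close>.\<close>

lemma peak_on_real_axis:
  assumes x: "10 * L \<le> exp x" and w: "w \<in> mid" and eq: "cmod (psi w) = psiR x"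
    and sym: "cmod (g (psi (cnj w))) = cmod (g (psi w))"
    and ge: "cmod (g (psi (of_real x))) \<le> cmod (g (psi w))"
  shows "Im w = 0"
proof (rule ccontr)
  assume v0: "Im w \<noteq> 0"
  have x1: "1 < x"
  proof -
    have "exp 1 < exp x" using x L exp_le by linarith
    then show ?thesis by simp
  qed
  have xQ: "of_real x \<in> Q" using x x1 L by (simp add: Q_def strip_def Re_exp)
  have gx: "exp (exp x - 1/5) \<le> cmod (g (psi (of_real x)))"
    using Re_\<kappa>[OF xQ] by (simp add: norm_g[OF xQ] Re_exp)
  have "5 * L < Re (exp w)"
  proof (rule large_imp[OF w])
    have "2 * exp (5 * L) \<le> exp 1 * exp (5 * L)"
      using exp_ge_add_one_self[of 1] by (intro mult_right_mono) auto
    also have "\<dots> = exp (1 + 5 * L)" by (simp only: exp_add)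
    also have "\<dots> < exp (exp x - 1/5)" using x L by simp
    finally show "2 * exp (5 * L) < cmod (g (psi w))" using gx ge by linarith
  qed (use L in auto)
  then have wQ: "w \<in> Q" using w L by (simp add: Q_def)
  note geo = Q_geometry[OF wQ]
  define u where "u = Re w"
  define v where "v = Im w"
  have "exp (exp x - 1/5) \<le> exp (Re (exp w) + Re (\<kappa> w))" using gx ge norm_g[OF wQ] by linarith
  then have Re1: "exp x - 2/5 \<le> exp u * cos v" using Re_\<kappa>[OF wQ] by (simp add: Re_exp u_def v_def)
  have ux: "u \<le> x"
  proof (rule ccontr)
    assume "\<not> u \<le> x"
    then have "psiR x < psiR u" using x1 by (intro psiR_strict_mono) auto
    also have "\<dots> \<le> Re (psi w)" unfolding u_def using geo by (intro Re_psi_ge) auto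
    also have "\<dots> \<le> psiR x" using complex_Re_le_cmod[of "psi w"] eq by simp
    finally show False by simp
  qed
  \<comment> \<open>Falling short of \<open>exp x\<close> by at most 2/5 while
    \<open>exp x \<ge> 30\<close> forces the cosine close to 1.\<close>
  have c: "9/10 < cos v"
  proof -
    have "0 < exp u * cos v" using Re1 x L by linarith
    then have "0 < cos v" by (simp add: zero_less_mult_iff)
    then have "exp u * cos v \<le> exp x * cos v" using ux by (intro mult_right_mono) auto
    then have "exp x * (1 - cos v) \<le> 2/5" using Re1 by (simp add: algebra_simps)
    moreover have "30 * (1 - cos v) \<le> exp x * (1 - cos v)" using x L by (intro mult_right_mono) auto
    ultimately have "30 * (1 - cos v) \<le> 2/5" by (rule order.trans[rotated])
    then show ?thesis by simp
  qed
  have v1: "\<bar>v\<bar> \<le> 1"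
  proof (rule ccontr)
    assume "\<not> \<bar>v\<bar> \<le> 1"
    then have "cos \<bar>v\<bar> \<le> cos 1" using geo pi_gt3 by (intro cos_monotone_0_pi_le) (auto simp: v_def)
    then show False using c cos_1_less by simp
  qed
  have eu: "9 * L \<le> exp u"
  proof -
    have "exp u * cos v \<le> exp u * 1" by (intro mult_left_mono) auto
    then show ?thesis using Re1 x L by linarith
  qed
  \<comment> \<open>Radius 1/4 yields the derivative bounds 4/5 and 32/5 for
    \<open>\<kappa>\<close>, below the 1 and 7 used later. The discs stay in \<open>Q\<close>
    because \<open>3/4 * 9 * 7/32 > 1\<close>.\<close>
  have sub: "cball \<sigma> (1/4) \<subseteq> Q" if \<sigma>: "u \<le> Re \<sigma>" "\<bar>Im \<sigma>\<bar> \<le> 1" for \<sigma>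
  proof
    fix \<tau> assume \<tau>: "\<tau> \<in> cball \<sigma> (1/4)"
    then have "cmod (\<sigma> - \<tau>) \<le> 1/4" by (simp add: dist_norm)
    then have "\<bar>Re \<sigma> - Re \<tau>\<bar> \<le> 1/4" "\<bar>Im \<sigma> - Im \<tau>\<bar> \<le> 1/4"
      using abs_Re_le_cmod[of "\<sigma> - \<tau>"] abs_Im_le_cmod[of "\<sigma> - \<tau>"] by auto
    then have R: "u - 1/4 \<le> Re \<tau>" and I: "\<bar>Im \<tau>\<bar> \<le> 5/4" using \<sigma> by linarith+
    have "(Im \<tau>)\<^sup>2 \<le> (5/4)\<^sup>2" using power_mono[OF I, of 2] by simp
    then have "7/32 \<le> cos (Im \<tau>)" using cos_ge_quadratic[of "Im \<tau>"] by (simp add: power2_eq_square)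
    moreover have "3/4 * (9 * L) \<le> exp (Re \<tau>)"
    proof -
      have "3/4 \<le> exp (- (1/4) :: real)" using exp_ge_add_one_self[of "- (1/4)"] by simp
      then have "3/4 * (9 * L) \<le> exp (- (1/4)) * exp u" using eu L by (intro mult_mono) auto
      also have "\<dots> = exp (u - 1/4)" by (simp flip: exp_add)
      also have "\<dots> \<le> exp (Re \<tau>)" using R by simp
      finally show ?thesis .
    qed
    ultimately have "(3/4 * (9 * L)) * (7/32) \<le> exp (Re \<tau>) * cos (Im \<tau>)" using L by (intro mult_mono) auto
    then have "L < Re (exp \<tau>)" using L by (simp add: Re_exp)
    moreover have "\<tau> \<in> mid" using R I geo by (simp add: strip_def u_def)
    ultimately show "\<tau> \<in> Q" by (simp add: Q_def)
  qed
  have inQ: "\<sigma> \<in> Q" if "u \<le> Re \<sigma>" "\<bar>Im \<sigma>\<bar> \<le> 1" for \<sigma>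
    using sub[OF that] by force
  define G where "G \<sigma> = exp \<sigma> + \<kappa> \<sigma>" for \<sigma>
  define G1 where "G1 \<sigma> = exp \<sigma> + deriv \<kappa> \<sigma>" for \<sigma>
  define G2 where "G2 \<sigma> = exp \<sigma> + deriv (deriv \<kappa>) \<sigma>" for \<sigma>
  have dG: "(G has_field_derivative G1 \<sigma>) (at \<sigma>)" if "u \<le> Re \<sigma>" "\<bar>Im \<sigma>\<bar> \<le> 1" for \<sigma>
    unfolding G_def G1_def by (intro DERIV_add DERIV_exp \<kappa>_has_derivative inQ that)
  have dG1: "(G1 has_field_derivative G2 \<sigma>) (at \<sigma>)" if "u \<le> Re \<sigma>" "\<bar>Im \<sigma>\<bar> \<le> 1" for \<sigma>
    unfolding G1_def G2_def
    by (intro DERIV_add DERIV_exp holomorphic_derivI[OF holomorphic_deriv[OF holomorphic_\<kappa> open_Q] open_Q] inQ that)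
  have b1: "\<bar>Re (deriv \<kappa> \<sigma>)\<bar> \<le> 1" if "u \<le> Re \<sigma>" "\<bar>Im \<sigma>\<bar> \<le> 1" for \<sigma>
    using \<kappa>_deriv_bound[OF sub[OF that], of 1] abs_Re_le_cmod[of "deriv \<kappa> \<sigma>"] by simp
  have b2: "\<bar>Re (deriv (deriv \<kappa>) \<sigma>)\<bar> \<le> 7" if "u \<le> Re \<sigma>" "\<bar>Im \<sigma>\<bar> \<le> 1" for \<sigma>
    using \<kappa>_deriv_bound[OF sub[OF that], of 2] abs_Re_le_cmod[of "deriv (deriv \<kappa>) \<sigma>"]
    by (simp add: numeral_2_eq_2)
  have Re_exp_ge: "12 < Re (exp \<sigma>)" if "u \<le> Re \<sigma>" "\<bar>Im \<sigma>\<bar> \<le> 1" for \<sigma>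
  proof -
    have "(Im \<sigma>)\<^sup>2 \<le> 1\<^sup>2" using power_mono[OF that(2), of 2] by simp
    then have "1/2 \<le> cos (Im \<sigma>)" using cos_ge_quadratic[of "Im \<sigma>"] by simp
    moreover have "27 \<le> exp (Re \<sigma>)" using eu that(1) L exp_le_cancel_iff[of u "Re \<sigma>"] by linarith
    ultimately have "27 * (1/2) \<le> exp (Re \<sigma>) * cos (Im \<sigma>)" by (intro mult_mono) auto
    then show ?thesis by (simp add: Re_exp)
  qed
  define \<phi> where "\<phi> \<tau> = Re (G (Complex u \<tau>))" for \<tau>
  have path: "((\<lambda>\<tau>. Complex u \<tau>) has_vector_derivative \<i>) (at \<tau>)" for \<tau>
  proof -
    have "((\<lambda>\<tau>. of_real u + \<i> * of_real \<tau>) has_vector_derivative \<i>) (at \<tau>)"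
      by (auto intro!: derivative_eq_intros)
    then show ?thesis by (simp add: Complex_eq)
  qed
  have d\<phi>: "(\<phi> has_real_derivative - Im (G1 (Complex u \<tau>))) (at \<tau>)" if "\<bar>\<tau>\<bar> \<le> 1" for \<tau>
  proof -
    have "((\<lambda>\<tau>. G (Complex u \<tau>)) has_vector_derivative \<i> * G1 (Complex u \<tau>)) (at \<tau>)"
      using field_vector_diff_chain_at[OF path dG[of "Complex u \<tau>"]] that by (simp add: o_def)
    from bounded_linear.has_vector_derivative[OF bounded_linear_Re this]
    show ?thesis by (simp add: \<phi>_def[abs_def] has_real_derivative_iff_has_vector_derivative)
  qed
  have d\<phi>1: "((\<lambda>\<tau>. - Im (G1 (Complex u \<tau>))) has_real_derivative - Re (G2 (Complex u \<tau>))) (at \<tau>)" if "\<bar>\<tau>\<bar> \<le> 1" for \<tau>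
  proof -
    have "((\<lambda>\<tau>. G1 (Complex u \<tau>)) has_vector_derivative \<i> * G2 (Complex u \<tau>)) (at \<tau>)"
      using field_vector_diff_chain_at[OF path dG1[of "Complex u \<tau>"]] that by (simp add: o_def)
    from bounded_linear.has_vector_derivative[OF bounded_linear_Im this]
    have "((\<lambda>\<tau>. Im (G1 (Complex u \<tau>))) has_real_derivative Re (G2 (Complex u \<tau>))) (at \<tau>)"
      by (simp add: has_real_derivative_iff_has_vector_derivative)
    then show ?thesis by (rule DERIV_minus)
  qed
  \<comment> \<open>The increments over \<open>[- y, 0]\<close> and \<open>[0, y]\<close> are
    compared through the slopes at intermediate points \<open>a < 0 < b\<close>, the slope being
    strictly decreasing.\<close>
  define y where "y = \<bar>v\<bar>"
  have y: "0 < y" "y \<le> 1" using v0 v1 by (auto simp: y_def v_def)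
  obtain a where a: "- y < a" "a < 0" "\<phi> 0 - \<phi> (- y) = (0 - - y) * (- Im (G1 (Complex u a)))"
    using MVT2[of "- y" 0 \<phi> "\<lambda>\<tau>. - Im (G1 (Complex u \<tau>))"] d\<phi> y by force
  obtain b where b: "0 < b" "b < y" "\<phi> y - \<phi> 0 = (y - 0) * (- Im (G1 (Complex u b)))"
    using MVT2[of 0 y \<phi> "\<lambda>\<tau>. - Im (G1 (Complex u \<tau>))"] d\<phi> y by force
  have "- Im (G1 (Complex u b)) < - Im (G1 (Complex u a))"
  proof (rule DERIV_neg_imp_decreasing[of a b "\<lambda>\<tau>. - Im (G1 (Complex u \<tau>))"])
    fix \<tau> assume "a \<le> \<tau>" "\<tau> \<le> b"
    then have "\<bar>\<tau>\<bar> \<le> 1" using a b y by linarith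
    moreover from this have "0 < Re (G2 (Complex u \<tau>))"
      using Re_exp_ge[of "Complex u \<tau>"] b2[of "Complex u \<tau>"] by (simp add: G2_def)
    ultimately show "\<exists>d. ((\<lambda>\<tau>. - Im (G1 (Complex u \<tau>))) has_real_derivative d) (at \<tau>) \<and> d < 0"
      using d\<phi>1 by force
  qed (use a b in auto)
  then have "y * (- Im (G1 (Complex u b))) < y * (- Im (G1 (Complex u a)))" using y by simp
  then have concave: "\<phi> y - \<phi> 0 < \<phi> 0 - \<phi> (- y)" using a(3) b(3) by simp
  have norm_eq: "cmod (g (psi \<sigma>)) = exp (Re (G \<sigma>))" if "u \<le> Re \<sigma>" "\<bar>Im \<sigma>\<bar> \<le> 1" for \<sigma>
    using norm_g[OF inQ[OF that]] by (simp add: G_def)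
  have "\<phi> y = \<phi> v \<and> \<phi> (- y) = \<phi> v"
  proof -
    have wv: "Complex u v = w" "Complex u (- v) = cnj w" by (auto simp: u_def v_def complex_eq_iff)
    have "exp (\<phi> (- v)) = exp (\<phi> v)"
    proof -
      have "cmod (g (psi w)) = exp (Re (G w))" "cmod (g (psi (cnj w))) = exp (Re (G (cnj w)))"
        using v1 by (auto intro!: norm_eq simp: u_def v_def)
      then show ?thesis using sym by (simp add: \<phi>_def wv)
    qed
    then have "\<phi> (- v) = \<phi> v" by simp
    then show ?thesis by (cases "0 \<le> v") (auto simp: y_def)
  qed
  then have "\<phi> v < \<phi> 0" using concave by simp
  moreover have "\<phi> 0 \<le> Re (G (of_real x))"
  proof -
    have "Re (G (of_real u)) \<le> Re (G (of_real x))"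
    proof (rule DERIV_nonneg_imp_nondecreasing[OF ux])
      fix \<tau> assume \<tau>: "u \<le> \<tau>" "\<tau> \<le> x"
      have "(of_real has_vector_derivative (1::complex)) (at \<tau>)"
        using has_vector_derivative_of_real[OF DERIV_ident] by simp
      from field_vector_diff_chain_at[OF this dG[of "of_real \<tau>"]] \<tau>
      have "((\<lambda>\<tau>. G (of_real \<tau>)) has_vector_derivative G1 (of_real \<tau>)) (at \<tau>)" by (simp add: o_def)
      from bounded_linear.has_vector_derivative[OF bounded_linear_Re this]
      have "((\<lambda>\<tau>. Re (G (of_real \<tau>))) has_real_derivative Re (G1 (of_real \<tau>))) (at \<tau>)"
        by (simp add: has_real_derivative_iff_has_vector_derivative)
      moreover have "0 \<le> Re (G1 (of_real \<tau>))"
        using Re_exp_ge[of "of_real \<tau>"] b1[of "of_real \<tau>"] \<tau> by (simp add: G1_def)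
      ultimately show "\<exists>d. ((\<lambda>\<tau>. Re (G (of_real \<tau>))) has_real_derivative d) (at \<tau>) \<and> 0 \<le> d" by blast
    qed
    then show ?thesis by (simp add: \<phi>_def Complex_eq)
  qed
  ultimately have "\<phi> v < Re (G (of_real x))" by simp
  then have "cmod (g (psi w)) < cmod (g (psi (of_real x)))"
    using norm_eq[of w] norm_eq[of "of_real x"] ux v1 by (simp add: \<phi>_def u_def v_def)
  then show False using ge by simp
qed

text \<open>Lifted to \<open>Q\<close>, the curve gives a continuous logarithm \<open>G\<close> of
  \<open>g / b\<close>, a quotient tending to 1. Hence \<open>Im G\<close> cannot make a half-turn
  and \<open>Re G\<close> is bounded above. As \<open>\<kappa>\<close> is bounded,
  \<open>exp (s t)\<close> stays bounded, and then so does the curve.\<close>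

lemma no_asymptotic_value:
  fixes \<gamma> :: "real \<Rightarrow> complex"
  assumes \<gamma>: "continuous_on {T0..} \<gamma>" "filterlim \<gamma> at_infinity at_top" "((\<lambda>t. g (\<gamma> t)) \<longlongrightarrow> b) at_top"
    and Q: "\<And>t. T0 \<le> t \<Longrightarrow> \<gamma> t \<in> psi ` Q" and "b \<noteq> 0"
  shows False
proof -
  obtain h where h: "h holomorphic_on psi ` strip (-1) 4" "\<And>w. w \<in> strip (-1) 4 \<Longrightarrow> h (psi w) = w"
    using holomorphic_has_inverse[OF holomorphic_psi open_strip inj_psi] by metis
  define s where "s t = h (\<gamma> t)" for t
  have s: "s t \<in> Q" "psi (s t) = \<gamma> t" if t: "T0 \<le> t" for t
  proof -
    obtain w where "w \<in> Q" "\<gamma> t = psi w" using Q[OF t] by blast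
    then show "s t \<in> Q" "psi (s t) = \<gamma> t" using h(2)[of w] Q_mid mid_subset by (auto simp: s_def)
  qed
  have cs: "continuous_on {T0..} s"
    unfolding s_def using Q Q_mid mid_subset
    by (intro continuous_on_compose2[OF holomorphic_on_imp_continuous_on[OF h(1)] \<gamma>(1)]) blast
  define G where "G t = exp (s t) + \<kappa> (s t) - Ln b" for t
  have cG: "continuous_on {T0..} G"
    unfolding G_def using s(1)
    by (intro continuous_intros cs continuous_on_compose2[OF holomorphic_on_imp_continuous_on[OF holomorphic_\<kappa>] cs]) auto
  have eG: "exp (G t) = g (\<gamma> t) / b" if "T0 \<le> t" for t
    using g_eq[OF s(1)[OF that]] s(2)[OF that] \<open>b \<noteq> 0\<close> by (simp add: G_def exp_diff)
  have "((\<lambda>t. g (\<gamma> t) / b) \<longlongrightarrow> b / b) at_top" by (intro tendsto_intros \<gamma>) fact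
  then have "\<forall>\<^sub>F t in at_top. dist (g (\<gamma> t) / b) 1 < 1/2"
    using \<open>b \<noteq> 0\<close> by (auto dest: tendstoD[where e = "1/2"])
  then obtain T1 where T1: "\<And>t. T1 \<le> t \<Longrightarrow> dist (g (\<gamma> t) / b) 1 < 1/2"
    unfolding eventually_at_top_linorder by blast
  define T where "T = max T0 T1"
  have near: "cmod (exp (G t) - 1) < 1/2" if "T \<le> t" for t
    using T1[of t] eG[of t] that by (simp add: T_def dist_norm)
  have cos: "0 < cos (Im (G t))" if "T \<le> t" for t
  proof -
    have "\<bar>Re (exp (G t)) - 1\<bar> < 1/2" using near[OF that] abs_Re_le_cmod[of "exp (G t) - 1"] by simp
    then have "0 < Re (exp (G t))" by linarith
    then show ?thesis by (simp add: Re_exp zero_less_mult_iff)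
  qed
  have Re_le: "Re (G t) \<le> 1" if "T \<le> t" for t
  proof -
    have "cmod (exp (G t)) \<le> 3/2" using near[OF that] norm_triangle_sub[of "exp (G t)" 1] by simp
    also have "\<dots> \<le> exp 1" using exp_ge_add_one_self[of 1] by simp
    finally show ?thesis by simp
  qed
  define y0 where "y0 = Im (G T)"
  have Im_le: "\<bar>Im (G t) - y0\<bar> < pi" if t: "T \<le> t" for t
  proof (rule ccontr)
    assume n: "\<not> \<bar>Im (G t) - y0\<bar> < pi"
    have c: "continuous_on {T..t} (\<lambda>t. Im (G t))"
      by (intro continuous_intros continuous_on_subset[OF cG]) (auto simp: T_def)
    \<comment> \<open>At a half-turn from \<open>y0\<close> the cosine is the negative of its value
      at \<open>T\<close>, yet it is positive all along the tail.\<close>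
    have ex: "\<exists>t'\<ge>T. Im (G t') = y0 + pi \<or> Im (G t') = y0 - pi"
    proof (cases "pi \<le> Im (G t) - y0")
      case True
      then show ?thesis using IVT'[of "\<lambda>t. Im (G t)" T "y0 + pi" t] c t pi_gt_zero by (auto simp: y0_def)
    next
      case False
      then have "Im (G t) \<le> y0 - pi" using n by linarith
      then show ?thesis using IVT2'[of "\<lambda>t. Im (G t)" t "y0 - pi" T] c t pi_gt_zero by (auto simp: y0_def)
    qed
    then obtain t' where t': "T \<le> t'" "Im (G t') = y0 + pi \<or> Im (G t') = y0 - pi" by blast
    then have "cos (Im (G t')) = - cos (Im (G T))"
      by (auto simp: y0_def cos_add cos_diff)
    then show False using cos[OF t'(1)] cos[of T] by simp
  qed
  define R where "R = 2 + \<bar>Re (Ln b)\<bar> + \<bar>y0\<bar> + pi + \<bar>Im (Ln b)\<bar> + 1"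
  have Rpos: "0 < R" unfolding R_def using pi_gt_zero by linarith
  have box: "s t \<in> cbox (Complex 0 (-3)) (Complex (ln R) 3)" if t: "T \<le> t" for t
  proof -
    have sQ: "s t \<in> Q" using s t by (simp add: T_def)
    have 1: "\<bar>Re (\<kappa> (s t))\<bar> \<le> 1/5" "\<bar>Im (\<kappa> (s t))\<bar> \<le> 1/5"
      using \<kappa>_bound[OF sQ] abs_Re_le_cmod[of "\<kappa> (s t)"] abs_Im_le_cmod[of "\<kappa> (s t)"] by linarith+
    have 2: "Re (exp (s t)) = Re (G t) - Re (\<kappa> (s t)) + Re (Ln b)"
      "Im (exp (s t)) = Im (G t) - Im (\<kappa> (s t)) + Im (Ln b)" by (auto simp: G_def)
    \<comment> \<open>\<open>G\<close> supplies the upper bound for \<open>Re (exp (s t))\<close>,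
      membership in \<open>Q\<close> the lower one.\<close>
    have "0 < Re (exp (s t))" using Q_Re[OF sQ] L by linarith
    then have "\<bar>Re (exp (s t))\<bar> \<le> 1 + 1/5 + \<bar>Re (Ln b)\<bar>" using 1 2 Re_le[OF t] by linarith
    moreover have "\<bar>Im (exp (s t))\<bar> \<le> \<bar>y0\<bar> + pi + 1/5 + \<bar>Im (Ln b)\<bar>" using 1 2 Im_le[OF t] by linarith
    ultimately have "cmod (exp (s t)) \<le> R" using cmod_le[of "exp (s t)"] by (simp add: R_def)
    then have "exp (Re (s t)) \<le> exp (ln R)" using Rpos by simp
    then have "Re (s t) \<le> ln R" by simp
    then show ?thesis using Q_geometry[OF sQ] by (simp add: in_cbox_rect)
  qed
  have "compact (psi ` cbox (Complex 0 (-3)) (Complex (ln R) 3))"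
    using cbox_subset_strip[of 0 3 "ln R"]
    by (intro compact_continuous_image holomorphic_on_imp_continuous_on holomorphic_on_subset[OF holomorphic_psi]) auto
  then obtain B where B: "\<And>z. z \<in> psi ` cbox (Complex 0 (-3)) (Complex (ln R) 3) \<Longrightarrow> cmod z \<le> B"
    using compact_imp_bounded bounded_iff by metis
  have "\<forall>\<^sub>F t in at_top. B + 1 \<le> cmod (\<gamma> t)"
    using \<gamma>(2) by (simp add: filterlim_at_infinity_conv_norm_at_top filterlim_at_top)
  then obtain T2 where "\<And>t. T2 \<le> t \<Longrightarrow> B + 1 \<le> cmod (\<gamma> t)"
    by (auto simp: eventually_at_top_linorder)
  then have "B + 1 \<le> cmod (\<gamma> (max T T2))" by simp
  moreover have "cmod (\<gamma> (max T T2)) \<le> B"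
    using B[OF imageI[OF box[of "max T T2"]]] s(2)[of "max T T2"] by (simp add: T_def)
  ultimately show False by simp
qed

end

section \<open>Two tracts: the class and the discontinuities\<close>

lemma (in tract) Im_psi_real:
  assumes "w \<in> mid" "Im w = 0" shows "Im (psi w) = 0"
proof -
  have "w = of_real (Re w)" using assms(2) by (simp add: complex_eq_iff)
  moreover have "0 \<le> Re w" using assms(1) by (simp add: strip_def)
  ultimately have "psi w = of_real (psiR (Re w))" using psi_of_real by metis
  then show ?thesis by simp
qed

locale full_model = tract +
  fixes E H :: "complex \<Rightarrow> complex" and C L :: real
  assumes E: "E holomorphic_on UNIV" and H: "H holomorphic_on UNIV"
    and even: "\<And>z. E (- z) = E z" and odd: "\<And>z. H (- z) = - H z"
    and E_cnj: "\<And>z. E (cnj z) = cnj (E z)" and H_cnj: "\<And>z. H (cnj z) = cnj (H z)"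
    and H_nz: "\<exists>z. H z \<noteq> 0"
    and outside: "\<And>z. z \<notin> psi ` mid \<Longrightarrow> - z \<notin> psi ` mid \<Longrightarrow> cmod (E z) \<le> C / 2 \<and> cmod (H z) \<le> C / 2"
    and E_mid: "\<And>w. w \<in> mid \<Longrightarrow> cmod (E (psi w) - exp (exp w)) \<le> C / 2"
    and H_mid: "\<And>w. w \<in> mid \<Longrightarrow> cmod (H (psi w)) \<le> C / 2 * exp (max 0 (Re (exp w)) / 2)"
    and C: "0 \<le> C" "10 * C \<le> exp (L / 2)" and L: "3 \<le> L"
begin

definition f :: "complex \<Rightarrow> complex" where
  "f z = E z + H z"

lemma f: "f holomorphic_on UNIV"
  unfolding f_def[abs_def] by (intro holomorphic_intros E H)

lemma f_cnj: "f (cnj z) = cnj (f z)"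
  by (simp add: f_def E_cnj H_cnj)

lemma f_outside: "z \<notin> psi ` mid \<Longrightarrow> - z \<notin> psi ` mid \<Longrightarrow> cmod (f z) \<le> C"
  using outside[of z] norm_triangle_ineq[of "E z" "H z"] by (auto simp: f_def)

lemma inside_aux:
  assumes "w \<in> mid" "cmod h \<le> C / 2 * exp (max 0 (Re (exp w)) / 2)"
  shows "cmod (E (psi w) + h - exp (exp w)) \<le> C * exp (max 0 (Re (exp w)) / 2)"
proof -
  have "C / 2 * 1 \<le> C / 2 * exp (max 0 (Re (exp w)) / 2)" using C by (intro mult_left_mono) auto
  then show ?thesis
    using E_mid[OF assms(1)] assms(2) norm_triangle_ineq[of "E (psi w) - exp (exp w)" h]
    by (simp add: algebra_simps)
qed

sublocale right: half_model a f C L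
  by unfold_locales
     (use f C L in \<open>auto simp: f_def intro!: inside_aux H_mid\<close>)

sublocale left: half_model a "\<lambda>z. f (- z)" C L
proof
  show "cmod (f (- psi w) - exp (exp w)) \<le> C * exp (max 0 (Re (exp w)) / 2)" if "w \<in> mid" for w
    using inside_aux[OF that, of "- H (psi w)"] H_mid[OF that] by (simp add: f_def even odd)
qed (use f C L in \<open>auto intro: holomorphic_compose_uminus\<close>)

lemma C_less: "L \<le> M \<Longrightarrow> C < 2 * exp M"
proof -
  assume M: "L \<le> M"
  have "exp (L / 2) \<le> exp M" using M L by simp
  then show ?thesis using C exp_gt_zero[of M] by linarith
qed

lemma large_cases:
  assumes M: "L \<le> M" and z: "2 * exp M < cmod (f z)"
  obtains w where "w \<in> mid" "M < Re (exp w)" "z = psi w"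
    | w where "w \<in> mid" "M < Re (exp w)" "z = - psi w"
proof -
  have "z \<in> psi ` mid \<or> - z \<in> psi ` mid" using f_outside[of z] z C_less[OF M] by force
  then show ?thesis
  proof
    assume "z \<in> psi ` mid"
    then obtain w where w: "w \<in> mid" "z = psi w" by blast
    then show ?thesis using right.large_imp[OF w(1) M] z that(1) by blast
  next
    assume "- z \<in> psi ` mid"
    then obtain w where w: "w \<in> mid" "- z = psi w" by blast
    then have zw: "z = - psi w" by (metis minus_minus)
    then show ?thesis using left.large_imp[OF w(1) M] z w that(2) by auto
  qed
qed

lemma critical_values_bounded: "critical_values f \<subseteq> cball 0 (2 * exp (L + 1))"
proof
  fix c assume "c \<in> critical_values f"
  then obtain z where z: "c = f z" "deriv f z = 0" unfolding critical_values_def by blast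
  have "cmod (f z) \<le> 2 * exp (L + 1)"
  proof (rule ccontr)
    assume "\<not> cmod (f z) \<le> 2 * exp (L + 1)"
    then have *: "2 * exp (L + 1) < cmod (f z)" by simp
    have fd: "(f has_field_derivative deriv f x) (at x)" for x
      using f by (auto intro: holomorphic_derivI)
    have "L \<le> L + 1" by simp
    from large_cases[OF this *] show False
    proof cases
      case (1 w)
      then show False using right.deriv_g_nonzero[of w] z by simp
    next
      case (2 w)
      have "((\<lambda>z. f (- z)) has_field_derivative deriv f (- psi w) * (- 1)) (at (psi w))"
        by (rule DERIV_chain2[OF fd]) (auto intro!: derivative_eq_intros)
      then have "deriv (\<lambda>z. f (- z)) (psi w) = 0" using 2 z by (simp add: DERIV_imp_deriv)
      then show False using left.deriv_g_nonzero[of w] 2 by simp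
    qed
  qed
  then show "c \<in> cball 0 (2 * exp (L + 1))" using z by simp
qed

text \<open>The tail of a curve with a large limit value lies in the union of two disjoint open
  sets, one in each tract, hence by connectedness in only one, where
  \<open>no_asymptotic_value\<close> excludes it.\<close>

lemma asymptotic_values_bounded: "asymptotic_values f \<subseteq> cball 0 (2 * exp L)"
proof
  fix b assume "b \<in> asymptotic_values f"
  then obtain \<gamma> :: "real \<Rightarrow> complex" where \<gamma>: "continuous_on {0..} \<gamma>" "filterlim \<gamma> at_infinity at_top"
    "((\<lambda>t. f (\<gamma> t)) \<longlongrightarrow> b) at_top"
    unfolding asymptotic_values_def by blast
  show "b \<in> cball 0 (2 * exp L)"
  proof (rule ccontr)
    assume "b \<notin> cball 0 (2 * exp L)"
    then have b: "2 * exp L < cmod b" by simp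
    then have b0: "b \<noteq> 0" using exp_gt_zero[of L] by (metis less_asym mult_pos_pos norm_zero zero_less_numeral)
    have "\<forall>\<^sub>F t in at_top. 2 * exp L < cmod (f (\<gamma> t))"
      using order_tendstoD(1)[OF tendsto_norm[OF \<gamma>(3)] b] .
    then obtain T1 where T1: "\<And>t. T1 \<le> t \<Longrightarrow> 2 * exp L < cmod (f (\<gamma> t))"
      unfolding eventually_at_top_linorder by blast
    define T where "T = max 0 T1"
    let ?A = "psi ` right.Q" and ?B = "uminus ` psi ` left.Q"
    have cov: "\<gamma> t \<in> ?A \<or> \<gamma> t \<in> ?B" if t: "T \<le> t" for t
    proof -
      have "2 * exp L < cmod (f (\<gamma> t))" using T1 t by (simp add: T_def)
      from large_cases[OF order.refl this] show ?thesis
        by cases (auto simp: right.Q_def left.Q_def)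
    qed
    have sub: "right.Q \<subseteq> strip (-1) 4" "left.Q \<subseteq> strip (-1) 4"
      using right.Q_mid left.Q_mid mid_subset by blast+
    have op: "open ?A" "open (psi ` left.Q)"
      using sub right.open_Q left.open_Q
      by (auto intro!: open_mapping_thm3 holomorphic_on_subset[OF holomorphic_psi] inj_on_subset[OF inj_psi])
    then have opB: "open ?B" by (simp add: open_negations)
    have disj: "?A \<inter> ?B = {}"
      using right.Q_mid left.Q_mid Re_psi_mid by (force dest: Re_psi_mid)
    have cont: "continuous_on {T..} \<gamma>" using \<gamma>(1) by (rule continuous_on_subset) (auto simp: T_def)
    have conn: "connected (\<gamma> ` {T..})" by (intro connected_continuous_image cont) (simp add: is_interval_connected)
    have "?A \<inter> \<gamma> ` {T..} = {} \<or> ?B \<inter> \<gamma> ` {T..} = {}"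
    proof (rule connectedD[OF conn op(1) opB])
      show "?A \<inter> ?B \<inter> \<gamma> ` {T..} = {}" using disj by blast
      show "\<gamma> ` {T..} \<subseteq> ?A \<union> ?B" using cov by blast
    qed
    then show False
    proof
      assume "?B \<inter> \<gamma> ` {T..} = {}"
      then have "\<And>t. T \<le> t \<Longrightarrow> \<gamma> t \<in> ?A" using cov by blast
      then show False using right.no_asymptotic_value[OF cont \<gamma>(2,3) _ b0] by blast
    next
      assume "?A \<inter> \<gamma> ` {T..} = {}"
      then have "\<gamma> t \<in> ?B" if "T \<le> t" for t using cov[OF that] that by blast
      then have *: "- \<gamma> t \<in> psi ` left.Q" if "T \<le> t" for t using that by fastforce
      have "continuous_on {T..} (\<lambda>t. - \<gamma> t)" by (intro continuous_intros cont)
      moreover have "filterlim (\<lambda>t. - \<gamma> t) at_infinity at_top"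
        using \<gamma>(2) by (simp add: filterlim_at_infinity_conv_norm_at_top)
      moreover have "((\<lambda>t. f (- (- \<gamma> t))) \<longlongrightarrow> b) at_top" using \<gamma>(3) by simp
      ultimately show False using left.no_asymptotic_value[of T "\<lambda>t. - \<gamma> t" b] * b0 by blast
    qed
  qed
qed

lemma real_axis_in_Q: 
  assumes "10 * L \<le> exp x"
  shows "of_real x \<in> right.Q" "of_real x \<in> left.Q" "0 \<le> x"
proof -
  have "exp 1 < exp x" using assms L exp_le by linarith
  then have x: "1 < x" by simp
  have "L < exp x" using assms L by linarith
  then show "of_real x \<in> right.Q" "of_real x \<in> left.Q" "0 \<le> x"
    using x by (auto simp: right.Q_def left.Q_def strip_def Re_exp)
qed

lemma f_large:
  assumes x: "10 * L \<le> exp x"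
  shows "2 * exp L < cmod (f (psi (of_real x)))"
proof -
  have "2 * exp L \<le> exp 1 * exp L" using exp_ge_add_one_self[of 1] by (intro mult_right_mono) auto
  also have "\<dots> = exp (1 + L)" by (simp only: exp_add)
  also have "\<dots> < exp (exp x - 1/5)" using x L by simp
  also have "\<dots> \<le> cmod (f (psi (of_real x)))"
    unfolding right.norm_g[OF real_axis_in_Q(1)[OF x]] using right.Re_\<kappa>[OF real_axis_in_Q(1)[OF x]] by (simp add: Re_exp)
  finally show ?thesis .
qed

text \<open>The imaginary axis avoids both tracts, so \<open>f\<close> is bounded on it, which no
  nonconstant polynomial is. Constants are excluded by the large values inside a tract.\<close>

lemma f_transcendental: "transcendental_entire f"
  unfolding transcendental_entire_def
proof (intro conjI f notI)
  assume "\<exists>p. \<forall>z. f z = poly p z"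
  then obtain p where p: "\<And>z. f z = poly p z" by blast
  have im: "cmod (f (\<i> * of_real y)) \<le> C" for y
  proof (rule f_outside)
    show "\<i> * of_real y \<notin> psi ` mid" "- (\<i> * of_real y) \<notin> psi ` mid"
      by (auto dest!: Re_psi_mid simp: image_iff) (metis Re_psi_mid Re_i_times Im_complex_of_real less_irrefl minus_zero uminus_complex.sel(1))+
  qed
  obtain c q where pc: "p = pCons c q" by (cases p)
  show False
  proof (cases "q = 0")
    case True
    have "10 * L \<le> exp (ln (10 * L))" using L by simp
    from f_large[OF this] have "C < cmod (f (psi (of_real (ln (10 * L)))))" using C_less[of L] by simp
    then show False using im[of 0] p pc True by simp
  next
    case False
    then obtain r where r: "\<And>z. r \<le> cmod z \<Longrightarrow> C + 1 \<le> cmod (poly p z)"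
      using poly_infinity[of q "C + 1" c] pc by blast
    have "C + 1 \<le> cmod (f (\<i> * of_real \<bar>r\<bar>))" unfolding p by (intro r) (simp add: norm_mult)
    then show False using im[of "\<bar>r\<bar>"] by simp
  qed
qed

lemma f_class: "f \<in> eremenko_lyubich_class"
proof -
  have "bounded (critical_values f \<union> asymptotic_values f)"
    using critical_values_bounded asymptotic_values_bounded bounded_subset[OF bounded_cball]
    by (simp add: bounded_Un) blast
  then show ?thesis by (simp add: eremenko_lyubich_class_def f_transcendental)
qed

section \<open>The maximum modulus set beyond a fixed radius\<close>

lemma continuous_norm_f: "continuous_on S (\<lambda>z. cmod (f z))"
  using holomorphic_on_imp_continuous_on[OF f] continuous_on_subset by (intro continuous_intros) blast

lemma le_max_modulus: "cmod z = r \<Longrightarrow> cmod (f z) \<le> max_modulus r f"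
  unfolding max_modulus_def
  by (intro cSUP_upper compact_imp_bounded[THEN bounded_imp_bdd_above] compact_continuous_image continuous_norm_f)
     auto

lemma max_modulus_attained:
  assumes "0 \<le> r" obtains z where "cmod z = r" "z \<in> max_modulus_set f"
proof -
  have ne: "sphere (0::complex) r \<noteq> {}" using assms by (auto intro!: exI[of _ "of_real r"])
  obtain z where z: "z \<in> sphere 0 r" "\<And>y. y \<in> sphere 0 r \<Longrightarrow> cmod (f y) \<le> cmod (f z)"
    using continuous_attains_sup[OF compact_sphere ne continuous_norm_f] by blast
  then have "max_modulus r f \<le> cmod (f z)" unfolding max_modulus_def using ne by (intro cSUP_least) auto
  then show ?thesis using le_max_modulus[of z r] z that[of z] by (auto simp: max_modulus_set_def)
qed

text \<open>The modulus beyond which the positive real point has a parameter \<open>x\<close> with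
  \<open>exp x \<ge> 10 * L\<close>, as \<open>peak_on_real_axis\<close> demands.\<close>

definition R0 :: real where
  "R0 = psiR (ln (10 * L))"

lemma above_R0:
  assumes "R0 < r"
  obtains x where "psiR x = r" "10 * L \<le> exp x" "0 \<le> x" "psi (of_real x) = of_real r"
proof -
  have l0: "0 \<le> ln (10 * L)" using L by simp
  then have "0 \<le> R0" unfolding R0_def using psiR_mono[of 0 "ln (10 * L)"] by simp
  then obtain x where x: "0 \<le> x" "psiR x = r" using psiR_surj[of r] assms by auto
  have "ln (10 * L) \<le> x"
  proof (rule ccontr)
    assume "\<not> ln (10 * L) \<le> x"
    then have "psiR x \<le> psiR (ln (10 * L))" using x by (intro psiR_mono) auto
    then show False using assms x by (simp add: R0_def)
  qed
  then have "exp (ln (10 * L)) \<le> exp x" by simp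
  then have "10 * L \<le> exp x" using L by simp
  then show ?thesis using that x psi_of_real by blast
qed

lemma max_modulus_set_real:
  assumes z: "z \<in> max_modulus_set f" "R0 < cmod z"
  shows "Im z = 0"
proof -
  obtain x where x: "psiR x = cmod z" "10 * L \<le> exp x" "0 \<le> x" "psi (of_real x) = of_real (cmod z)"
    using above_R0[OF z(2)] .
  have M: "cmod (f z) = max_modulus (cmod z) f" using z by (simp add: max_modulus_set_def)
  have 1: "cmod (f (psi (of_real x))) \<le> cmod (f z)" "cmod (f (- psi (of_real x))) \<le> cmod (f z)"
    unfolding M x(4) by (auto intro!: le_max_modulus)
  then have "2 * exp L < cmod (f z)" using f_large[OF x(2)] by linarith
  from large_cases[OF order.refl this] show ?thesis
  proof cases
    case (1 w)
    have "cmod (f (psi (cnj w))) = cmod (f (psi w))"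
      using psi_cnj[OF mid_subset[OF 1(1)]] by (simp add: f_cnj)
    then have "Im w = 0"
      using right.peak_on_real_axis[OF x(2) 1(1)] 1 x \<open>cmod (f (psi (of_real x))) \<le> cmod (f z)\<close> by simp
    then show ?thesis using 1 Im_psi_real by simp
  next
    case (2 w)
    have "cmod (f (- psi (cnj w))) = cmod (f (- psi w))"
      using psi_cnj[OF mid_subset[OF 2(1)]] by (simp add: f_cnj flip: complex_cnj_minus)
    then have "Im w = 0"
      using left.peak_on_real_axis[OF x(2) 2(1)] 2 x \<open>cmod (f (- psi (of_real x))) \<le> cmod (f z)\<close> by simp
    then show ?thesis using 2 Im_psi_real by simp
  qed
qed

text \<open>\<open>2 * E r\<close> is the sum of the values of \<open>f\<close> at \<open>r\<close>
  and \<open>- r\<close>. Divided by \<open>exp (exp x)\<close>, each of them is within 1/10 of 1,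
  so they cannot cancel.\<close>

lemma E_nonzero: assumes "R0 < r" shows "E (of_real r) \<noteq> 0"
proof
  assume E0: "E (of_real r) = 0"
  obtain x where x: "psiR x = r" "10 * L \<le> exp x" "0 \<le> x" "psi (of_real x) = of_real r"
    using above_R0[OF assms] .
  let ?e = "exp (- exp (of_real x)) :: complex"
  have "f (of_real r) * ?e + f (- of_real r) * ?e = 0" by (simp add: f_def even odd E0)
  then have "(f (of_real r) * ?e - 1) + (f (- of_real r) * ?e - 1) = -2"
    by (simp add: algebra_simps)
  then have "cmod ((f (of_real r) * ?e - 1) + (f (- of_real r) * ?e - 1)) = 2" by simp
  moreover have "cmod (f (of_real r) * ?e - 1) \<le> 1/10" "cmod (f (- of_real r) * ?e - 1) \<le> 1/10"
    using right.small[OF real_axis_in_Q(1)[OF x(2)]] left.small[OF real_axis_in_Q(2)[OF x(2)]] x(4) by simp_all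
  ultimately show False
    using norm_triangle_ineq[of "f (of_real r) * ?e - 1" "f (- of_real r) * ?e - 1"] by linarith
qed

text \<open>Beyond \<open>R0\<close> the set is real, so a component containing
  \<open>\<epsilon> * r\<close> can reach smaller moduli only along that ray. A missing point
  \<open>\<epsilon> * s\<close> would disconnect it.\<close>

lemma component_reaches_down:
  assumes r: "R0 < r" and \<epsilon>: "\<epsilon> = 1 \<or> \<epsilon> = (-1::real)"
    and in_set: "of_real (\<epsilon> * r) \<in> max_modulus_set f" and no: "\<not> max_modulus_discontinuity f r"
  shows "\<exists>m<r. \<forall>s. m < s \<longrightarrow> s < r \<longrightarrow> of_real (\<epsilon> * s) \<in> max_modulus_set f"
proof -
  have R0_nonneg: "0 \<le> R0" unfolding R0_def using psiR_mono[of 0 "ln (10 * L)"] L by simp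
  define \<Gamma> where "\<Gamma> = connected_component_set (max_modulus_set f) (of_real (\<epsilon> * r))"
  have mem: "of_real (\<epsilon> * r) \<in> \<Gamma>" unfolding \<Gamma>_def using in_set by (simp add: connected_component_refl)
  have "\<Gamma> \<in> components (max_modulus_set f)" unfolding \<Gamma>_def using in_set by (rule componentsI)
  moreover have "cmod (of_real (\<epsilon> * r)) = r" using \<epsilon> r R0_nonneg by (auto simp: norm_mult)
  ultimately obtain w where w: "w \<in> \<Gamma>" "cmod w < r"
    using no mem r R0_nonneg unfolding max_modulus_discontinuity_def by force
  have conn: "connected \<Gamma>" unfolding \<Gamma>_def by (rule connected_connected_component)
  have sub: "\<Gamma> \<subseteq> max_modulus_set f" unfolding \<Gamma>_def by (rule connected_component_subset)
  show ?thesis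
  proof (intro exI[of _ "max R0 (cmod w)"] conjI allI impI)
    show "max R0 (cmod w) < r" using w r by simp
    fix s assume s: "max R0 (cmod w) < s" "s < r"
    show "of_real (\<epsilon> * s) \<in> max_modulus_set f"
    proof (rule ccontr)
      assume out: "of_real (\<epsilon> * s) \<notin> max_modulus_set f"
      \<comment> \<open>The second set takes in the opposite half-plane as well, so that the two
        sets cover the component even where it meets the other ray.\<close>
      let ?A = "{z. s < cmod z} \<inter> {z. 0 < \<epsilon> * Re z}" and ?B = "{z. cmod z < s} \<union> {z. \<epsilon> * Re z < 0}"
      have "open ?A" "open ?B"
        by (intro open_Int open_Un open_Collect_less continuous_intros)+
      moreover have "?A \<inter> ?B \<inter> \<Gamma> = {}" by auto
      moreover have "\<Gamma> \<subseteq> ?A \<union> ?B"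
      proof
        fix z assume z: "z \<in> \<Gamma>"
        show "z \<in> ?A \<union> ?B"
        proof (rule ccontr)
          assume n: "z \<notin> ?A \<union> ?B"
          then have 1: "s \<le> cmod z" "0 \<le> \<epsilon> * Re z" by auto
          then have "R0 < cmod z" using s by simp
          then have "Im z = 0" using max_modulus_set_real z sub by blast
          then have zr: "z = of_real (Re z)" "cmod z = \<bar>Re z\<bar>" by (auto simp: complex_eq_iff cmod_def)
          then have "\<epsilon> * Re z = cmod z" using 1(2) \<epsilon> by auto
          then have "cmod z = s" using n 1 s R0_nonneg by auto
          then have "Re z = \<epsilon> * s" using \<open>\<epsilon> * Re z = cmod z\<close> \<epsilon> by auto
          then have "of_real (\<epsilon> * s) \<in> \<Gamma>" using zr z by metis
          then show False using out sub by blast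
        qed
      qed
      ultimately have "?A \<inter> \<Gamma> = {} \<or> ?B \<inter> \<Gamma> = {}"
        using connectedD[OF conn, of ?A ?B] by blast
      moreover have "of_real (\<epsilon> * r) \<in> ?A" using s \<epsilon> R0_nonneg by (auto simp: norm_mult)
      moreover have "w \<in> ?B" using s by simp
      ultimately show False using mem w by blast
    qed
  qed
qed

lemma f_discontinuity:
  assumes r: "R0 < r" and H0: "H (of_real r) = 0"
  shows "max_modulus_discontinuity f r"
proof (rule ccontr)
  assume no: "\<not> max_modulus_discontinuity f r"
  have R0_nonneg: "0 \<le> R0" unfolding R0_def using psiR_mono[of 0 "ln (10 * L)"] L by simp
  have feq: "f (- of_real r) = f (of_real r)" by (simp add: f_def even odd H0)
  \<comment> \<open>The maximum on the circle is attained, necessarily at \<open>r\<close> or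
    \<open>- r\<close>; since \<open>f\<close> agrees at these two points, both belong to the
    set.\<close>
  obtain z where z: "cmod z = r" "z \<in> max_modulus_set f" using max_modulus_attained[of r] r R0_nonneg by auto
  then have "Im z = 0" using max_modulus_set_real r by simp
  then have "z = of_real r \<or> z = - of_real r" using z(1) by (auto simp: complex_eq_iff cmod_def)
  then have "of_real (1 * r) \<in> max_modulus_set f" "of_real ((-1) * r) \<in> max_modulus_set f"
    using z(2) feq by (auto simp: max_modulus_set_def)
  then obtain m1 m2 where m: "m1 < r" "\<And>s. m1 < s \<Longrightarrow> s < r \<Longrightarrow> of_real (1 * s) \<in> max_modulus_set f"
     "m2 < r" "\<And>s. m2 < s \<Longrightarrow> s < r \<Longrightarrow> of_real ((-1) * s) \<in> max_modulus_set f"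
    using component_reaches_down[OF r _ _ no, of 1] component_reaches_down[OF r _ _ no, of "-1"] by blast
  define m where "m = max R0 (max m1 m2)"
  have mr: "m < r" using m r by (simp add: m_def)
  have H_zero: "H (of_real s) = 0" if s: "m < s" "s < r" for s
  proof -
    have "cmod (f (of_real s)) = cmod (f (- of_real s))"
      using m(2)[of s] m(4)[of s] s by (simp add: m_def max_modulus_set_def)
    moreover have "\<exists>e h. E (of_real s) = of_real e \<and> H (of_real s) = of_real h"
      using E_cnj[of "of_real s"] H_cnj[of "of_real s"] by (metis Reals_cases Reals_cnj_iff complex_cnj_complex_of_real)
    then obtain e h where eh: "E (of_real s) = of_real e" "H (of_real s) = of_real h" by blast
    ultimately have "cmod (of_real (e + h)) = cmod (of_real (e - h))"
      by (simp add: f_def even odd)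
    then have "\<bar>e + h\<bar> = \<bar>e - h\<bar>" by (simp only: norm_of_real)
    moreover have "e \<noteq> 0" using E_nonzero[of s] s eh by (auto simp: m_def)
    ultimately have "h = 0" by (auto simp: abs_if split: if_splits)
    then show ?thesis using eh by simp
  qed
  define c where "c = (m + r) / 2"
  have c: "m < c" "c < r" using mr by (auto simp: c_def field_simps)
  have "H z = 0" for z
  proof (rule analytic_continuation[OF H open_UNIV connected_UNIV, of "of_real ` {m<..<r}" "of_real c"])
    show "(of_real c :: complex) islimpt of_real ` {m<..<r}"
    proof (rule islimptI)
      fix T assume T: "(of_real c :: complex) \<in> T" "open T"
      then have "open (of_real -` T :: real set)" by (intro open_vimage) (auto intro!: continuous_intros)
      then obtain d where d: "0 < d" "ball c d \<subseteq> of_real -` T"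
        using T(1) open_contains_ball by (metis vimageI)
      obtain e where e: "0 < e" "e < d" "e < r - c"
        using d c field_lbound_gt_zero[of d "r - c"] by auto
      define y where "y = c + e"
      have "\<bar>c - y\<bar> < d" "c < y" "y < r" using e by (auto simp: y_def)
      then have "y \<in> ball c d" by (simp add: dist_real_def)
      then show "\<exists>y\<in>of_real ` {m<..<r}. y \<in> T \<and> y \<noteq> of_real c"
        using d c \<open>c < y\<close> \<open>y < r\<close> \<open>y \<in> ball c d\<close> by (intro bexI[of _ "of_real y"]) auto
    qed
    show "\<And>z. z \<in> of_real ` {m<..<r} \<Longrightarrow> H z = 0" using H_zero by auto
  qed auto
  then show False using H_nz by blast
qed

end

section \<open>Fitting the tract to the prescribed moduli\<close>

lemma strictly_increasing_cover:
  fixes r :: "nat \<Rightarrow> real"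
  assumes "incseq r" "filterlim r at_top sequentially"
  obtains \<rho> where "strict_mono \<rho>" "range \<rho> \<subseteq> range r" "range r \<subseteq> range \<rho>" "filterlim \<rho> at_top sequentially"
proof -
  \<comment> \<open>\<open>incseq\<close> allows repeated values, which would leave no gap between
    consecutive preimages; only first occurrences are kept.\<close>
  define I where "I = {n. \<forall>m<n. r m \<noteq> r n}"
  have rep: "\<exists>m\<in>I. r m = r n" for n
  proof -
    obtain m where m: "r m = r n" "\<And>k. k < m \<Longrightarrow> r k \<noteq> r n"
      using exists_least_iff[of "\<lambda>m. r m = r n"] by blast
    then show ?thesis unfolding I_def by (intro bexI[of _ m]) auto
  qed
  have less: "r m < r n" if "m < n" "n \<in> I" for m n
    using that incseqD[OF assms(1), of m n] by (auto simp: I_def order_less_le)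
  have inf: "infinite I"
  proof
    assume "finite I"
    then have "finite (r ` I)" by simp
    moreover have "range r \<subseteq> r ` I" using rep by (metis image_iff image_subsetI)
    ultimately have "finite (range r)" using finite_subset by blast
    then have "bdd_above (range r)" by simp
    then obtain B where "\<And>n. r n \<le> B" by (auto simp: bdd_above_def)
    moreover obtain n where "B < r n"
      using assms(2) by (auto simp: filterlim_at_top_dense eventually_sequentially)
    ultimately show False by (simp add: leD)
  qed
  define \<rho> where "\<rho> k = r (enumerate I k)" for k
  have sm: "strict_mono (enumerate I)" using inf by (rule strict_mono_enumerate)
  show ?thesis
  proof (rule that[of \<rho>])
    show "strict_mono \<rho>"
      by (rule strict_monoI) (auto simp: \<rho>_def intro!: less strict_monoD[OF sm] enumerate_in_set inf)
    show "range \<rho> \<subseteq> range r" by (auto simp: \<rho>_def)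
    show "range r \<subseteq> range \<rho>"
    proof (rule image_subsetI)
      fix n
      obtain m where m: "m \<in> I" "r m = r n" using rep by blast
      then obtain k where "enumerate I k = m" using enumerate_Ex[of I m] inf by blast
      then show "r n \<in> range \<rho>" using m by (metis \<rho>_def rangeI)
    qed
    show "filterlim \<rho> at_top sequentially"
      unfolding \<rho>_def using filterlim_compose[OF assms(2) filterlim_subseq[OF sm]] .
  qed
qed

text \<open>For the index \<open>n\<close>, the first \<open>K\<close> terms, with \<open>K\<close>
  the integer part of \<open>\<rho> n / 2\<close>, are each at most 1. For every later
  \<open>k\<close> the index \<open>n\<close> lies in \<open>J k\<close>, so \<open>a k\<close> is
  large enough to make the term at most \<open>\<rho> n / 4 * 2^-k\<close>. Each group adds at most
  \<open>\<rho> n / 2\<close>. As \<open>\<rho>\<close> tends to infinity, \<open>J k\<close> is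
  finite and one \<open>a k\<close> can serve all its members.\<close>

lemma slow_tract:
  fixes \<rho> N :: "nat \<Rightarrow> real"
  assumes \<rho>: "\<And>n. 0 < \<rho> n" "filterlim \<rho> at_top sequentially" and N: "\<And>n. 0 \<le> N n"
  obtains a where "tract a" "\<And>n. tract.psiR a (N n) \<le> \<rho> n"
proof -
  define J where "J k = {n. \<rho> n \<le> 2 * real (Suc k)}" for k
  have finJ: "finite (J k)" for k
  proof -
    obtain n0 where "\<And>n. n0 \<le> n \<Longrightarrow> 2 * real (Suc k) < \<rho> n"
      using \<rho>(2) unfolding filterlim_at_top_dense eventually_sequentially by metis
    then have "J k \<subseteq> {..<n0}" by (force simp: J_def not_le[symmetric])
    then show ?thesis using finite_subset by blast
  qed
  define a where "a k = 10 * 2 ^ k + (\<Sum>n\<in>J k. 2 ^ (k + 2) * N n / \<rho> n)" for k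
  have nn: "0 \<le> 2 ^ (k + 2) * N n / \<rho> n" for k n
    using N[of n] \<rho>(1)[of n] by simp
  interpret tract a
  proof
    show "10 * 2 ^ k \<le> a k" for k
      unfolding a_def using nn by (simp add: sum_nonneg)
  qed
  have "psiR (N n) \<le> \<rho> n" for n
  proof -
    define K where "K = nat \<lfloor>\<rho> n / 2\<rfloor>"
    have K: "real K \<le> \<rho> n / 2" "\<rho> n / 2 < real K + 1"
      unfolding K_def using \<rho>(1)[of n] by linarith+
    let ?b = "\<lambda>k. if k < K then 1 else (0::real)"
    have b: "?b sums (\<Sum>k<K. 1)" using sums_If_finite_set[of "{..<K}" "\<lambda>_. 1::real"] by simp
    have g: "(\<lambda>k. \<rho> n / 4 * (1/2) ^ k) sums (\<rho> n / 4 * (1 / (1 - 1/2)))"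
      by (intro sums_mult geometric_sums) simp
    have s: "(\<lambda>k. ?b k + \<rho> n / 4 * (1/2) ^ k) sums (real K + \<rho> n / 2)"
      using sums_add[OF b g] by simp
    have "psiR (N n) \<le> (\<Sum>k. ?b k + \<rho> n / 4 * (1/2) ^ k)"
      unfolding psiR_def
    proof (rule suminf_le)
      fix k
      show "N n / (N n + a k) \<le> ?b k + \<rho> n / 4 * (1/2) ^ k"
      proof (cases "k < K")
        case True
        have "N n / (N n + a k) \<le> 1" using N[of n] a_pos[of k] by simp
        moreover have "0 \<le> \<rho> n / 4 * (1/2) ^ k" using \<rho>(1)[of n] by simp
        ultimately show ?thesis using True by simp
      next
        case False
        then have "\<rho> n \<le> 2 * real (Suc k)" using K by simp
        then have "n \<in> J k" by (simp add: J_def)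
        then have "2 ^ (k + 2) * N n / \<rho> n \<le> (\<Sum>n\<in>J k. 2 ^ (k + 2) * N n / \<rho> n)"
          using finJ nn by (intro member_le_sum) auto
        then have "2 ^ (k + 2) * N n / \<rho> n \<le> a k" unfolding a_def by (simp add: add_increasing)
        then have "2 ^ (k + 2) * N n \<le> a k * \<rho> n" using \<rho>(1)[of n] by (simp add: field_simps)
        then have "N n \<le> \<rho> n / 4 * (1/2) ^ k * a k" by (simp add: field_simps power_divide)
        also have "\<dots> \<le> \<rho> n / 4 * (1/2) ^ k * (N n + a k)"
          using \<rho>(1)[of n] N[of n] by (intro mult_left_mono) auto
        finally have "N n / (N n + a k) \<le> \<rho> n / 4 * (1/2) ^ k"
          using N[of n] a_pos[of k] by (simp add: pos_divide_le_eq add_nonneg_pos)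
        then show ?thesis using False by simp
      qed
    qed (use N summable_psiR sums_summable[OF s] in auto)
    also have "\<dots> = real K + \<rho> n / 2" using s by (rule sums_unique[symmetric])
    finally show ?thesis using K by simp
  qed
  then show ?thesis using that tract_axioms by blast
qed

theorem theorem1p2:
  fixes r :: "nat \<Rightarrow> real"
  assumes "incseq r"
    and "\<And>n. r n > 0"
    and "filterlim r at_top sequentially"
  shows "\<exists>f \<in> eremenko_lyubich_class. \<forall>n. max_modulus_discontinuity f (r n)"
proof -
  obtain \<rho> where \<rho>: "strict_mono \<rho>" "range \<rho> \<subseteq> range r" "range r \<subseteq> range \<rho>" "filterlim \<rho> at_top sequentially"
    using strictly_increasing_cover[OF assms(1,3)] .
  have \<rho>_pos: "0 < \<rho> n" for n
    using \<rho>(2) assms(2) by (metis image_subset_iff rangeE UNIV_I)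
  have \<rho>_less: "\<rho> n < \<rho> (Suc n)" for n using \<rho>(1) by (simp add: strict_mono_Suc_iff)
  obtain u where u: "amp_threshold u" using amp_threshold_exists by blast
  then have u10: "10 \<le> u" by (simp add: amp_threshold_def)
  define C where "C = 400 * decay_const"
  define L where "L = max 3 (2 * ln (10 * C))"
  have C: "0 < C" using decay_const_ge_1 by (simp add: C_def)
  have L: "3 \<le> L" "10 * C \<le> exp (L / 2)"
  proof -
    show "3 \<le> L" by (simp add: L_def)
    have "10 * C = exp (ln (10 * C))" using C by simp
    also have "\<dots> \<le> exp (L / 2)" unfolding exp_le_cancel_iff L_def by simp
    finally show "10 * C \<le> exp (L / 2)" .
  qed
  \<comment> \<open>The sum collects everything demanded of the \<open>n\<close>-th preimage: a zero
    of the odd part close enough, a position beyond \<open>ln (10 * L)\<close> and hence beyond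
    \<open>R0\<close>, and a gap of 3 to the next preimage. It is fixed before
    \<open>a\<close>.\<close>
  define N where "N n = u + 2 + 400 * 2 ^ n + ln (10 * L) + 1 + 3 * \<rho> (Suc n) / (\<rho> (Suc n) - \<rho> n)" for n
  have l0: "0 \<le> ln (10 * L)" using L by simp
  have q0: "0 < 3 * \<rho> (Suc n) / (\<rho> (Suc n) - \<rho> n)" for n
    using \<rho>_less[of n] \<rho>_pos[of "Suc n"] by simp
  have N_ge: "u + 2 + 400 * 2 ^ n \<le> N n" "ln (10 * L) < N n" "3 * \<rho> (Suc n) / (\<rho> (Suc n) - \<rho> n) \<le> N n" "0 < N n" for n
  proof -
    have "0 < (2::real) ^ n" by simp
    then show "u + 2 + 400 * 2 ^ n \<le> N n" "ln (10 * L) < N n" "3 * \<rho> (Suc n) / (\<rho> (Suc n) - \<rho> n) \<le> N n" "0 < N n"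
      unfolding N_def using u10 l0 q0[of n] by linarith+
  qed
  obtain a where a: "tract a" "\<And>n. tract.psiR a (N n) \<le> \<rho> n"
    using slow_tract[of \<rho> N] \<rho>_pos \<rho>(4) N_ge(4) less_imp_le by metis
  interpret tract a by (rule a(1))
  have "\<exists>x. 0 \<le> x \<and> psiR x = \<rho> n" for n using psiR_surj[of "\<rho> n"] \<rho>_pos[of n] by (metis less_imp_le)
  then obtain s where s: "\<And>n. 0 \<le> s n" "\<And>n. psiR (s n) = \<rho> n" by metis
  have sN: "N n \<le> s n" for n
  proof (rule ccontr)
    assume "\<not> N n \<le> s n"
    then have "psiR (s n) < psiR (N n)" using s by (intro psiR_strict_mono) auto
    then show False using a(2)[of n] s by simp
  qed
  have s_less: "s n < s (Suc n)" for n
  proof (rule ccontr)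
    assume "\<not> s n < s (Suc n)"
    then have "psiR (s (Suc n)) \<le> psiR (s n)" using s by (intro psiR_mono) auto
    then show False using s \<rho>_less[of n] by simp
  qed
  have gap: "s n + 3 \<le> s (Suc n)" for n
  proof -
    have sp: "0 < s n" using sN[of n] N_ge(4)[of n] by linarith
    \<comment> \<open>The slope of \<open>psiR\<close> between the two preimages is at most
      \<open>\<rho> (Suc n) / N n\<close>, so climbing from \<open>\<rho> n\<close> to
      \<open>\<rho> (Suc n)\<close> takes a length of at least 3 by the last summand of
      \<open>N n\<close>.\<close>
    have "norm (psiR (s (Suc n)) - psiR (s n)) \<le> \<rho> (Suc n) / N n * norm (s (Suc n) - s n)"
    proof (rule field_differentiable_bound[of "{s n..s (Suc n)}"])
      fix y assume y: "y \<in> {s n..s (Suc n)}"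
      then have y0: "0 < y" using sp by auto
      show "(psiR has_field_derivative lam (of_real y)) (at y within {s n..s (Suc n)})"
        using y0 s(1)[of n] by (intro DERIV_subset[OF psiR_has_derivative]) auto
      have "lam (of_real y) \<le> psiR y / y" using y0 by (rule lam_of_real_le)
      also have "\<dots> \<le> \<rho> (Suc n) / N n"
      proof (rule frac_le)
        show "psiR y \<le> \<rho> (Suc n)" using y y0 s(2)[of "Suc n"] psiR_mono[of y "s (Suc n)"] by auto
        show "N n \<le> y" using y sN[of n] by simp
      qed (use \<rho>_pos N_ge(4) less_imp_le in auto)
      finally show "norm (lam (of_real y)) \<le> \<rho> (Suc n) / N n"
        using lam_pos[of "of_real y"] y0 by simp
    qed (use s_less[of n] in auto)
    then have "\<rho> (Suc n) - \<rho> n \<le> \<rho> (Suc n) / N n * (s (Suc n) - s n)"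
      using s_less[of n] \<rho>_less[of n] by (simp add: s)
    then have "(\<rho> (Suc n) - \<rho> n) * N n \<le> \<rho> (Suc n) * (s (Suc n) - s n)"
      using N_ge(4)[of n] by (simp add: field_simps)
    moreover have "3 * \<rho> (Suc n) \<le> (\<rho> (Suc n) - \<rho> n) * N n"
      using N_ge(3)[of n] \<rho>_less[of n] by (simp add: pos_divide_le_eq mult.commute)
    ultimately have "\<rho> (Suc n) * 3 \<le> \<rho> (Suc n) * (s (Suc n) - s n)" by linarith
    then show ?thesis using \<rho>_pos[of "Suc n"] by simp
  qed
  have s_large: "u + 2 + 400 * 2 ^ n \<le> s n" for n using N_ge(1)[of n] sN[of n] by linarith
  obtain E H where EH: "E holomorphic_on UNIV" "H holomorphic_on UNIV"
    "\<And>z. E (- z) = E z" "\<And>z. H (- z) = - H z" "\<And>z. E (cnj z) = cnj (E z)" "\<And>z. H (cnj z) = cnj (H z)"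
    "\<And>n. H (of_real (psiR (s n))) = 0" "\<exists>z. H z \<noteq> 0"
    "\<And>z. z \<notin> psi ` mid \<Longrightarrow> - z \<notin> psi ` mid \<Longrightarrow> cmod (E z) \<le> 200 * decay_const \<and> cmod (H z) \<le> 200 * decay_const"
    "\<And>w. w \<in> mid \<Longrightarrow> cmod (E (psi w) - exp (exp w)) \<le> 200 * decay_const"
    "\<And>w. w \<in> mid \<Longrightarrow> cmod (H (psi w)) \<le> 200 * decay_const * exp (max 0 (Re (exp w)) / 2)"
    using model_functions[OF u s_large gap] by blast
  interpret full_model a E H C L
    by unfold_locales (use EH C L in \<open>auto simp: C_def\<close>)
  show ?thesis
  proof (rule bexI[OF _ f_class], rule allI)
    fix n
    obtain k where k: "r n = \<rho> k" using \<rho>(3) by blast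
    have "R0 < \<rho> k"
    proof -
      have "R0 < psiR (s k)"
        unfolding R0_def using l0 N_ge(2)[of k] sN[of k] by (intro psiR_strict_mono) auto
      then show ?thesis by (simp add: s)
    qed
    then show "max_modulus_discontinuity f (r n)"
      unfolding k using EH(7)[of k] by (intro f_discontinuity) (auto simp: s)
  qed
qed

end
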